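(* Let $\mathcal C$ be an $\epsilon$-rational curve of proper degree $d>2$ and let $\overline{\mathcal P}^{\Delta}(\Delta,t)$ be the associated pair of rational functions, all as set up in the context; let $m=6$ if $d>3$ and $m=3$ if $d=3$. There exists a non-empty Zariski open subset $\Omega$ of $\mathbb C^m$ such that if $\Delta_0\in\Omega$ then $\overline{\mathcal P}^{\Delta}(\Delta_0,t)$ is a rational parametrization of a rational curve of degree at most $d$.
   Context: **Notation.** $0<\epsilon<1$ is fixed. $\|\cdot\|$ is the $\infty$-norm of a polynomial, $\|\cdot\|_2$ the unitary norm on $\mathbb C^2$. For $\vec v=(i,j)\in\mathbb N^2$, $|\vec v|=i+j$ and $g^{\vec v}=\partial^{i+j}g/\partial x^i\partial y^j$; $\vec e_1=(1,0)$, $\vec e_2=(0,1)$. **The curve.** $\mathcal C$ is a real affine plane curve over $\mathbb C$ defined by $f\in\mathbb R[x,y]$, with homogenization $F(x,y,z)$ and projective closure $\mathcal C^h$. Standing assumptions: $f$ is $\epsilon$-irreducible (not of the form $gh+\mathcal E$ with $g,h,\mathcal E\in\mathbb C[x,y]$, $g,h$ non-constant, and $\|\mathcal E\|<\epsilon\|f\|$; so $f$ is irreducible) and of proper degree $d>2$ (total degree $d$, and $|f^{\vec v}|>\epsilon\|f\|$ for some $|\vec v|=d$); $\mathcal C^h$ has no singular points at infinity (on $z=0$); $(1:0:0),(0:1:0)\notin\mathcal C^h$; $\mathcal C$ is $\epsilon$-rational, as follows. **$\epsilon$-points.** $P\in\mathbb C^2$ is an $\epsilon$-point of $\mathcal C$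 if $|f(P)|<\epsilon\|f\|$. Its $\epsilon$-multiplicity is the smallest $r$ such that $|f^{\vec v}(P)|<\epsilon\|f\|$ for all $|\vec v|\le r-1$ and $|f^{\vec v}(P)|\ge\epsilon\|f\|$ for some $|\vec v|=r$; $P$ is $\epsilon$-simple if $r=1$. $P$ is $k$-pure ($k\in\{1,2\}$) if $r>1$ and $|f^{r\vec e_k}(P)|\ge\epsilon\|f\|$; then $\mathrm{weight}_k(P)=\max_{0\le i\le r-1}\left|\frac{r!\,f^{i\vec e_k}(P)}{i!\,f^{r\vec e_k}(P)}\right|^{1/(r-i)}$, and $\mathrm{weight}(P)$ is the maximum of the $k$-weights over the $k$ for which $P$ is $k$-pure. With $\mathcal R_{\rm out}(x)=\frac12-\frac{x(1-9x)}{2(1+3x)}-\frac{32x^2}{(1+3x)^3}$, $\mathrm{radius}(P)=\mathcal R_{\rm out}(\mathrm{weight}(P))$ if $P$ is pure and $0$ otherwise. **$\epsilon$-singular locus.** $\mathcal S_1$ is the set of solutions, under fixed precision $\epsilon\|f\|$, of $f=f^{\vec e_1}=f^{\vec e_2}=0$. For $2\le k\le d-1$ choose $\vec u_1,\dots,\vec u_s$ ($2\le s\le k+1$) with $|\vec u_i|=k$ and $\gcd(f^{\vec u_1},\dots,f^{\vec u_s})=1$, let $\mathcal A_k$ be the set of solutions of $f^{\vec u_1}=\dots=f^{\vec u_s}=0$ under precision $\epsilon\|f\|$, and let $\mathcal S_k$ be the set of $P\in\mathcal A_k$ with $|f^{\vec w}(P)|<\epsilon\|f\|$ for all $|\vec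 w|\le k$ ($\mathcal S_k=\emptyset$ if no such choice exists). $\mathrm{Sing}_\epsilon(\mathcal C)=\bigcup_{k=1}^{d-1}\mathcal S_k$. **Clusters and $\epsilon$-rationality.** Write $P\sim Q$ if $\|P-Q\|_2+|\mathrm{radius}(P)-\mathrm{radius}(Q)|<\mathcal R_{\rm out}(\epsilon)$. The cluster of $P\in\mathrm{Sing}_\epsilon(\mathcal C)$ is the set of $Q\in\mathrm{Sing}_\epsilon(\mathcal C)$ with $P\sim Q$, or with $P'\sim P$ and $P'\sim Q$ for some $P'\in\mathrm{Sing}_\epsilon(\mathcal C)$. A representative of a cluster is a point of maximum $\epsilon$-multiplicity in it having least $|f|$ among such points; the $\epsilon$-multiplicity of the cluster is that of its representative. Let the cluster decomposition of $\mathrm{Sing}_\epsilon(\mathcal C)$ consist of $s$ clusters with representatives $Q_i=(q_{i,1}:q_{i,2}:1)$ and $\epsilon$-multiplicities $r_i$. $\mathcal C$ is $\epsilon$-rational if $(d-1)(d-2)-\sum_{i=1}^s r_i(r_i-1)=0$. **The pencil.** $P_j=(p_{j,1}:p_{j,2}:1)$, $1\le j\le d-3$, are $\epsilon$-simple points of $\mathcal C$. Consider the linear system of projective curves of degree $d-2$ having each $Q_i$ as base point of multiplicity $r_i-1$ and passing through each $P_j$; it is assumed to have dimension $1$ (if necessary after imposing further $\epsilon$-simple points or slightly perturbing the points), with defining polynomial $H_1(x,y,z)+tH_2(x,y,z)$, $H_1,H_2$ homogeneous of degree $d-2$. It is assumed (if necessary after replacing $H_2$ by $H_2+\rho_1x^{d-2}+\rho_2y^{d-2}$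 for suitable small $\rho_1,\rho_2$) that the curve $H_2=0$ and $\mathcal C^h$ have no common points at infinity. **Perturbed construction.** If $d>3$, $\Delta=(\delta_1,\dots,\delta_6)$ are parameters and $G(\Delta,x,y,z)=\delta_1y^{d-2}+\delta_2y^{d-3}z+\delta_3x^{d-2}+\delta_4x^{d-3}z+\delta_5x^{d-3}y+\delta_6xy^{d-3}$; if $d=3$, $\Delta=(\delta_1,\delta_2,\delta_3)$ and $G=\delta_1y+\delta_2z+\delta_3x$. Put $\overline H^{**}(\Delta,t,x,y,z)=H_1+tH_2+G$, $S_1^\Delta(\Delta,x,t)=\mathrm{Res}_y(\overline H^{**}(\Delta,t,x,y,1),f)$, $S_2^\Delta(\Delta,y,t)=\mathrm{Res}_x(\overline H^{**}(\Delta,t,x,y,1),f)$, $A_1(x)=\prod_{i=1}^s(x-q_{i,1})^{r_i(r_i-1)}\prod_{j=1}^{d-3}(x-p_{j,1})$, $A_2(y)=\prod_{i=1}^s(y-q_{i,2})^{r_i(r_i-1)}\prod_{j=1}^{d-3}(y-p_{j,2})$ (both of degree $d(d-2)-1$). $B_1^\Delta(\Delta,x,t)$ is the quotient of the division of $S_1^\Delta$ by $A_1$ with respect to $x$, and $B_2^\Delta(\Delta,y,t)$ the quotient of $S_2^\Delta$ by $A_2$ with respect to $y$. The polynomials $S_1^\Delta$, $S_2^\Delta$ have degree $d(d-2)$ in $x$, $y$ respectively, so $B_1^\Delta$ is linear in $x$ and $B_2^\Delta$ is linear in $y$. The components of $\overline{\mathcal P}^{\Delta}(\Delta,t)$ are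 the root of $B_1^\Delta$ as a polynomial in $x$ and the root of $B_2^\Delta$ as a polynomial in $y$. "Rational parametrization" means that the two components are not both constant. *)

theory Defs
  imports
    "HOL-Analysis.Analysis"
    "HOL-Library.Poly_Mapping"
    "HOL-Computational_Algebra.Computational_Algebra"
    "Subresultants.Resultant_Prelim"
begin

text \<open>
  Polynomials in several variables are nested univariate polynomials with the first variable
  innermost: an element of \<open>R[x,y]\<close> is an \<open>'a poly poly\<close>, an element of \<open>R[x,y,z]\<close> an
  \<open>'a poly poly poly\<close>.
\<close>

type_synonym point = "complex \<times> complex"
type_synonym mindex = "nat \<times> nat"

subsection \<open>Polynomials in two and three variables\<close>

definition coeff2 :: "'a::zero poly poly \<Rightarrow> nat \<Rightarrow> nat \<Rightarrow> 'a" where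
  "coeff2 f i j = coeff (coeff f j) i"

definition coeff3 :: "'a::zero poly poly poly \<Rightarrow> nat \<Rightarrow> nat \<Rightarrow> nat \<Rightarrow> 'a" where
  "coeff3 H i j k = coeff (coeff (coeff H k) j) i"

definition monom2 :: "'a::zero \<Rightarrow> nat \<Rightarrow> nat \<Rightarrow> 'a poly poly" where
  "monom2 c i j = monom (monom c i) j"

definition monom3 :: "'a::zero \<Rightarrow> nat \<Rightarrow> nat \<Rightarrow> nat \<Rightarrow> 'a poly poly poly" where
  "monom3 c i j k = monom (monom (monom c i) j) k"

definition eval2 :: "complex poly poly \<Rightarrow> point \<Rightarrow> complex" where
  "eval2 f P = poly (poly f [:snd P:]) (fst P)"

definition eval3 :: "complex poly poly poly \<Rightarrow> complex \<Rightarrow> complex \<Rightarrow> complex \<Rightarrow> complex" where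
  "eval3 H a b c = poly (poly (poly H [:[:c:]:]) [:b:]) a"

definition total_degree :: "complex poly poly \<Rightarrow> nat" where
  "total_degree f = Max (insert 0 {i + j |i j. coeff2 f i j \<noteq> 0})"

definition max_norm :: "complex poly poly \<Rightarrow> real" where
  "max_norm f = Max (range (\<lambda>(i, j). cmod (coeff2 f i j)))"

definition ord :: "mindex \<Rightarrow> nat" where
  "ord v = fst v + snd v"

definition pdiff :: "mindex \<Rightarrow> complex poly poly \<Rightarrow> complex poly poly" where
  "pdiff v f = (pderiv ^^ snd v) ((map_poly pderiv ^^ fst v) f)"

definition pdiff3 ::
  "nat \<Rightarrow> nat \<Rightarrow> nat \<Rightarrow> complex poly poly poly \<Rightarrow> complex poly poly poly" where
  "pdiff3 a b c H =
     (pderiv ^^ c) ((map_poly pderiv ^^ b) ((map_poly (map_poly pderiv) ^^ a) H))"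

definition homogeneous3 :: "nat \<Rightarrow> complex poly poly poly \<Rightarrow> bool" where
  "homogeneous3 n H \<longleftrightarrow> (\<forall>i j k. coeff3 H i j k \<noteq> 0 \<longrightarrow> i + j + k = n)"

definition homogenization :: "complex poly poly \<Rightarrow> complex poly poly poly" where
  "homogenization f = (let d = total_degree f in
     \<Sum>j\<le>d. \<Sum>i\<le>d - j. monom3 (coeff2 f i j) i j (d - i - j))"

definition swap_vars :: "'a::comm_monoid_add poly poly \<Rightarrow> 'a poly poly" where
  "swap_vars f = (\<Sum>j\<le>degree f. \<Sum>i\<le>degree (coeff f j). monom2 (coeff2 f i j) j i)"

definition real_poly2 :: "complex poly poly \<Rightarrow> bool" where
  "real_poly2 f \<longleftrightarrow> (\<forall>i j. coeff2 f i j \<in> \<real>)"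

subsection \<open>Standing assumptions on the curve\<close>

text \<open>
  The perturbation is taken in the space of polynomials of degree at most \<open>deg f\<close>. Without this
  bound no non-constant polynomial would be \<open>\<epsilon>\<close>-irreducible for any positive \<open>\<epsilon>\<close>: take
  \<open>g = f\<close>, \<open>h = 1 + \<eta> x\<close>, \<open>E = - \<eta> x f\<close> with \<open>0 < \<eta> < \<epsilon>\<close>.
\<close>

definition eps_irreducible :: "real \<Rightarrow> complex poly poly \<Rightarrow> bool" where
  "eps_irreducible \<epsilon> f \<longleftrightarrow>
     \<not> (\<exists>g h E. f = g * h + E \<and> total_degree g > 0 \<and> total_degree h > 0
          \<and> total_degree E \<le> total_degree f \<and> max_norm E < \<epsilon> * max_norm f)"

text \<open>The derivatives of order \<open>d\<close> are constants, so it does not matter where they are evaluated.\<close>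

definition proper_degree :: "real \<Rightarrow> complex poly poly \<Rightarrow> nat \<Rightarrow> bool" where
  "proper_degree \<epsilon> f d \<longleftrightarrow> total_degree f = d \<and>
     (\<exists>v. ord v = d \<and> cmod (eval2 (pdiff v f) (0, 0)) > \<epsilon> * max_norm f)"

definition no_singularity_at_infinity :: "complex poly poly \<Rightarrow> bool" where
  "no_singularity_at_infinity f \<longleftrightarrow> (let F = homogenization f in
     \<not> (\<exists>a b. (a, b) \<noteq> (0, 0) \<and> eval3 F a b 0 = 0 \<and> eval3 (pdiff3 1 0 0 F) a b 0 = 0
          \<and> eval3 (pdiff3 0 1 0 F) a b 0 = 0 \<and> eval3 (pdiff3 0 0 1 F) a b 0 = 0))"

subsection \<open>\<open>\<epsilon>\<close>-points\<close>

definition eps_point :: "real \<Rightarrow> complex poly poly \<Rightarrow> point \<Rightarrow> bool" where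
  "eps_point \<epsilon> f P \<longleftrightarrow> cmod (eval2 f P) < \<epsilon> * max_norm f"

definition eps_mult :: "real \<Rightarrow> complex poly poly \<Rightarrow> point \<Rightarrow> nat" where
  "eps_mult \<epsilon> f P = (LEAST r.
     (\<forall>v. ord v < r \<longrightarrow> cmod (eval2 (pdiff v f) P) < \<epsilon> * max_norm f) \<and>
     (\<exists>v. ord v = r \<and> cmod (eval2 (pdiff v f) P) \<ge> \<epsilon> * max_norm f))"

definition eps_simple :: "real \<Rightarrow> complex poly poly \<Rightarrow> point \<Rightarrow> bool" where
  "eps_simple \<epsilon> f P \<longleftrightarrow> eps_point \<epsilon> f P \<and> eps_mult \<epsilon> f P = 1"

definition axis_index :: "nat \<Rightarrow> nat \<Rightarrow> mindex" where
  "axis_index k n = (if k = 1 then (n, 0) else (0, n))"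

definition pure :: "real \<Rightarrow> complex poly poly \<Rightarrow> point \<Rightarrow> nat \<Rightarrow> bool" where
  "pure \<epsilon> f P k \<longleftrightarrow> (let r = eps_mult \<epsilon> f P in
     r > 1 \<and> cmod (eval2 (pdiff (axis_index k r) f) P) \<ge> \<epsilon> * max_norm f)"

definition weight_k :: "real \<Rightarrow> complex poly poly \<Rightarrow> point \<Rightarrow> nat \<Rightarrow> real" where
  "weight_k \<epsilon> f P k = (let r = eps_mult \<epsilon> f P in
     Max ((\<lambda>i. root (r - i) (cmod
            ((fact r * eval2 (pdiff (axis_index k i) f) P) /
             (fact i * eval2 (pdiff (axis_index k r) f) P)))) ` {0..r - 1}))"

definition weight :: "real \<Rightarrow> complex poly poly \<Rightarrow> point \<Rightarrow> real" where
  "weight \<epsilon> f P = Max (weight_k \<epsilon> f P ` {k \<in> {1, 2}. pure \<epsilon> f P k})"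

definition R_out :: "real \<Rightarrow> real" where
  "R_out x = 1 / 2 - x * (1 - 9 * x) / (2 * (1 + 3 * x)) - 32 * x ^ 2 / (1 + 3 * x) ^ 3"

definition radius :: "real \<Rightarrow> complex poly poly \<Rightarrow> point \<Rightarrow> real" where
  "radius \<epsilon> f P = (if \<exists>k\<in>{1, 2}. pure \<epsilon> f P k then R_out (weight \<epsilon> f P) else 0)"

subsection \<open>The \<open>\<epsilon>\<close>-singular locus and its clusters\<close>

text \<open>
  A set \<open>A\<close> of solutions of the system \<open>g = 0\<close> (\<open>g \<in> G\<close>) under precision \<open>\<tau>\<close>: its elements solve
  the system up to \<open>\<tau>\<close>, and every exact solution is represented up to \<open>\<tau>\<close>. The finite set returned
  by a numerical solver and the set of all points with residuals below \<open>\<tau>\<close> are both meant to be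
  covered, so the set is not required to be finite.
\<close>

definition solution_set :: "real \<Rightarrow> complex poly poly set \<Rightarrow> point set \<Rightarrow> bool" where
  "solution_set \<tau> G A \<longleftrightarrow>
     (\<forall>P\<in>A. \<forall>g\<in>G. cmod (eval2 g P) < \<tau>) \<and>
     (\<forall>Z. (\<forall>g\<in>G. eval2 g Z = 0) \<longrightarrow> (\<exists>P\<in>A. norm (P - Z) < \<tau>))"

text \<open>\<open>gcd = 1\<close> is expressed by saying that all common divisors are units.\<close>

definition admissible_choice :: "complex poly poly \<Rightarrow> nat \<Rightarrow> mindex set \<Rightarrow> bool" where
  "admissible_choice f k V \<longleftrightarrow>
     V \<subseteq> {u. ord u = k} \<and> 2 \<le> card V \<and> card V \<le> k + 1 \<and>
     (\<forall>h. (\<forall>u\<in>V. h dvd pdiff u f) \<longrightarrow> is_unit h)"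

text \<open>\<open>A k\<close> is the set of solutions, under precision \<open>\<epsilon> \<parallel>f\<parallel>\<close>, of the \<open>k\<close>-th system; for \<open>k \<ge> 2\<close>
  the system is given by the chosen multi-indices \<open>V k\<close>.\<close>

definition solution_data ::
  "real \<Rightarrow> complex poly poly \<Rightarrow> (nat \<Rightarrow> mindex set) \<Rightarrow> (nat \<Rightarrow> point set) \<Rightarrow> bool" where
  "solution_data \<epsilon> f V A \<longleftrightarrow>
     solution_set (\<epsilon> * max_norm f) {f, pdiff (1, 0) f, pdiff (0, 1) f} (A 1) \<and>
     (\<forall>k\<in>{2..total_degree f - 1}. (\<exists>W. admissible_choice f k W) \<longrightarrow>
        admissible_choice f k (V k) \<and>
        solution_set (\<epsilon> * max_norm f) ((\<lambda>u. pdiff u f) ` V k) (A k))"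

definition sing_k ::
  "real \<Rightarrow> complex poly poly \<Rightarrow> (nat \<Rightarrow> point set) \<Rightarrow> nat \<Rightarrow> point set" where
  "sing_k \<epsilon> f A k =
     (if k = 1 then A 1
      else if \<exists>W. admissible_choice f k W
      then {P \<in> A k. \<forall>w. ord w \<le> k \<longrightarrow> cmod (eval2 (pdiff w f) P) < \<epsilon> * max_norm f}
      else {})"

definition eps_sing :: "real \<Rightarrow> complex poly poly \<Rightarrow> (nat \<Rightarrow> point set) \<Rightarrow> point set" where
  "eps_sing \<epsilon> f A = (\<Union>k\<in>{1..total_degree f - 1}. sing_k \<epsilon> f A k)"

text \<open>The product norm on \<open>complex \<times> complex\<close> is the unitary norm.\<close>

definition close :: "real \<Rightarrow> complex poly poly \<Rightarrow> point \<Rightarrow> point \<Rightarrow> bool" where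
  "close \<epsilon> f P Q \<longleftrightarrow> norm (P - Q) + \<bar>radius \<epsilon> f P - radius \<epsilon> f Q\<bar> < R_out \<epsilon>"

definition cluster :: "real \<Rightarrow> complex poly poly \<Rightarrow> point set \<Rightarrow> point \<Rightarrow> point set" where
  "cluster \<epsilon> f S P =
     {Q \<in> S. close \<epsilon> f P Q \<or> (\<exists>P'\<in>S. close \<epsilon> f P' P \<and> close \<epsilon> f P' Q)}"

definition representative :: "real \<Rightarrow> complex poly poly \<Rightarrow> point set \<Rightarrow> point \<Rightarrow> bool" where
  "representative \<epsilon> f K Q \<longleftrightarrow> Q \<in> K \<and>
     (\<forall>P\<in>K. eps_mult \<epsilon> f P \<le> eps_mult \<epsilon> f Q) \<and>
     (\<forall>P\<in>K. eps_mult \<epsilon> f P = eps_mult \<epsilon> f Q \<longrightarrow> cmod (eval2 f Q) \<le> cmod (eval2 f P))"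

definition cluster_decomposition ::
  "real \<Rightarrow> complex poly poly \<Rightarrow> point set \<Rightarrow> nat \<Rightarrow> (nat \<Rightarrow> point) \<Rightarrow> (nat \<Rightarrow> nat) \<Rightarrow> bool" where
  "cluster_decomposition \<epsilon> f S s Q r \<longleftrightarrow>
     (\<exists>K. bij_betw K {1..s} (cluster \<epsilon> f S ` S) \<and>
          (\<forall>i\<in>{1..s}. representative \<epsilon> f (K i) (Q i) \<and> r i = eps_mult \<epsilon> f (Q i)))"

definition eps_rational :: "nat \<Rightarrow> nat \<Rightarrow> (nat \<Rightarrow> nat) \<Rightarrow> bool" where
  "eps_rational d s r \<longleftrightarrow>
     (int d - 1) * (int d - 2) - (\<Sum>i=1..s. int (r i) * (int (r i) - 1)) = 0"

subsection \<open>The pencil of adjoint curves\<close>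

text \<open>\<open>H = 0\<close> has multiplicity at least \<open>n\<close> at the point \<open>(p\<^sub>1 : p\<^sub>2 : 1)\<close>.\<close>

definition vanishes_to_order :: "complex poly poly poly \<Rightarrow> nat \<Rightarrow> point \<Rightarrow> bool" where
  "vanishes_to_order H n P \<longleftrightarrow>
     (\<forall>a b c. a + b + c < n \<longrightarrow> eval3 (pdiff3 a b c H) (fst P) (snd P) 1 = 0)"

text \<open>The forms (including \<open>0\<close>) of degree \<open>n\<close> with base points \<open>Q i\<close> of multiplicity \<open>r i - 1\<close> that
  vanish on \<open>Y\<close>.\<close>

definition linear_system ::
  "nat \<Rightarrow> nat \<Rightarrow> (nat \<Rightarrow> point) \<Rightarrow> (nat \<Rightarrow> nat) \<Rightarrow> point set \<Rightarrow> complex poly poly poly set" where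
  "linear_system n s Q r Y =
     {H. homogeneous3 n H \<and> (\<forall>i\<in>{1..s}. vanishes_to_order H (r i - 1) (Q i)) \<and>
         (\<forall>P\<in>Y. eval3 H (fst P) (snd P) 1 = 0)}"

abbreviation scale3 :: "complex \<Rightarrow> complex poly poly poly \<Rightarrow> complex poly poly poly" where
  "scale3 c H \<equiv> Polynomial.smult [:[:c:]:] H"

text \<open>The linear system \<open>L\<close> has projective dimension 1 and defining polynomial \<open>H\<^sub>1 + t H\<^sub>2\<close>.\<close>

definition pencil ::
  "complex poly poly poly set \<Rightarrow> complex poly poly poly \<Rightarrow> complex poly poly poly \<Rightarrow> bool" where
  "pencil L H1 H2 \<longleftrightarrow>
     L = {scale3 a H1 + scale3 b H2 |a b. True} \<and>
     (\<forall>a b. scale3 a H1 + scale3 b H2 = 0 \<longrightarrow> a = 0 \<and> b = 0)"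

definition no_common_point_at_infinity ::
  "complex poly poly poly \<Rightarrow> complex poly poly poly \<Rightarrow> bool" where
  "no_common_point_at_infinity H F \<longleftrightarrow>
     \<not> (\<exists>a b. (a, b) \<noteq> (0, 0) \<and> eval3 H a b 0 = 0 \<and> eval3 F a b 0 = 0)"

subsection \<open>The perturbed construction\<close>

text \<open>\<open>\<complex>[\<Delta>]\<close> as finitely supported coefficient functions on monomials; \<open>\<delta>\<^sub>k\<close> is the variable with
  index \<open>k\<close>. The ring \<open>\<complex>[\<Delta>][t]\<close> is \<open>dpoly poly\<close>.\<close>

type_synonym dpoly = "(nat \<Rightarrow>\<^sub>0 nat) \<Rightarrow>\<^sub>0 complex"

definition Const :: "complex \<Rightarrow> dpoly" where
  "Const c = Poly_Mapping.single 0 c"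

definition delta :: "nat \<Rightarrow> dpoly" where
  "delta k = Poly_Mapping.single (Poly_Mapping.single k 1) 1"

definition eval_dpoly :: "(nat \<Rightarrow> complex) \<Rightarrow> dpoly \<Rightarrow> complex" where
  "eval_dpoly a p = (\<Sum>\<mu>\<in>Poly_Mapping.keys p. Poly_Mapping.lookup p \<mu> *
     (\<Prod>k\<in>Poly_Mapping.keys \<mu>. a k ^ Poly_Mapping.lookup \<mu> k))"

definition lift_const :: "complex \<Rightarrow> dpoly poly" where
  "lift_const c = [:Const c:]"

definition num_params :: "nat \<Rightarrow> nat" where
  "num_params d = (if d = 3 then 3 else 6)"

definition G_form :: "nat \<Rightarrow> dpoly poly poly poly poly" where
  "G_form d = (let \<delta> = (\<lambda>k. [:delta k:]) in
     if d = 3 then monom3 (\<delta> 1) 0 1 0 + monom3 (\<delta> 2) 0 0 1 + monom3 (\<delta> 3) 1 0 0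
     else monom3 (\<delta> 1) 0 (d - 2) 0 + monom3 (\<delta> 2) 0 (d - 3) 1 + monom3 (\<delta> 3) (d - 2) 0 0
        + monom3 (\<delta> 4) (d - 3) 0 1 + monom3 (\<delta> 5) (d - 3) 1 0 + monom3 (\<delta> 6) 1 (d - 3) 0)"

text \<open>\<open>H\<^sub>1 + t H\<^sub>2 + G\<close> as a polynomial in \<open>x, y, z\<close> over \<open>\<complex>[\<Delta>][t]\<close>.\<close>

definition H_pert ::
  "nat \<Rightarrow> complex poly poly poly \<Rightarrow> complex poly poly poly \<Rightarrow> dpoly poly poly poly poly" where
  "H_pert d H1 H2 =
     map_poly (map_poly (map_poly lift_const)) H1
     + monom3 (monom 1 1) 0 0 0 * map_poly (map_poly (map_poly lift_const)) H2
     + G_form d"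

definition S1 ::
  "complex poly poly \<Rightarrow> nat \<Rightarrow> complex poly poly poly \<Rightarrow> complex poly poly poly \<Rightarrow> dpoly poly poly"
  where
  "S1 f d H1 H2 =
     resultant (poly (H_pert d H1 H2) 1) (map_poly (map_poly lift_const) f)"

definition S2 ::
  "complex poly poly \<Rightarrow> nat \<Rightarrow> complex poly poly poly \<Rightarrow> complex poly poly poly \<Rightarrow> dpoly poly poly"
  where
  "S2 f d H1 H2 =
     resultant (swap_vars (poly (H_pert d H1 H2) 1)) (swap_vars (map_poly (map_poly lift_const) f))"

text \<open>\<open>A\<^sub>1\<close> and \<open>A\<^sub>2\<close>: here \<open>pr\<close> is the projection to the first or second coordinate.\<close>

definition A_poly ::
  "(point \<Rightarrow> complex) \<Rightarrow> nat \<Rightarrow> nat \<Rightarrow> (nat \<Rightarrow> point) \<Rightarrow> (nat \<Rightarrow> nat) \<Rightarrow> (nat \<Rightarrow> point) \<Rightarrow> complex poly"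
  where
  "A_poly pr d s Q r P =
     (\<Prod>i=1..s. [:- pr (Q i), 1:] ^ (r i * (r i - 1))) * (\<Prod>j=1..d - 3. [:- pr (P j), 1:])"

text \<open>Since \<open>A\<close> is monic, pseudo-division by \<open>A\<close> is division with remainder.\<close>

definition B_quot :: "dpoly poly poly \<Rightarrow> complex poly \<Rightarrow> dpoly poly poly" where
  "B_quot S A = fst (pseudo_divmod S (map_poly lift_const A))"

text \<open>The root, in \<open>\<complex>(\<Delta>, t)\<close>, of a linear polynomial over \<open>\<complex>[\<Delta>][t]\<close>.\<close>

definition linear_root :: "dpoly poly poly \<Rightarrow> dpoly poly fract" where
  "linear_root B = (THE \<xi>. poly (map_poly to_fract B) \<xi> = 0)"

definition P_Delta ::
  "complex poly poly \<Rightarrow> nat \<Rightarrow> nat \<Rightarrow> (nat \<Rightarrow> point) \<Rightarrow> (nat \<Rightarrow> nat) \<Rightarrow> (nat \<Rightarrow> point) \<Rightarrow>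
   complex poly poly poly \<Rightarrow> complex poly poly poly \<Rightarrow> dpoly poly fract \<times> dpoly poly fract" where
  "P_Delta f d s Q r P H1 H2 =
     (linear_root (B_quot (S1 f d H1 H2) (A_poly fst d s Q r P)),
      linear_root (B_quot (S2 f d H1 H2) (A_poly snd d s Q r P)))"

text \<open>The rational function \<open>\<phi> \<in> \<complex>(\<Delta>, t)\<close> can be specialized at \<open>\<Delta> = \<Delta>\<^sub>0\<close>, with value
  \<open>\<psi> \<in> \<complex>(t)\<close>.\<close>

definition specializes_to ::
  "(nat \<Rightarrow> complex) \<Rightarrow> dpoly poly fract \<Rightarrow> complex poly fract \<Rightarrow> bool" where
  "specializes_to \<Delta>0 \<phi> \<psi> \<longleftrightarrow>
     (\<exists>n q. \<phi> = Fract n q \<and> map_poly (eval_dpoly \<Delta>0) q \<noteq> 0 \<and>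
            \<psi> = Fract (map_poly (eval_dpoly \<Delta>0) n) (map_poly (eval_dpoly \<Delta>0) q))"

subsection \<open>Zariski open sets and rational parametrizations\<close>

text \<open>\<open>\<complex>\<^sup>m\<close> is the set of functions on \<open>{1..m}\<close>.\<close>

definition affine_space :: "nat \<Rightarrow> (nat \<Rightarrow> complex) set" where
  "affine_space m = ({1..m} \<rightarrow>\<^sub>E UNIV)"

definition zariski_open :: "nat \<Rightarrow> (nat \<Rightarrow> complex) set \<Rightarrow> bool" where
  "zariski_open m \<Omega> \<longleftrightarrow>
     (\<exists>I. (\<forall>p\<in>I. \<forall>\<mu>\<in>Poly_Mapping.keys p. Poly_Mapping.keys \<mu> \<subseteq> {1..m}) \<and>
          \<Omega> = affine_space m - {a \<in> affine_space m. \<forall>p\<in>I. eval_dpoly a p = 0})"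

definition fract_value :: "complex poly fract \<Rightarrow> complex \<Rightarrow> complex \<Rightarrow> bool" where
  "fract_value \<phi> t0 a \<longleftrightarrow>
     (\<exists>n q. \<phi> = Fract n q \<and> poly q t0 \<noteq> 0 \<and> a = poly n t0 / poly q t0)"

definition is_constant :: "complex poly fract \<Rightarrow> bool" where
  "is_constant \<phi> \<longleftrightarrow> (\<exists>c. \<phi> = to_fract [:c:])"

definition param_image :: "complex poly fract \<times> complex poly fract \<Rightarrow> point set" where
  "param_image \<P> = {(a, b). \<exists>t0. fract_value (fst \<P>) t0 a \<and> fract_value (snd \<P>) t0 b}"

definition zariski_closure2 :: "point set \<Rightarrow> point set" where
  "zariski_closure2 X = {P. \<forall>h. (\<forall>Q\<in>X. eval2 h Q = 0) \<longrightarrow> eval2 h P = 0}"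

text \<open>\<open>\<P>\<close> is not constant and parametrizes the curve \<open>g = 0\<close>, i.e. the curve is the Zariski closure
  of its image.\<close>

definition rational_parametrization ::
  "complex poly fract \<times> complex poly fract \<Rightarrow> complex poly poly \<Rightarrow> bool" where
  "rational_parametrization \<P> g \<longleftrightarrow>
     \<not> (is_constant (fst \<P>) \<and> is_constant (snd \<P>)) \<and>
     zariski_closure2 (param_image \<P>) = {P. eval2 g P = 0}"

definition rational_curve :: "complex poly poly \<Rightarrow> bool" where
  "rational_curve g \<longleftrightarrow> irreducible g \<and> (\<exists>\<P>. rational_parametrization \<P> g)"

end

theory Submission
  imports
    Defs
    "HOL-Computational_Algebra.Field_as_Ring"
    "Subresultants.Subresultant"
begin

text \<open>
  The idea. Write \<open>N = d (d - 2)\<close>. The roots in \<open>x\<close> of \<open>S\<^sub>1\<close> are the abscissas of the \<open>N\<close> intersection points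
  of \<open>f = 0\<close> with the moving curve \<open>H\<^sub>1 + t H\<^sub>2 + G = 0\<close>, so that \<open>S\<^sub>1 = L x\<^sup>N + s x\<^sup>N\<^sup>-\<^sup>1 + \<dots>\<close>, where \<open>- s / L\<close> is
  the sum of these abscissas. As \<open>A\<^sub>1\<close> is monic of degree \<open>N - 1\<close>, the quotient \<open>B\<^sub>1\<close> is \<open>L x + (s - \<alpha> L)\<close> with
  \<open>\<alpha>\<close> the coefficient of \<open>x\<^sup>N\<^sup>-\<^sup>2\<close> in \<open>A\<^sub>1\<close>, and the first component is \<open>\<alpha> - s / L\<close>: the sum of the abscissas
  of all intersection points minus the sum of those prescribed by \<open>A\<^sub>1\<close>.

  Denominators. By a weight count in the Sylvester matrix (\<open>resultant_top_coeff\<close>), \<open>L\<close> is the resultant of the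
  top forms. For fixed \<open>\<Delta>\<close> it is therefore, up to a nonzero constant, \<open>\<Prod>\<^sub>\<beta> (A \<beta> + t B \<beta>)\<close> over the roots
  \<open>\<beta>\<close> of the top form of \<open>f\<close>, where \<open>A\<close> and \<open>B\<close> are the top forms of \<open>H\<^sub>1 + G\<close> and \<open>H\<^sub>2\<close>
  (\<open>resultant_root_product\<close>). The curves \<open>H\<^sub>2 = 0\<close> and \<open>f = 0\<close> do not meet at infinity, which says \<open>B \<beta> \<noteq> 0\<close>;
  hence \<open>L\<close> has degree exactly \<open>d\<close> in \<open>t\<close>, whatever \<open>\<Delta>\<close> is. Exchanging \<open>x\<close> and \<open>y\<close> replaces \<open>\<beta>\<close> by \<open>1 / \<beta>\<close> and
  changes the product only by a constant factor (\<open>lead_swap_vars\<close>), so the two components have the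
  common denominator \<open>L\<close>. Only \<open>d\<close> rows of each Sylvester matrix contain \<open>t\<close>, and they do so linearly;
  the numerators thus have degree at most \<open>d\<close>, too.

  Nonconstancy. The first component is constant iff \<open>s\<close> is a constant multiple of \<open>L\<close>. Let \<open>\<mu>\<close> and \<open>\<nu>\<close> be the
  parameters of \<open>x\<^sup>d\<^sup>-\<^sup>2\<close> and of \<open>x\<^sup>d\<^sup>-\<^sup>3 z\<close> in \<open>G\<close>. Then \<open>L\<close> does not depend on \<open>\<nu>\<close> and equals \<open>\<tau> \<mu>\<close> with
  \<open>\<tau> \<lambda> = \<Prod>\<^sub>\<beta> (A \<beta> + t B \<beta> + \<lambda>)\<close> up to a constant, where \<open>A\<close> is now taken for \<open>\<mu> = 0\<close>; and \<open>s\<close> is affine in \<open>\<nu>\<close> with slope \<open>\<tau>' \<mu>\<close>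
  (\<open>resultant_second_coeff_affine\<close>). The slope has degree less than \<open>d\<close> in \<open>t\<close>. If \<open>s\<close> were proportional to
  \<open>L\<close> for two values of \<open>\<nu>\<close>, then so would be the slope, and it would vanish; but at \<open>t = 0\<close> it is a nonzero
  polynomial in \<open>\<mu>\<close>. So suitable \<open>\<mu>\<close> and \<open>\<nu>\<close> exist (\<open>ex_nonproportional\<close>). Non-proportionality is the
  nonvanishing of a minor of the coefficients of \<open>s\<close> and \<open>L\<close>; this minor, times two linear factors which
  keep the degrees of the moving curve in \<open>y\<close> and in \<open>x\<close>, defines the open set.

  The curve. What remains concerns any pair \<open>(N\<^sub>1 / L, N\<^sub>2 / L)\<close> with degrees at most \<open>d\<close> and \<open>N\<^sub>1 / L\<close> not
  constant. The polynomials vanishing on its image are the multiples of one irreducible \<open>g\<close>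
  (\<open>ex_generator\<close>). Among the monomials of total degree at most \<open>n\<close>, about \<open>n deg g\<close> are not divisible by
  the leading monomial of \<open>g\<close>, and no relation is supported on them. After multiplication by \<open>L\<^sup>n\<close> their
  values lie in the space of polynomials of degree at most \<open>n d\<close>, of dimension \<open>n d + 1\<close>. For large \<open>n\<close>
  this forces \<open>deg g \<le> d\<close> (\<open>total_degree_generator_le\<close>).
\<close>

section \<open>Bivariate polynomials and forms\<close>

text \<open>
  A bound on the total degree over any coefficient ring; \<open>top_form n p\<close> is the form of degree \<open>n\<close> of \<open>p\<close>,
  dehomogenized by \<open>x = 1\<close>, so that its roots are the points at infinity other than \<open>(0 : 1 : 0)\<close>.
\<close>

definition tdeg_le :: "nat \<Rightarrow> 'a::zero poly poly \<Rightarrow> bool" where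
  "tdeg_le n p \<longleftrightarrow> (\<forall>i j. coeff2 p i j \<noteq> 0 \<longrightarrow> i + j \<le> n)"

definition top_form :: "nat \<Rightarrow> 'a::comm_monoid_add poly poly \<Rightarrow> 'a poly" where
  "top_form n p = (\<Sum>j\<le>n. monom (coeff2 p (n - j) j) j)"

lemma tdeg_leD: "tdeg_le n p \<Longrightarrow> j \<le> n \<Longrightarrow> degree (coeff p j) \<le> n - j"
  by (rule degree_le) (force simp: tdeg_le_def coeff2_def)

lemma coeff_top_form: "coeff (top_form n p) j = (if j \<le> n then coeff2 p (n - j) j else 0)"
  by (simp add: top_form_def coeff_sum)

lemma coeff2_map_poly [simp]: "g 0 = 0 \<Longrightarrow> coeff2 (map_poly (map_poly g) p) i j = g (coeff2 p i j)"
  by (simp add: coeff2_def coeff_map_poly)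

lemma poly2_eq_iff: "p = q \<longleftrightarrow> (\<forall>i j. coeff2 p i j = coeff2 q i j)"
  by (auto simp: coeff2_def poly_eq_iff)

lemma coeff2_simps [simp]:
  "coeff2 (p + q) i j = coeff2 p i j + coeff2 q i j"
  "coeff2 (Polynomial.smult [:c:] r) i j = c * coeff2 r i j"
  "coeff2 0 i j = 0"
  "coeff2 [:u:] i j = (if j = 0 then coeff u i else 0)"
  by (simp_all add: coeff2_def coeff_pCons split: nat.split)

text \<open>
  Identities in \<open>t\<close> are proved at the values of \<open>t\<close> where the degree of the moving curve does not drop; the
  zeros of \<open>w\<close> are the finitely many excluded values.
\<close>

lemma cofinite_poly_eq:
  fixes p q :: "complex poly"
  assumes "w \<noteq> 0" "\<And>t. poly w t \<noteq> 0 \<Longrightarrow> poly p t = poly q t"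
  shows "p = q"
proof -
  have "poly (w * (p - q)) t = 0" for t using assms(2)[of t] by auto
  then have "w * (p - q) = 0" using poly_all_0_iff_0 by blast
  then show ?thesis using assms(1) by simp
qed

lemma degree_top_form:
  assumes "coeff2 p 0 n \<noteq> 0"
  shows "degree (top_form n p) = n" "lead_coeff (top_form n p) = coeff2 p 0 n"
proof -
  show "degree (top_form n p) = n"
    using assms by (intro antisym le_degree degree_le) (auto simp: coeff_top_form)
  then show "lead_coeff (top_form n p) = coeff2 p 0 n" by (simp add: coeff_top_form)
qed

lemma degree_eq_if_tdeg_le:
  assumes "tdeg_le n p" "coeff2 p 0 n \<noteq> 0"
  shows "degree p = n"
proof (intro antisym le_degree degree_le)
  show "coeff p n \<noteq> 0" using assms(2) by (auto simp: coeff2_def)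
  show "\<forall>i>n. coeff p i = 0"
    using assms(1) unfolding tdeg_le_def coeff2_def poly_eq_iff by fastforce
qed

lemma tdeg_le_mono: "(\<And>i j. coeff2 p i j \<noteq> 0 \<Longrightarrow> coeff2 q i j \<noteq> 0 \<or> coeff2 r i j \<noteq> 0) \<Longrightarrow>
    tdeg_le n q \<Longrightarrow> tdeg_le n r \<Longrightarrow> tdeg_le n p"
  unfolding tdeg_le_def by blast

lemma finite_support2: "finite {(i, j). coeff2 f i j \<noteq> 0}"
proof (rule finite_subset)
  let ?D = "Max (insert 0 (degree ` range (coeff f)))"
  have fin: "finite (range (coeff f))"
  proof (rule finite_subset)
    show "range (coeff f) \<subseteq> insert 0 (coeff f ` {..degree f})"
      using le_degree by (fastforce simp: not_le)
  qed simp
  show "{(i, j). coeff2 f i j \<noteq> 0} \<subseteq> {..?D} \<times> {..degree f}"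
  proof clarsimp
    fix i j assume nz: "coeff2 f i j \<noteq> 0"
    have "i \<le> degree (coeff f j)" using nz le_degree by (auto simp: coeff2_def)
    also have "\<dots> \<le> ?D" using fin by (intro Max_ge) auto
    moreover have "j \<le> degree f" using nz by (intro le_degree) (auto simp: coeff2_def)
    ultimately show "i \<le> ?D \<and> j \<le> degree f" by simp
  qed
qed simp

lemma total_degree_le_iff: "total_degree f \<le> n \<longleftrightarrow> tdeg_le n f"
proof -
  have "{i + j |i j. coeff2 f i j \<noteq> 0} = (\<lambda>(i, j). i + j) ` {(i, j). coeff2 f i j \<noteq> 0}" by auto
  then have "finite {i + j |i j. coeff2 f i j \<noteq> 0}" using finite_support2[of f] by simp
  then show ?thesis by (auto simp: total_degree_def tdeg_le_def)
qed

lemma eval2_mult: "eval2 (p * q) P = eval2 p P * eval2 q P"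
  and eval2_add: "eval2 (p + q) P = eval2 p P + eval2 q P"
  by (simp_all add: eval2_def)

lemma eval2_const: "eval2 [:u:] P = poly u (fst P)"
  by (simp add: eval2_def)

lemma eval2_sum:
  assumes "tdeg_le n h"
  shows "eval2 h (x, y) = (\<Sum>j\<le>n. \<Sum>i\<le>n - j. coeff2 h i j * (x ^ i * y ^ j))"
proof -
  have "degree h \<le> n"
    using assms by (intro degree_le) (fastforce simp: tdeg_le_def coeff2_def poly_eq_iff)
  then have "poly h [:y:] = (\<Sum>j\<le>n. coeff h j * [:y:] ^ j)"
    unfolding poly_altdef by (intro sum.mono_neutral_left) (auto simp: coeff_eq_0)
  then have "eval2 h (x, y) = (\<Sum>j\<le>n. poly (coeff h j) x * y ^ j)"
    by (simp add: eval2_def poly_sum)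
  moreover have "poly (coeff h j) x = (\<Sum>i\<le>n - j. coeff2 h i j * x ^ i)" if "j \<le> n" for j
    unfolding poly_altdef coeff2_def using tdeg_leD[OF assms that]
    by (intro sum.mono_neutral_left) (auto simp: coeff_eq_0)
  then have "(\<Sum>j\<le>n. poly (coeff h j) x * y ^ j) = (\<Sum>j\<le>n. (\<Sum>i\<le>n - j. coeff2 h i j * x ^ i) * y ^ j)"
    by (intro sum.cong) auto
  ultimately show ?thesis by (simp only: sum_distrib_right mult.assoc)
qed

lemma coeff2_swap_vars [simp]:
  "coeff2 (swap_vars p) i j = coeff2 p j i"
proof -
  have "coeff2 (swap_vars p) i j =
      (\<Sum>l\<le>degree p. \<Sum>k\<le>degree (coeff p l). if i = l then (if j = k then coeff2 p j i else 0) else 0)"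
    unfolding swap_vars_def coeff2_def[of "sum _ _"] coeff_sum monom2_def
    by (intro sum.cong) (auto simp: coeff2_def)
  also have "\<dots> = (\<Sum>l\<le>degree p. if i = l then (\<Sum>k\<le>degree (coeff p i). if j = k then coeff2 p j i else 0) else 0)"
    by (intro sum.cong) auto
  also have "\<dots> = coeff2 p j i"
    by (auto simp: coeff2_def coeff_eq_0 not_le)
  finally show ?thesis .
qed

lemma tdeg_le_swap_vars: "tdeg_le n (swap_vars p) \<longleftrightarrow> tdeg_le n p"
  unfolding tdeg_le_def coeff2_swap_vars by (metis add.commute)

lemma map_swap_vars:
  assumes "g 0 = 0"
  shows "map_poly (map_poly g) (swap_vars p) = swap_vars (map_poly (map_poly g) p)"
  using assms by (simp add: poly2_eq_iff)

text \<open>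
  Exchanging the variables turns the point \<open>(1 : \<beta> : 0)\<close> into \<open>(\<beta> : 1 : 0) = (1 : 1 / \<beta> : 0)\<close>.
\<close>

lemma poly_top_form_swap_vars:
  fixes p :: "complex poly poly"
  assumes "\<beta> \<noteq> 0"
  shows "poly (top_form n (swap_vars p)) (inverse \<beta>) = inverse \<beta> ^ n * poly (top_form n p) \<beta>"
proof -
  have "poly (top_form n (swap_vars p)) (inverse \<beta>) = (\<Sum>j\<le>n. coeff2 p j (n - j) * inverse \<beta> ^ j)"
    by (simp add: top_form_def poly_sum poly_monom)
  also have "\<dots> = (\<Sum>j\<le>n. coeff2 p (n - j) j * inverse \<beta> ^ (n - j))"
    by (rule sum.reindex_bij_witness[of _ "\<lambda>j. n - j" "\<lambda>j. n - j"]) auto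
  also have "\<dots> = (\<Sum>j\<le>n. inverse \<beta> ^ n * (coeff2 p (n - j) j * \<beta> ^ j))"
  proof (intro sum.cong refl)
    fix j assume "j \<in> {..n}"
    then have "inverse \<beta> ^ n = inverse \<beta> ^ (n - j) * inverse \<beta> ^ j" by (simp flip: power_add)
    then show "coeff2 p (n - j) j * inverse \<beta> ^ (n - j) = inverse \<beta> ^ n * (coeff2 p (n - j) j * \<beta> ^ j)"
      using assms by (simp add: field_simps)
  qed
  finally show ?thesis by (simp add: top_form_def poly_sum poly_monom sum_distrib_left)
qed

lemma top_form_swap_vars:
  assumes "coeff2 f 0 n \<noteq> 0"
  shows "top_form n (swap_vars f) = reflect_poly (top_form n f)"
  using degree_top_form[OF assms] by (auto simp: poly_eq_iff coeff_top_form coeff_reflect_poly)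

lemma coeff2_poly_1: "coeff2 (poly H 1) i j = (\<Sum>k\<le>degree H. coeff3 H i j k)"
  by (simp add: poly_altdef coeff2_def coeff3_def coeff_sum)

lemma tdeg_le_poly_1: "homogeneous3 n H \<Longrightarrow> tdeg_le n (poly H 1)"
  unfolding tdeg_le_def coeff2_poly_1 homogeneous3_def
  by (metis le_add1 sum.neutral)

lemma coeff2_poly_1_top:
  assumes "homogeneous3 n H" "i + j = n"
  shows "coeff2 (poly H 1) i j = coeff3 H i j 0"
proof -
  have "coeff3 H i j k = (if k = 0 then coeff3 H i j 0 else 0)" for k
    using assms unfolding homogeneous3_def by (metis add_cancel_left_right)
  then have "coeff2 (poly H 1) i j = (\<Sum>k\<le>degree H. if k = 0 then coeff3 H i j 0 else 0)"
    unfolding coeff2_poly_1 by (intro sum.cong) auto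
  then show ?thesis by simp
qed

text \<open>
  A form is determined by its dehomogenization \<open>poly H 1\<close>, which is the form in which all curves are
  treated below.
\<close>

lemma eval3_at_infinity:
  assumes "homogeneous3 n H"
  shows "eval3 H a b 0 = (\<Sum>j\<le>n. coeff2 (poly H 1) (n - j) j * (a ^ (n - j) * b ^ j))"
proof -
  have c: "coeff2 (coeff H 0) i j = coeff3 H i j 0" for i j by (simp add: coeff2_def coeff3_def)
  have t: "tdeg_le n (coeff H 0)"
    using assms unfolding tdeg_le_def c homogeneous3_def by (metis add_0_right order_refl)
  have "eval3 H a b 0 = eval2 (coeff H 0) (a, b)"
    by (simp add: eval3_def eval2_def poly_0_coeff_0)
  also have "\<dots> = (\<Sum>j\<le>n. \<Sum>i\<le>n - j. if i = n - j then coeff2 (poly H 1) i j * (a ^ i * b ^ j) else 0)"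
    unfolding eval2_sum[OF t]
  proof (intro sum.cong refl)
    fix i j assume "j \<in> {..n}" "i \<in> {..n - j}"
    moreover from this have "i + j = n \<longleftrightarrow> i = n - j" by auto
    moreover have "coeff3 H i j 0 = 0" if "i + j \<noteq> n" using assms that unfolding homogeneous3_def by (metis add_0_right)
    ultimately show "coeff2 (coeff H 0) i j * (a ^ i * b ^ j) =
        (if i = n - j then coeff2 (poly H 1) i j * (a ^ i * b ^ j) else 0)"
      using coeff2_poly_1_top[OF assms, of i j] by (auto simp: c)
  qed
  finally show ?thesis by simp
qed

lemma poly_top_form_at_infinity:
  assumes "homogeneous3 n H"
  shows "poly (top_form n (poly H 1)) \<beta> = eval3 H 1 \<beta> 0"
  unfolding eval3_at_infinity[OF assms] by (simp add: top_form_def poly_sum poly_monom)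

lemma eval3_axes:
  assumes "homogeneous3 n H"
  shows "eval3 H 1 0 0 = coeff2 (poly H 1) n 0" "eval3 H 0 1 0 = coeff2 (poly H 1) 0 n"
proof -
  have "eval3 H 1 0 0 = (\<Sum>j\<le>n. if j = 0 then coeff2 (poly H 1) n 0 else 0)"
    unfolding eval3_at_infinity[OF assms] by (intro sum.cong) auto
  then show "eval3 H 1 0 0 = coeff2 (poly H 1) n 0" by simp
  have "eval3 H 0 1 0 = (\<Sum>j\<le>n. if j = n then coeff2 (poly H 1) 0 n else 0)"
    unfolding eval3_at_infinity[OF assms] by (intro sum.cong) auto
  then show "eval3 H 0 1 0 = coeff2 (poly H 1) 0 n" by simp
qed

lemma poly_monom3_1: "poly (monom3 c i j k) 1 = monom2 c i j"
  by (simp add: monom3_def monom2_def poly_monom)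

lemma coeff3_add [simp]: "coeff3 (G + H) i j k = coeff3 G i j k + coeff3 H i j k"
  and coeff3_monom3: "coeff3 (monom3 c i' j' k') i j k = (if i = i' \<and> j = j' \<and> k = k' then c else 0)"
  by (auto simp: coeff3_def monom3_def)

lemma coeff2_monom2 [simp]: "coeff2 (monom2 c i' j') i j = (if i = i' \<and> j = j' then c else 0)"
  by (auto simp: coeff2_def monom2_def)

lemma homogeneous3_add: "homogeneous3 n G \<Longrightarrow> homogeneous3 n H \<Longrightarrow> homogeneous3 n (G + H)"
  unfolding homogeneous3_def coeff3_add by (metis add_0)

lemma homogeneous3_monom3: "i + j + k = n \<Longrightarrow> homogeneous3 n (monom3 c i j k)"
  by (auto simp: homogeneous3_def coeff3_monom3)

lemma homogeneous3_homogenization: "homogeneous3 (total_degree f) (homogenization f)"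
proof -
  have z: "homogeneous3 n 0" for n by (simp add: homogeneous3_def coeff3_def)
  have s: "homogeneous3 n (\<Sum>i\<in>I. p i)" if "\<And>i. i \<in> I \<Longrightarrow> homogeneous3 n (p i)" for n I and p :: "nat \<Rightarrow> _"
    using that by (induction I rule: infinite_finite_induct) (auto intro: z homogeneous3_add)
  show ?thesis
    unfolding homogenization_def Let_def by (intro s homogeneous3_monom3) auto
qed

lemma poly_homogenization_1: "poly (homogenization f) 1 = f"
proof -
  define d where "d = total_degree f"
  have t: "tdeg_le d f" by (simp add: d_def flip: total_degree_le_iff)
  have "coeff2 (poly (homogenization f) 1) i j = coeff2 f i j" for i j
  proof -
    have "coeff2 (poly (homogenization f) 1) i j =
        (\<Sum>j'\<le>d. \<Sum>i'\<le>d - j'. if j' = j then (if i' = i then coeff2 f i j else 0) else 0)"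
      unfolding homogenization_def Let_def d_def[symmetric] poly_sum poly_monom3_1
        coeff2_def[of "sum _ _"] coeff_sum
      by (intro sum.cong refl) (auto simp: monom2_def coeff2_def)
    also have "\<dots> = (\<Sum>j'\<le>d. if j' = j then (\<Sum>i'\<le>d - j. if i' = i then coeff2 f i j else 0) else 0)"
      by (intro sum.cong) auto
    also have "\<dots> = coeff2 f i j"
      using t by (fastforce simp: tdeg_le_def)
    finally show ?thesis .
  qed
  then show ?thesis by (simp add: poly2_eq_iff)
qed

lemma tdeg_le_monom2: "i + j \<le> n \<Longrightarrow> tdeg_le n (monom2 c i j)"
  by (auto simp: tdeg_le_def split: if_splits)

lemma tdeg_le_add: "tdeg_le n p \<Longrightarrow> tdeg_le n q \<Longrightarrow> tdeg_le n (p + q)"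
  by (rule tdeg_le_mono[where q = p and r = q]) auto

lemma pencil_homogeneous:
  assumes "pencil (linear_system n s Q r Y) H1 H2"
  shows "homogeneous3 n H1" "homogeneous3 n H2"
proof -
  have "scale3 1 H1 + scale3 0 H2 \<in> linear_system n s Q r Y" "scale3 0 H1 + scale3 1 H2 \<in> linear_system n s Q r Y"
    using assms unfolding pencil_def by blast+
  then show "homogeneous3 n H1" "homogeneous3 n H2"
    by (simp_all add: linear_system_def flip: one_pCons)
qed

section \<open>Graded Sylvester matrices\<close>

lemma degree_mult_le_add:
  fixes p q :: "'a::comm_semiring_0 poly"
  shows "degree p \<le> a \<Longrightarrow> degree q \<le> b \<Longrightarrow> degree (p * q) \<le> a + b"
  using degree_mult_le[of p q] by linarith

text \<open>
  A relation between two rings that is compatible with addition, and with multiplication up to adding the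
  degrees, passes from the entries of two matrices to their determinants as soon as every term of the Leibniz
  expansion has the same weight. For a degree bound the relation constrains the first argument alone; for a
  statement on leading coefficients the second ring is the one that contains them.
\<close>

locale graded_relation =
  fixes R :: "nat \<Rightarrow> 'a::comm_ring_1 \<Rightarrow> 'b::comm_ring_1 \<Rightarrow> bool"
  assumes zero: "R n 0 0"
    and one: "R 0 1 1"
    and add: "R n a b \<Longrightarrow> R n a' b' \<Longrightarrow> R n (a + a') (b + b')"
    and uminus: "R n a b \<Longrightarrow> R n (- a) (- b)"
    and mult: "R n a b \<Longrightarrow> R n' a' b' \<Longrightarrow> R (n + n') (a * a') (b * b')"
begin

lemma sum:
  assumes "\<And>i. i \<in> I \<Longrightarrow> R n (x i) (y i)"
  shows "R n (\<Sum>i\<in>I. x i) (\<Sum>i\<in>I. y i)"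
  using assms by (induction I rule: infinite_finite_induct) (auto intro: zero add)

lemma prod:
  assumes "finite I" "\<And>i. i \<in> I \<Longrightarrow> R (w i) (x i) (y i)"
  shows "R (\<Sum>i\<in>I. w i) (\<Prod>i\<in>I. x i) (\<Prod>i\<in>I. y i)"
  using assms by (induction I rule: finite_induct) (auto intro: one mult)

lemma det:
  assumes M: "M \<in> carrier_mat k k" and M': "M' \<in> carrier_mat k k"
    and R: "\<And>p. p permutes {0..<k} \<Longrightarrow>
      R n (\<Prod>i = 0..<k. M $$ (i, p i)) (\<Prod>i = 0..<k. M' $$ (i, p i))"
  shows "R n (Determinant.det M) (Determinant.det M')"
proof -
  have "R n (signof p * (\<Prod>i = 0..<k. M $$ (i, p i))) (signof p * (\<Prod>i = 0..<k. M' $$ (i, p i)))"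
    if "p permutes {0..<k}" for p
    using R[OF that] uminus[OF R[OF that]] by (cases "sign p = 1") (auto simp: sign_def)
  then show ?thesis
    unfolding det_def'[OF M] det_def'[OF M'] by (intro sum) auto
qed

text \<open>
  In row \<open>i\<close> of the Sylvester matrix the entry in column \<open>j\<close> is the coefficient of a power that is
  \<open>j - i\<close> (or \<open>j - (i - n)\<close> in the last \<open>m\<close> rows) below the top. Along a permutation these differences
  add up to \<open>m n\<close>. The shift \<open>e\<close> is an extra weight for the \<open>n\<close> rows which come from \<open>p\<close>.
\<close>

lemma resultant:
  assumes p: "\<And>k. k \<le> m \<Longrightarrow> R (e + g * (m - k)) (coeff p k) (coeff p' k)"
    and q: "\<And>k. k \<le> n \<Longrightarrow> R (g * (n - k)) (coeff q k) (coeff q' k)"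
  shows "R (e * n + g * (m * n)) (resultant_sub m n p q) (resultant_sub m n p' q')"
  unfolding resultant_sub_def
proof (rule det[where k = "m + n"])
  fix \<pi> assume \<pi>: "\<pi> permutes {0..<m + n}"
  let ?M = "sylvester_mat_sub m n p q" and ?M' = "sylvester_mat_sub m n p' q'"
  define a where "a i = (if i < n then i else i - n)" for i
  define c where "c i = (if i < n then e else 0)" for i
  have less: "\<pi> i < m + n" if "i < m + n" for i
    using permutes_in_image[OF \<pi>, of i] that by auto
  show "R (e * n + g * (m * n)) (\<Prod>i = 0..<m + n. ?M $$ (i, \<pi> i)) (\<Prod>i = 0..<m + n. ?M' $$ (i, \<pi> i))"
  proof (cases "\<forall>i<m + n. a i \<le> \<pi> i")
    case False
    then obtain i where i: "i < m + n" "\<not> a i \<le> \<pi> i" by blast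
    then have "?M $$ (i, \<pi> i) = 0" "?M' $$ (i, \<pi> i) = 0"
      using less[OF i(1)] by (auto simp: sylvester_mat_sub_index a_def split: if_splits)
    then have "(\<Prod>i = 0..<m + n. ?M $$ (i, \<pi> i)) = 0" "(\<Prod>i = 0..<m + n. ?M' $$ (i, \<pi> i)) = 0"
      using i(1) by (auto intro!: prod_zero)
    then show ?thesis by (simp add: zero)
  next
    case True
    have entry: "R (c i + g * (\<pi> i - a i)) (?M $$ (i, \<pi> i)) (?M' $$ (i, \<pi> i))" if i: "i < m + n" for i
    proof -
      have ge: "a i \<le> \<pi> i" using True i by simp
      show ?thesis
      proof (cases "i < n")
        case True
        then have c: "c i + g * (\<pi> i - a i) = e + g * (m - (m + i - \<pi> i))" if "\<pi> i - i \<le> m"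
          using that ge by (simp add: a_def c_def)
        show ?thesis
        proof (cases "\<pi> i - i \<le> m")
          case True
          then show ?thesis
            using p[of "m + i - \<pi> i"] \<open>i < n\<close> ge i less[OF i]
            unfolding c[OF True] by (simp add: sylvester_mat_sub_index a_def)
        qed (use \<open>i < n\<close> ge i less[OF i] in \<open>simp add: sylvester_mat_sub_index a_def zero\<close>)
      next
        case False
        then have c: "c i + g * (\<pi> i - a i) = g * (n - (i - \<pi> i))" if "\<pi> i \<le> i"
        proof -
          have "\<pi> i + n - i = n - (i - \<pi> i)" using that ge False by (simp add: a_def)
          then show ?thesis using False ge by (simp add: a_def c_def)
        qed
        show ?thesis
        proof (cases "\<pi> i \<le> i")
          case True
          then have "i - \<pi> i \<le> n" using ge False by (simp add: a_def)
          then show ?thesis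
            using q[of "i - \<pi> i"] False ge i less[OF i] True
            unfolding c[OF True] by (simp add: sylvester_mat_sub_index a_def)
        qed (use False ge i less[OF i] in \<open>simp add: sylvester_mat_sub_index a_def zero\<close>)
      qed
    qed
    have "(\<Sum>i = 0..<m + n. \<pi> i) = (\<Sum>i = 0..<m + n. i)"
      using sum.permute[OF \<pi>, of "\<lambda>i. i"] by (simp add: comp_def)
    also have "\<dots> = (\<Sum>i = 0..<n. i) + (\<Sum>i = n..<n + m. i)"
      by (simp add: sum.atLeastLessThan_concat add.commute)
    also have "(\<Sum>i = n..<n + m. i) = (\<Sum>i = 0..<m. i + n)"
      using sum.shift_bounds_nat_ivl[of "\<lambda>i. i" 0 n m] by (simp add: add.commute)
    finally have \<pi>sum: "(\<Sum>i = 0..<m + n. \<pi> i) = (\<Sum>i = 0..<n. i) + (\<Sum>i = 0..<m. i) + m * n"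
      by (simp add: sum.distrib)
    have "(\<Sum>i = 0..<m + n. a i) = (\<Sum>i = 0..<n. a i) + (\<Sum>i = n..<n + m. a i)"
      by (simp add: sum.atLeastLessThan_concat add.commute)
    also have "(\<Sum>i = n..<n + m. a i) = (\<Sum>i = 0..<m. a (i + n))"
      using sum.shift_bounds_nat_ivl[of a 0 n m] by (simp add: add.commute)
    finally have asum: "(\<Sum>i = 0..<m + n. a i) = (\<Sum>i = 0..<n. i) + (\<Sum>i = 0..<m. i)"
      by (simp add: a_def)
    have "(\<Sum>i = 0..<m + n. c i) = (\<Sum>i = 0..<n. c i) + (\<Sum>i = n..<n + m. c i)"
      by (simp add: sum.atLeastLessThan_concat add.commute)
    then have csum: "(\<Sum>i = 0..<m + n. c i) = e * n"
      by (simp add: c_def)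
    have "(\<Sum>i = 0..<m + n. \<pi> i - a i) = m * n"
      using True by (subst sum_subtractf_nat) (auto simp: \<pi>sum asum)
    then have w: "(\<Sum>i = 0..<m + n. c i + g * (\<pi> i - a i)) = e * n + g * (m * n)"
      by (simp add: sum.distrib csum flip: sum_distrib_left)
    show ?thesis
      unfolding w[symmetric] by (rule prod) (auto intro: entry)
  qed
qed auto

end

lemma coeff_mult_top:
  fixes p q :: "'a::comm_semiring_0 poly"
  assumes "degree p \<le> a" "degree q \<le> b"
  shows "coeff (p * q) (a + b) = coeff p a * coeff q b"
proof -
  have "coeff (p * q) (a + b) = (\<Sum>i\<le>a + b. if i = a then coeff p a * coeff q b else 0)"
    unfolding coeff_mult
  proof (rule sum.cong)
    fix i assume "i \<in> {..a + b}"
    then show "coeff p i * coeff q (a + b - i) = (if i = a then coeff p a * coeff q b else 0)"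
      using assms by (cases i a rule: linorder_cases) (auto simp: coeff_eq_0)
  qed simp
  then show ?thesis by simp
qed

interpretation top_coeff: graded_relation "\<lambda>n (p :: 'a::comm_ring_1 poly) c. degree p \<le> n \<and> coeff p n = c"
  by unfold_locales (auto simp: coeff_mult_top intro: degree_add_le degree_mult_le_add)

text \<open>
  Bezout's bound in \<open>x\<close>: a coefficient of \<open>y\<^sup>k\<close> in a polynomial of total degree \<open>m\<close> has weight \<open>m - k\<close>.
\<close>

lemma resultant_top_coeff:
  fixes p q :: "'a::comm_ring_1 poly poly"
  assumes "tdeg_le m p" "tdeg_le n q" "degree p = m" "degree q = n"
  shows "degree (resultant p q) \<le> m * n"
    and "coeff (resultant p q) (m * n) = resultant_sub m n (top_form m p) (top_form n q)"
proof -
  have "degree (resultant_sub m n p q) \<le> 0 * n + 1 * (m * n) \<and>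
    coeff (resultant_sub m n p q) (0 * n + 1 * (m * n)) = resultant_sub m n (top_form m p) (top_form n q)"
  proof (rule top_coeff.resultant)
    fix k assume "k \<le> m"
    then show "degree (coeff p k) \<le> 0 + 1 * (m - k) \<and>
        coeff (coeff p k) (0 + 1 * (m - k)) = coeff (top_form m p) k"
      using tdeg_leD[OF assms(1)] by (simp add: coeff_top_form coeff2_def)
  next
    fix k assume "k \<le> n"
    then show "degree (coeff q k) \<le> 1 * (n - k) \<and>
        coeff (coeff q k) (1 * (n - k)) = coeff (top_form n q) k"
      using tdeg_leD[OF assms(2)] by (simp add: coeff_top_form coeff2_def)
  qed
  then show "degree (resultant p q) \<le> m * n"
    and "coeff (resultant p q) (m * n) = resultant_sub m n (top_form m p) (top_form n q)"
    unfolding resultant_sub assms(3,4) by simp_all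
qed

interpretation coeff_degree: graded_relation
  "\<lambda>n (p :: 'a::comm_ring_1 poly poly) (_ :: 'a poly poly). \<forall>i. degree (coeff p i) \<le> n"
proof
  show "\<forall>i. degree (coeff (1 :: 'a poly poly) i) \<le> 0"
    by simp
  fix n n' and a a' :: "'a poly poly"
  assume "\<forall>i. degree (coeff a i) \<le> n" "\<forall>i. degree (coeff a' i) \<le> n'"
  then show "\<forall>i. degree (coeff (a * a') i) \<le> n + n'"
    by (auto simp: coeff_mult intro!: degree_sum_le degree_mult_le_add)
qed (auto intro: degree_add_le)

text \<open>
  Here the weight is the degree in the parameter \<open>t\<close>, which occurs linearly in \<open>p\<close> and not at all in \<open>q\<close>.
\<close>

lemma resultant_coeff_degree:
  fixes p q :: "'a::comm_ring_1 poly poly poly"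
  assumes "\<And>i j. degree (coeff2 p i j) \<le> 1" "\<And>i j. degree (coeff2 q i j) = 0"
  shows "degree (coeff (resultant p q) i) \<le> degree q"
  using coeff_degree.resultant[where e = 1 and g = 0 and m = "degree p" and n = "degree q"
      and p = p and q = q] assms
  by (simp add: coeff2_def resultant_sub)

section \<open>Resultants as products over roots\<close>

definition root_product :: "complex poly \<Rightarrow> complex poly \<Rightarrow> complex" where
  "root_product f h = lead_coeff f ^ degree h * (\<Prod>\<beta>\<in>#proots f. poly h \<beta>)"

lemma poly_conv_proots: "poly h x = lead_coeff h * (\<Prod>\<gamma>\<in>#proots h. x - \<gamma>)" for h :: "complex poly"
proof -
  have "poly h x = poly (Polynomial.smult (lead_coeff h) (\<Prod>\<gamma>\<in>#proots h. [:- \<gamma>, 1:])) x"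
    by (simp only: complex_poly_decompose_multiset)
  then show ?thesis by (simp add: poly_prod_mset image_mset.compositionality comp_def)
qed

text \<open>
  Both sides are \<open>\<Prod>\<^sub>\<beta> \<Prod>\<^sub>\<gamma> (\<beta> - \<gamma>)\<close>, up to leading coefficients and the signs of the factors.
\<close>

lemma root_product_swap: "root_product f h = (-1) ^ (degree f * degree h) * root_product h f"
proof -
  have expand: "root_product f h = lead_coeff f ^ degree h * lead_coeff h ^ degree f *
      (\<Prod>\<beta>\<in>#proots f. \<Prod>\<gamma>\<in>#proots h. \<beta> - \<gamma>)" for f h
    unfolding root_product_def poly_conv_proots[of h]
    by (simp add: prod_mset.distrib size_proots_complex)
  have "(\<Prod>\<beta>\<in>#proots f. \<Prod>\<gamma>\<in>#proots h. \<beta> - \<gamma>) =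
      (\<Prod>\<beta>\<in>#proots f. \<Prod>\<gamma>\<in>#proots h. (-1) * (\<gamma> - \<beta>))"
    by simp
  also have "\<dots> = (-1) ^ (degree f * degree h) * (\<Prod>\<beta>\<in>#proots f. \<Prod>\<gamma>\<in>#proots h. \<gamma> - \<beta>)"
    unfolding prod_mset.distrib
    by (simp add: size_proots_complex power_mult power_commutes flip: power_mult) (simp add: mult.commute)
  also have "(\<Prod>\<beta>\<in>#proots f. \<Prod>\<gamma>\<in>#proots h. \<gamma> - \<beta>) = (\<Prod>\<gamma>\<in>#proots h. \<Prod>\<beta>\<in>#proots f. \<gamma> - \<beta>)"
    by (rule prod_mset.swap)
  finally show ?thesis by (simp add: expand[of f h] expand[of h f] mult_ac)
qed

lemma prod_mset_proots_cong: "(\<And>x. poly h x = 0 \<Longrightarrow> g x = g' x) \<Longrightarrow> h \<noteq> 0 \<Longrightarrow>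
    (\<Prod>\<gamma>\<in>#proots h. g \<gamma>) = (\<Prod>\<gamma>\<in>#proots h. g' \<gamma>)" for h :: "complex poly"
  by (intro arg_cong[of _ _ prod_mset] image_mset_cong) simp

text \<open>
  The Euclidean algorithm: if \<open>r\<close> is the remainder of \<open>f\<close> modulo \<open>h\<close>, then \<open>r\<close> and \<open>f\<close> agree at the roots of \<open>h\<close>,
  and the resultants of \<open>(f, h)\<close> and of \<open>(h, r)\<close> differ by a sign and a power of the leading coefficient
  of \<open>h\<close>, exactly as the root products do.
\<close>

lemma resultant_root_product_degree_le:
  fixes f h :: "complex poly"
  assumes "h \<noteq> 0" "degree h \<le> degree f"
  shows "resultant f h = root_product f h"
  using assms
proof (induction "degree h" arbitrary: f h rule: less_induct)
  case less
  show ?case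
  proof (cases "degree h = 0")
    case True
    then obtain c where "h = [:c:]" by (auto elim: degree_eq_zeroE)
    then show ?thesis by (simp add: root_product_def size_proots_complex)
  next
    case False
    then have f: "f \<noteq> 0" using less.prems by auto
    define r where "r = f mod h"
    have fr: "f + (- (f div h)) * h = r" by (simp add: r_def minus_div_mult_eq_mod)
    have r: "poly r x = poly f x" if "poly h x = 0" for x
      using that by (simp flip: fr)
    have swap: "(-1) ^ (degree f * degree h) * (lead_coeff h ^ degree f * (\<Prod>\<gamma>\<in>#proots h. poly r \<gamma>))
        = root_product f h"
      unfolding root_product_swap[of f h]
      by (simp add: root_product_def prod_mset_proots_cong[OF r \<open>h \<noteq> 0\<close>])
    show ?thesis
    proof (cases "degree r = 0")
      case True
      then obtain c where c: "r = [:c:]" by (auto elim: degree_eq_zeroE)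
      have "[:resultant f h:] = Polynomial.smult ((-1) ^ (degree f * degree h) * lead_coeff h ^ degree f
          * c ^ (degree h - 1)) [:c:]"
        using BT_eq_19[OF fr less.prems(2), of 0] \<open>degree h \<noteq> 0\<close> f less.prems(1)
        by (simp add: c subresultant_resultant)
      then have "resultant f h = (-1) ^ (degree f * degree h) * lead_coeff h ^ degree f * c ^ degree h"
        using \<open>degree h \<noteq> 0\<close> by (simp add: power_eq_if mult_ac)
      then show ?thesis by (simp add: c size_proots_complex mult_ac flip: swap)
    next
      case False
      then have r0: "r \<noteq> 0" by auto
      then have deg: "degree r < degree h"
        using degree_mod_less[of h f] less.prems(1) by (simp add: r_def)
        have "[:resultant f h:] = Polynomial.smult ((-1) ^ (degree f * degree h) *
            lead_coeff h ^ (degree f - degree r)) [:resultant h r:]"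
          using BT_lemma_1_12[OF fr less.prems(2), of 0] False deg
          by (simp add: subresultant_resultant)
        moreover have "resultant h r = root_product h r"
          using less.hyps[OF deg r0] deg by simp
        ultimately have "resultant f h = (-1) ^ (degree f * degree h) *
            (lead_coeff h ^ (degree f - degree r) * lead_coeff h ^ degree r * (\<Prod>\<gamma>\<in>#proots h. poly r \<gamma>))"
          by (simp add: root_product_def mult_ac)
        also have "lead_coeff h ^ (degree f - degree r) * lead_coeff h ^ degree r = lead_coeff h ^ degree f"
          using deg less.prems(2) by (simp flip: power_add)
        finally show ?thesis by (simp add: swap)
    qed
  qed
qed

theorem resultant_root_product:
  fixes f h :: "complex poly"
  assumes "h \<noteq> 0" "f \<noteq> 0"
  shows "resultant f h = root_product f h"
proof (cases "degree h \<le> degree f")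
  case True
  then show ?thesis using assms by (simp add: resultant_root_product_degree_le)
next
  case False
  then show ?thesis using assms
    unfolding resultant_swap[of f h] root_product_swap[of f h]
    by (simp add: resultant_root_product_degree_le)
qed

lemma proots_reflect_poly:
  fixes p :: "complex poly"
  assumes "coeff p 0 \<noteq> 0"
  shows "proots (reflect_poly p) = image_mset inverse (proots p)"
proof -
  have p: "p \<noteq> 0" using assms by auto
  define c where "c = lead_coeff p"
  have c: "c \<noteq> 0" "p = Polynomial.smult c (\<Prod>\<beta>\<in>#proots p. [:- \<beta>, 1:])"
    unfolding c_def by (use p in simp) (rule complex_poly_decompose_multiset[symmetric])
  have "reflect_poly (\<Prod>\<beta>\<in>#M. [:- \<beta>, 1:]) =
      Polynomial.smult (\<Prod>\<beta>\<in>#M. - \<beta>) (\<Prod>\<beta>\<in>#M. [:- inverse \<beta>, 1:])" if "0 \<notin># M" for M :: "complex multiset"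
    using that
  proof (induction M)
    case (add \<beta> M)
    have "reflect_poly [:- \<beta>, 1:] = Polynomial.smult (- \<beta>) [:- inverse \<beta>, 1:]"
      using add.prems by (simp add: reflect_poly_def)
    then show ?case
      using add by (simp add: reflect_poly_mult del: mult_pCons_left mult_pCons_right smult_pCons)
        (simp add: mult.commute)
  qed simp
  moreover have "0 \<notin># proots p" using assms p by (simp add: poly_0_coeff_0)
  ultimately have "reflect_poly p = Polynomial.smult (c * (\<Prod>\<beta>\<in>#proots p. - \<beta>)) (\<Prod>\<beta>\<in>#proots p. [:- inverse \<beta>, 1:])"
    by (subst c(2)) (simp add: reflect_poly_smult)
  moreover have "c * (\<Prod>\<beta>\<in>#proots p. - \<beta>) \<noteq> 0"
    using c(1) \<open>0 \<notin># proots p\<close> by auto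
  ultimately have "proots (reflect_poly p) = proots (\<Prod>\<beta>\<in>#proots p. [:- inverse \<beta>, 1:])"
    by simp
  also have "proots (\<Prod>\<beta>\<in>#M. [:- inverse \<beta>, 1:]) = image_mset inverse M" for M :: "complex multiset"
  proof (induction M)
    case (add \<beta> M)
    have "(\<Prod>\<beta>\<in>#M. [:- inverse \<beta>, 1:]) \<noteq> 0" by auto
    then have "proots ([:- inverse \<beta>, 1:] * (\<Prod>\<beta>\<in>#M. [:- inverse \<beta>, 1:])) =
        {#inverse \<beta>#} + image_mset inverse M"
      using add proots_linear_factor[of "- inverse \<beta>"] by (subst proots_mult) auto
    then show ?case by simp
  qed simp
  finally show ?thesis .
qed

section \<open>The second coefficient of a resultant\<close>

text \<open>
  The second coefficient \<open>coeff p (a - 1)\<close> obeys the product rule. It is written as \<open>coeff (pCons 0 p) a\<close>,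
  which has the right value \<open>0\<close> for \<open>a = 0\<close>.
\<close>

lemma coeff_mult_second:
  fixes p q :: "'a::comm_ring_1 poly"
  assumes p: "degree p \<le> a" and q: "degree q \<le> b"
  shows "coeff (pCons 0 (p * q)) (a + b) =
    coeff p a * coeff (pCons 0 q) b + coeff (pCons 0 p) a * coeff q b"
proof -
  consider "a = 0" | "b = 0" | a' b' where "a = Suc a'" "b = Suc b'"
    by (cases a; cases b) auto
  then show ?thesis
  proof cases
    case 1
    then obtain c where "p = [:c:]" using p by (auto elim: degree_eq_zeroE)
    then show ?thesis using 1 by (simp add: coeff_pCons split: nat.split)
  next
    case 2
    then obtain c where "q = [:c:]" using q by (auto elim: degree_eq_zeroE)
    then show ?thesis using 2 by (simp add: coeff_pCons mult.commute split: nat.split)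
  next
    case 3
    have "coeff (p * q) (Suc (a' + b')) =
        (\<Sum>i\<le>Suc (a' + b'). (if i = a' then coeff p a' * coeff q b else 0) + (if i = a then coeff p a * coeff q b' else 0))"
      unfolding coeff_mult
    proof (rule sum.cong)
      fix i assume "i \<in> {..Suc (a' + b')}"
      then show "coeff p i * coeff q (Suc (a' + b') - i) =
          (if i = a' then coeff p a' * coeff q b else 0) + (if i = a then coeff p a * coeff q b' else 0)"
        using 3 p q coeff_eq_0[of p i] coeff_eq_0[of q "Suc (a' + b') - i"]
        by (cases i a' rule: linorder_cases; cases "i = a") (auto simp: not_le)
    qed simp
    also have "\<dots> = coeff p a' * coeff q b + coeff p a * coeff q b'"
      using 3 by (simp add: sum.distrib)
    finally show ?thesis using 3 by simp
  qed
qed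

text \<open>
  Polynomials in \<open>x\<close> and an outer variable \<open>\<lambda>\<close>, graded by giving \<open>\<lambda>\<close> the weight \<open>m\<close>.
\<close>

lemma weighted_degree_graded:
  "graded_relation (\<lambda>n (p :: 'a::comm_ring_1 poly poly) (_ :: 'a poly poly).
     \<forall>k. coeff p k \<noteq> 0 \<longrightarrow> m * k + degree (coeff p k) \<le> n)"
proof
  fix n and a a' b b' :: "'a poly poly"
  assume *: "\<forall>k. coeff a k \<noteq> 0 \<longrightarrow> m * k + degree (coeff a k) \<le> n"
    "\<forall>k. coeff a' k \<noteq> 0 \<longrightarrow> m * k + degree (coeff a' k) \<le> n"
  show "\<forall>k. coeff (a + a') k \<noteq> 0 \<longrightarrow> m * k + degree (coeff (a + a') k) \<le> n"
  proof safe
    fix k assume nz: "coeff (a + a') k \<noteq> 0"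
    then have "coeff a k \<noteq> 0 \<or> coeff a' k \<noteq> 0" by auto
    then have "degree (coeff a k) \<le> n - m * k" "degree (coeff a' k) \<le> n - m * k" "m * k \<le> n"
      using *[rule_format, of k] by (auto, (cases "coeff a k = 0"; cases "coeff a' k = 0"; force)+)
    then show "m * k + degree (coeff (a + a') k) \<le> n"
      using degree_add_le[of "coeff a k" "n - m * k" "coeff a' k"] by simp
  qed
next
  fix n n' and a a' b b' :: "'a poly poly"
  assume *: "\<forall>k. coeff a k \<noteq> 0 \<longrightarrow> m * k + degree (coeff a k) \<le> n"
    "\<forall>k. coeff a' k \<noteq> 0 \<longrightarrow> m * k + degree (coeff a' k) \<le> n'"
  show "\<forall>k. coeff (a * a') k \<noteq> 0 \<longrightarrow> m * k + degree (coeff (a * a') k) \<le> n + n'"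
  proof safe
    fix k assume nz: "coeff (a * a') k \<noteq> 0"
    have summand: "m * k + degree (coeff a i * coeff a' (k - i)) \<le> n + n'"
      if "coeff a i * coeff a' (k - i) \<noteq> 0" "i \<le> k" for i
    proof -
      have "coeff a i \<noteq> 0" "coeff a' (k - i) \<noteq> 0" using that by auto
      then have "m * i + degree (coeff a i) \<le> n" "m * (k - i) + degree (coeff a' (k - i)) \<le> n'"
        using * by auto
      moreover have "m * k = m * i + m * (k - i)" using that by (simp flip: add_mult_distrib2)
      ultimately show ?thesis using degree_mult_le[of "coeff a i" "coeff a' (k - i)"] by linarith
    qed
    from nz obtain i where "i \<le> k" "coeff a i * coeff a' (k - i) \<noteq> 0"
      unfolding coeff_mult by (meson atMost_iff sum.neutral)
    then have k: "m * k \<le> n + n'" using summand[of i] by simp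
    have "degree (coeff (a * a') k) \<le> n + n' - m * k"
      unfolding coeff_mult
    proof (rule degree_sum_le)
      fix i assume "i \<in> {..k}"
      then show "degree (coeff a i * coeff a' (k - i)) \<le> n + n' - m * k"
        using summand[of i] by (cases "coeff a i * coeff a' (k - i) = 0") auto
    qed simp
    then show "m * k + degree (coeff (a * a') k) \<le> n + n'" using k by simp
  qed
qed (auto simp: coeff_1)

text \<open>
  Let \<open>T\<close> be the resultant of \<open>h + \<lambda>\<close> and \<open>f\<close>, with \<open>\<lambda>\<close> a new variable. If \<open>\<lambda>\<close> is given the weight \<open>m\<close>, then \<open>T\<close>
  has weight \<open>m n\<close>. Substituting \<open>\<lambda> = \<mu> x\<^sup>m + \<nu> x\<^sup>m\<^sup>-\<^sup>1 = x\<^sup>m\<^sup>-\<^sup>1 (\<mu> x + \<nu>)\<close> and expanding to first order below the top,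
  \<open>\<nu>\<close> enters through \<open>(\<mu> x + \<nu>)\<^sup>k = \<mu>\<^sup>k x\<^sup>k + k \<nu> \<mu>\<^sup>k\<^sup>-\<^sup>1 x\<^sup>k\<^sup>-\<^sup>1 + \<dots>\<close> only, and the factors \<open>k \<mu>\<^sup>k\<^sup>-\<^sup>1\<close> assemble to the derivative of
  the top coefficient \<open>\<tau>\<close>.
\<close>

theorem resultant_second_coeff_affine:
  fixes h f :: "'a::idom poly poly"
  assumes h: "tdeg_le m h" "degree h = m" and f: "tdeg_le n f" "degree f = n" and mn: "m > 0" "n > 0"
  obtains \<tau> where
    "\<And>\<mu>. coeff (resultant (h + [:monom \<mu> m:]) f) (m * n) = poly \<tau> \<mu>"
    "\<And>\<mu> \<nu>. coeff (resultant (h + [:monom \<mu> m + monom \<nu> (m - 1):]) f) (m * n - 1) =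
       coeff (resultant (h + [:monom \<mu> m:]) f) (m * n - 1) + \<nu> * poly (pderiv \<tau>) \<mu>"
proof -
  let ?c = "map_poly (\<lambda>c. [:c:])"
  \<comment> \<open>Coefficients in \<open>x\<close> become constants in \<open>\<lambda>\<close>; the innermost \<open>[:0, 1:]\<close> is \<open>\<lambda>\<close>.\<close>
  define hT where "hT = ?c h + [:[:0, 1:]:]"
  define T where "T = resultant hT (?c f)"
  have deg_c: "degree (?c p) = degree p" for p :: "'a poly poly"
    by (cases "p = 0") (auto simp: degree_map_poly)
  have deg_hT: "degree hT = m"
    unfolding hT_def using h(2) mn by (subst degree_add_eq_left) (simp_all add: deg_c)
  interpret graded_relation "\<lambda>n (p :: 'a poly poly) (_ :: 'a poly poly).
      \<forall>k. coeff p k \<noteq> 0 \<longrightarrow> m * k + degree (coeff p k) \<le> n"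
    by (rule weighted_degree_graded)
  have deg_fT: "degree (?c f) = n"
    using f(2) by (simp add: deg_c)
  have "\<forall>k. coeff T k \<noteq> 0 \<longrightarrow> m * k + degree (coeff T k) \<le> 0 * n + 1 * (m * n)"
    unfolding T_def resultant_sub deg_hT deg_fT
  proof (rule resultant)
    fix j assume "j \<le> m"
    then show "\<forall>k. coeff (coeff hT j) k \<noteq> 0 \<longrightarrow> m * k + degree (coeff (coeff hT j) k) \<le> 0 + 1 * (m - j)"
      using tdeg_leD[OF h(1), of j] by (auto simp: hT_def coeff_map_poly coeff_pCons split: nat.splits)
  next
    fix j assume "j \<le> n"
    then show "\<forall>k. coeff (coeff (?c f) j) k \<noteq> 0 \<longrightarrow> m * k + degree (coeff (coeff (?c f) j) k) \<le> 1 * (n - j)"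
      using tdeg_leD[OF f(1)] by (auto simp: coeff_map_poly coeff_pCons split: nat.splits)
  qed
  then have T: "m * k + degree (coeff T k) \<le> m * n" if "coeff T k \<noteq> 0" for k
    using that by simp
  have kn: "k \<le> n" if "coeff T k \<noteq> 0" for k
    using T[OF that] mn(1) by (metis add_leD1 mult_le_cancel1)
  have res_T: "resultant (h + [:a:]) f = poly T a" for a
  proof -
    have ha: "map_poly (\<lambda>p. poly p a) hT = h + [:a:]" and fa: "map_poly (\<lambda>p. poly p a) (?c f) = f"
      by (auto simp: hT_def poly_eq_iff coeff_map_poly coeff_pCons split: nat.split)
    have "degree (h + [:a:]) = m" using h(2) mn by (simp add: degree_add_eq_left)
    then show ?thesis
      using poly_hom.resultant_map_poly[of a hT "?c f"] deg_hT deg_fT f(2)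
      unfolding T_def ha fa by simp
  qed
  have poly_T: "poly T a = (\<Sum>k\<le>n. coeff T k * a ^ k)" for a
  proof -
    have "degree T \<le> n" using kn by (intro degree_le) (metis not_le)
    then show ?thesis unfolding poly_altdef
      by (intro sum.mono_neutral_left) (auto simp: coeff_eq_0)
  qed
  define \<tau> where "\<tau> = (\<Sum>k\<le>n. monom (coeff (coeff T k) (m * n - m * k)) k)"
  define \<sigma> where "\<sigma> \<mu> = (\<Sum>k\<le>n. coeff (pCons 0 (coeff T k)) (m * n - m * k) * \<mu> ^ k)" for \<mu>
  have lin: "monom \<mu> m + monom \<nu> (m - 1) = monom 1 (m - 1) * [:\<nu>, \<mu>:]" for \<mu> \<nu> :: 'a
    using mn(1) by (auto simp: poly_eq_iff coeff_monom_mult coeff_pCons split: nat.split)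
  define a where "a \<mu> \<nu> = monom \<mu> m + monom \<nu> (m - 1)" for \<mu> \<nu> :: 'a
  have a_pow: "a \<mu> \<nu> ^ k = monom 1 ((m - 1) * k) * [:\<nu>, \<mu>:] ^ k" for \<mu> \<nu> k
    unfolding a_def lin power_mult_distrib by (simp add: monom_power)
  have deg_a: "degree (a \<mu> \<nu> ^ k) \<le> m * k" for \<mu> \<nu> k
  proof -
    have "degree (a \<mu> \<nu>) \<le> m" unfolding a_def
      by (intro degree_add_le) (auto intro: order.trans[OF degree_monom_le])
    then have "k * degree (a \<mu> \<nu>) \<le> k * m" by simp
    then show ?thesis using degree_power_le[of "a \<mu> \<nu>" k] by (simp only: mult.commute)
  qed
  have mk: "m * k = (m - 1) * k + k" for k using mn(1) by (cases m) auto
  have a_top: "coeff (a \<mu> \<nu> ^ k) (m * k) = \<mu> ^ k" for \<mu> \<nu> k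
    unfolding a_pow mk coeff_monom_mult by (simp add: coeff_linear_poly_power)
  have a_second: "coeff (pCons 0 (a \<mu> \<nu> ^ k)) (m * k) = \<nu> * (of_nat k * \<mu> ^ (k - 1))" for \<mu> \<nu> k
  proof (cases k)
    case (Suc l)
    then have "m * k = Suc ((m - 1) * k + l)" using mk[of k] by simp
    then have "coeff (pCons 0 (a \<mu> \<nu> ^ k)) (m * k) = coeff ([:\<nu>, \<mu>:] ^ k) l"
      unfolding a_pow by (simp add: coeff_monom_mult)
    then show ?thesis unfolding Suc by (simp only: coeff_linear_poly_power) simp
  qed simp
  have deg_T: "degree (coeff T k) \<le> m * n - m * k" for k
    using T[of k] by (cases "coeff T k = 0") auto
  have split: "(m * n - m * k) + m * k = m * n" if "k \<le> n" for k
    using that by simp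
  have mult_top: "coeff (coeff T k * a \<mu> \<nu> ^ k) (m * n) = coeff (coeff T k) (m * n - m * k) * \<mu> ^ k"
    if "k \<le> n" for k \<mu> \<nu>
    using coeff_mult_top[OF deg_T[of k] deg_a[of \<mu> \<nu> k]] split[OF that] by (simp add: a_top)
  have mult_second: "coeff (pCons 0 (coeff T k * a \<mu> \<nu> ^ k)) (m * n) =
      coeff (coeff T k) (m * n - m * k) * (\<nu> * (of_nat k * \<mu> ^ (k - 1))) +
      coeff (pCons 0 (coeff T k)) (m * n - m * k) * \<mu> ^ k" if "k \<le> n" for k \<mu> \<nu>
    using coeff_mult_second[OF deg_T[of k] deg_a[of \<mu> \<nu> k]] split[OF that]
    unfolding a_top a_second by simp
  show ?thesis
  proof
    show top: "coeff (resultant (h + [:monom \<mu> m:]) f) (m * n) = poly \<tau> \<mu>" for \<mu>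
    proof -
      have "coeff (resultant (h + [:a \<mu> 0:]) f) (m * n) = (\<Sum>k\<le>n. coeff (coeff T k * a \<mu> 0 ^ k) (m * n))"
        by (simp add: res_T poly_T coeff_sum)
      also have "\<dots> = (\<Sum>k\<le>n. coeff (coeff T k) (m * n - m * k) * \<mu> ^ k)"
        by (intro sum.cong refl) (simp add: mult_top)
      finally show ?thesis by (simp add: \<tau>_def a_def poly_sum poly_monom)
    qed
    have second: "coeff (resultant (h + [:a \<mu> \<nu>:]) f) (m * n - 1) = \<sigma> \<mu> + \<nu> * poly (pderiv \<tau>) \<mu>" for \<mu> \<nu>
    proof -
      have "coeff (resultant (h + [:a \<mu> \<nu>:]) f) (m * n - 1) = coeff (pCons 0 (poly T (a \<mu> \<nu>))) (m * n)"
        using mn by (simp add: res_T coeff_pCons split: nat.split)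
      also have "pCons 0 (poly T (a \<mu> \<nu>)) = (\<Sum>k\<le>n. pCons 0 (coeff T k * a \<mu> \<nu> ^ k))"
        unfolding poly_T by (rule pCons_0_hom.hom_sum)
      also have "coeff \<dots> (m * n) = (\<Sum>k\<le>n. coeff (pCons 0 (coeff T k * a \<mu> \<nu> ^ k)) (m * n))"
        by (simp add: coeff_sum)
      also have "\<dots> = (\<Sum>k\<le>n. coeff (coeff T k) (m * n - m * k) * (\<nu> * (of_nat k * \<mu> ^ (k - 1))) +
          coeff (pCons 0 (coeff T k)) (m * n - m * k) * \<mu> ^ k)"
        by (intro sum.cong refl) (simp only: mult_second atMost_iff)
      also have "\<dots> = \<sigma> \<mu> + \<nu> * poly (pderiv \<tau>) \<mu>"
        by (simp add: \<sigma>_def \<tau>_def pderiv_sum pderiv_monom poly_sum poly_monom sum.distrib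
            sum_distrib_left mult_ac)
      finally show ?thesis .
    qed
    show "coeff (resultant (h + [:monom \<mu> m + monom \<nu> (m - 1):]) f) (m * n - 1) =
       coeff (resultant (h + [:monom \<mu> m:]) f) (m * n - 1) + \<nu> * poly (pderiv \<tau>) \<mu>" for \<mu> \<nu>
      using second[of \<mu> \<nu>] second[of \<mu> 0] by (simp add: a_def)
  qed
qed

section \<open>Resultants of a curve with a pencil\<close>

lemma comm_ring_hom_map_poly_eval: "comm_ring_hom (map_poly (\<lambda>p. poly p (t :: 'a::comm_ring_1)))"
proof -
  interpret map_poly_comm_ring_hom "\<lambda>p. poly p t" ..
  show ?thesis by (rule comm_ring_hom_axioms)
qed

lemma map_poly_eval_mult:
  "map_poly (\<lambda>p. poly p (t :: 'a::comm_ring_1)) (p * q) = map_poly (\<lambda>p. poly p t) p * map_poly (\<lambda>p. poly p t) q"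
proof -
  interpret map_poly_comm_ring_hom "\<lambda>p. poly p t" ..
  show ?thesis by (rule hom_mult)
qed

lemma resultant_top_coeff_complex:
  fixes h f :: "complex poly poly"
  assumes h: "tdeg_le m h" "coeff2 h 0 m \<noteq> 0" and f: "tdeg_le n f" "coeff2 f 0 n \<noteq> 0"
  shows "coeff (resultant h f) (m * n) =
    (-1) ^ (m * n) * coeff2 f 0 n ^ m * (\<Prod>\<beta>\<in>#proots (top_form n f). poly (top_form m h) \<beta>)"
proof -
  note deg = degree_top_form[OF h(2)] degree_top_form[OF f(2)]
  have nz: "top_form m h \<noteq> 0" "top_form n f \<noteq> 0"
    using deg h(2) f(2) by auto
  have "coeff (resultant h f) (m * n) = resultant (top_form m h) (top_form n f)"
    using resultant_top_coeff(2)[OF h(1) f(1) degree_eq_if_tdeg_le[OF h] degree_eq_if_tdeg_le[OF f]]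
    by (simp add: resultant_sub[of "top_form m h"] deg)
  also have "\<dots> = (-1) ^ (m * n) * root_product (top_form n f) (top_form m h)"
    unfolding resultant_root_product[OF nz(2,1)] root_product_swap[of "top_form m h"] deg ..
  finally show ?thesis
    unfolding root_product_def deg(4) deg(1) by (simp only: mult.assoc)
qed

text \<open>
  \<open>h = a + t b\<close>, as a polynomial in \<open>x, y\<close> over \<open>\<complex>[t]\<close>.
\<close>

definition is_pencil :: "complex poly poly poly \<Rightarrow> complex poly poly \<Rightarrow> complex poly poly \<Rightarrow> bool" where
  "is_pencil h a b \<longleftrightarrow> (\<forall>i j. coeff2 h i j = [:coeff2 a i j, coeff2 b i j:])"

abbreviation lift_t :: "complex poly poly \<Rightarrow> complex poly poly poly" where
  "lift_t \<equiv> map_poly (map_poly (\<lambda>c. [:c:]))"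

text \<open>
  The curve \<open>f = 0\<close> of degree \<open>n\<close>, which avoids \<open>(0 : 1 : 0)\<close>, is intersected with curves of degree \<open>m\<close>.
\<close>

locale pencil_resultant =
  fixes m n :: nat and f :: "complex poly poly"
  assumes mn: "m > 0" "n > 0" and f: "tdeg_le n f" "coeff2 f 0 n \<noteq> 0"
begin

definition lead :: "complex poly poly \<Rightarrow> complex poly poly \<Rightarrow> complex poly" where
  "lead a b = Polynomial.smult ((-1) ^ (m * n) * coeff2 f 0 n ^ m)
     (\<Prod>\<beta>\<in>#proots (top_form n f). [:poly (top_form m a) \<beta>, poly (top_form m b) \<beta>:])"

lemma size_roots: "size (proots (top_form n f)) = n"
  using degree_top_form[OF f(2)] by (simp add: size_proots_complex)

lemma degree_lead:
  assumes "\<And>\<beta>. poly (top_form n f) \<beta> = 0 \<Longrightarrow> poly (top_form m b) \<beta> \<noteq> 0"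
  shows "degree (lead a b) = n" "lead a b \<noteq> 0"
proof -
  have "top_form n f \<noteq> 0" using degree_top_form[OF f(2)] f(2) by auto
  have "degree (\<Prod>\<beta>\<in>#M. [:poly (top_form m a) \<beta>, poly (top_form m b) \<beta>:]) = size M \<and>
      (\<Prod>\<beta>\<in>#M. [:poly (top_form m a) \<beta>, poly (top_form m b) \<beta>:]) \<noteq> 0"
    if "\<And>\<beta>. \<beta> \<in># M \<Longrightarrow> poly (top_form m b) \<beta> \<noteq> 0" for M
    using that by (induction M) (auto simp: degree_mult_eq simp del: mult_pCons_left)
  from this[of "proots (top_form n f)"] assms \<open>top_form n f \<noteq> 0\<close>
  show "degree (lead a b) = n" "lead a b \<noteq> 0"
    using f(2) by (auto simp: lead_def size_roots)
qed

context
  fixes h a b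
  assumes h: "is_pencil h a b" and ab: "tdeg_le m a" "tdeg_le m b"
    and nz: "[:coeff2 a 0 m, coeff2 b 0 m:] \<noteq> 0"
begin

lemma tdeg_h: "tdeg_le m h" "coeff2 h 0 m \<noteq> 0" "degree h = m"
proof -
  show "tdeg_le m h" using h ab by (auto simp: tdeg_le_def is_pencil_def)
  show "coeff2 h 0 m \<noteq> 0" using h nz by (auto simp: is_pencil_def)
  with \<open>tdeg_le m h\<close> show "degree h = m" by (rule degree_eq_if_tdeg_le)
qed

lemma tdeg_lift: "tdeg_le n (lift_t f)" "coeff2 (lift_t f) 0 n \<noteq> 0" "degree (lift_t f) = n"
proof -
  show "tdeg_le n (lift_t f)" using f by (auto simp: tdeg_le_def)
  show "coeff2 (lift_t f) 0 n \<noteq> 0" using f by auto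
  with \<open>tdeg_le n (lift_t f)\<close> show "degree (lift_t f) = n" by (rule degree_eq_if_tdeg_le)
qed

text \<open>
  The resultant commutes with evaluation at every \<open>t\<close> at which the pencil keeps its degree in \<open>y\<close>.
\<close>

lemma eval_resultant:
  assumes t: "poly [:coeff2 a 0 m, coeff2 b 0 m:] t \<noteq> 0"
  shows "poly (coeff (resultant h (lift_t f)) i) t =
    coeff (resultant (a + Polynomial.smult [:t:] b) f) i"
proof -
  let ?e = "map_poly (map_poly (\<lambda>p. poly p t))"
  have h': "?e h = a + Polynomial.smult [:t:] b" and f': "?e (lift_t f) = f"
    unfolding poly2_eq_iff using h by (simp_all add: is_pencil_def)
  have "tdeg_le m (a + Polynomial.smult [:t:] b)"
    by (rule tdeg_le_mono[OF _ ab]) auto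
  moreover have "coeff2 (a + Polynomial.smult [:t:] b) 0 m \<noteq> 0" using t by simp
  ultimately have "degree (?e h) = degree h"
    unfolding tdeg_h h' by (rule degree_eq_if_tdeg_le)
  moreover have "degree (?e (lift_t f)) = degree (lift_t f)"
    unfolding tdeg_lift f' by (rule degree_eq_if_tdeg_le[OF f])
  ultimately have "resultant (?e h) (?e (lift_t f)) = map_poly (\<lambda>p. poly p t) (resultant h (lift_t f))"
    by (rule comm_ring_hom.resultant_map_poly[OF comm_ring_hom_map_poly_eval])
  then have "coeff (resultant (?e h) (?e (lift_t f))) i = poly (coeff (resultant h (lift_t f)) i) t"
    by (simp add: coeff_map_poly)
  then show ?thesis by (simp only: h' f')
qed

lemma coeff_resultant_lead: "coeff (resultant h (lift_t f)) (m * n) = lead a b"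
proof (rule cofinite_poly_eq[OF nz])
  fix t assume t: "poly [:coeff2 a 0 m, coeff2 b 0 m:] t \<noteq> 0"
  have "tdeg_le m (a + Polynomial.smult [:t:] b)"
    by (rule tdeg_le_mono[OF _ ab]) auto
  moreover have "coeff2 (a + Polynomial.smult [:t:] b) 0 m \<noteq> 0" using t by simp
  moreover have "top_form m (a + Polynomial.smult [:t:] b) = top_form m a + Polynomial.smult t (top_form m b)"
    by (simp add: poly_eq_iff coeff_top_form)
  ultimately show "poly (coeff (resultant h (lift_t f)) (m * n)) t = poly (lead a b) t"
    using f by (simp add: eval_resultant[OF t] resultant_top_coeff_complex lead_def poly_prod_mset
        image_mset.compositionality comp_def)
qed

lemma degree_coeff_resultant: "degree (coeff (resultant h (lift_t f)) i) \<le> n"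
proof -
  have "degree (coeff2 h i j) \<le> 1" "degree (coeff2 (lift_t f) i j) = 0" for i j
    using h by (auto simp: is_pencil_def)
  from resultant_coeff_degree[of h "lift_t f", OF this] show ?thesis by (simp add: tdeg_lift)
qed

end

text \<open>
  Differentiating \<open>\<Prod>\<^sub>\<beta> (A \<beta> + B \<beta> t + \<lambda>)\<close> with respect to \<open>\<lambda>\<close> removes one of the factors, each of which is linear in \<open>t\<close>.
\<close>

lemma degree_pderiv_prod_linear:
  fixes A B :: "complex \<Rightarrow> complex"
  shows "degree (poly (\<Prod>\<beta>\<in>#M. [:[:A \<beta>, B \<beta>:], 1:]) [:\<mu>:]) \<le> size M \<and>
    (M \<noteq> {#} \<longrightarrow> degree (poly (pderiv (\<Prod>\<beta>\<in>#M. [:[:A \<beta>, B \<beta>:], 1:])) [:\<mu>:]) < size M)"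
proof (induction M)
  case (add \<beta> M)
  let ?p = "\<Prod>\<beta>\<in>#M. [:[:A \<beta>, B \<beta>:], 1:]"
  have p: "degree (poly ?p [:\<mu>:]) \<le> size M" and p': "M \<noteq> {#} \<Longrightarrow> degree (poly (pderiv ?p) [:\<mu>:]) \<le> size M - 1"
    using add by auto
  have lin: "degree (poly [:[:A \<beta>, B \<beta>:], 1:] [:\<mu>:]) \<le> 1" by simp
  have d: "degree (poly ([:[:A \<beta>, B \<beta>:], 1:] * ?p) [:\<mu>:]) \<le> Suc (size M)"
    unfolding plus_1_eq_Suc[symmetric]
    unfolding poly_mult by (rule degree_mult_le_add[OF lin p])
  have s: "degree (poly [:[:A \<beta>, B \<beta>:], 1:] [:\<mu>:] * poly (pderiv ?p) [:\<mu>:]) \<le> size M"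
  proof (cases "M = {#}")
    case False
    then have "1 + (size M - 1) = size M" by (cases M) auto
    then show ?thesis using degree_mult_le_add[OF lin p'[OF False]] by simp
  qed simp
  have "pderiv ([:[:A \<beta>, B \<beta>:], 1:] * ?p) = [:[:A \<beta>, B \<beta>:], 1:] * pderiv ?p + ?p"
    unfolding pderiv_mult by (simp add: pderiv_pCons)
  then have "poly (pderiv ([:[:A \<beta>, B \<beta>:], 1:] * ?p)) [:\<mu>:] =
      poly [:[:A \<beta>, B \<beta>:], 1:] [:\<mu>:] * poly (pderiv ?p) [:\<mu>:] + poly ?p [:\<mu>:]"
    by (simp only: poly_add poly_mult)
  then have "degree (poly (pderiv ([:[:A \<beta>, B \<beta>:], 1:] * ?p)) [:\<mu>:]) \<le> size M"
    using degree_add_le[OF s p] by (simp only:)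
  with d show ?case
    by (simp only: image_mset_add_mset prod_mset.add_mset size_add_mset less_Suc_eq_le simp_thms)
qed simp

text \<open>
  Adding \<open>\<nu> x\<^sup>m\<^sup>-\<^sup>1\<close> changes the second coefficient by \<open>\<nu> E\<close> with \<open>deg E < n\<close>, but leaves the top coefficient, which has
  degree \<open>n\<close>, unchanged. So \<open>\<nu> = 0\<close> and \<open>\<nu> = 1\<close> cannot both give proportional coefficients unless \<open>E = 0\<close>, and this
  is excluded by the choice of \<open>\<mu>\<close>. The set \<open>F\<close> of forbidden \<open>\<mu>\<close> leaves room for another open condition.
\<close>

lemma ex_nonproportional:
  assumes ab: "tdeg_le m a" "tdeg_le m b" "[:coeff2 a 0 m, coeff2 b 0 m:] \<noteq> 0"
    and b: "\<And>\<beta>. poly (top_form n f) \<beta> = 0 \<Longrightarrow> poly (top_form m b) \<beta> \<noteq> 0"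
    and F: "finite F"
    and h: "\<And>\<mu> \<nu>. is_pencil (h \<mu> \<nu>) (a + [:monom \<mu> m + monom \<nu> (m - 1):]) b"
  obtains \<mu> \<nu> where "\<mu> \<notin> F"
    "\<And>c. coeff (resultant (h \<mu> \<nu>) (lift_t f)) (m * n - 1) \<noteq>
       Polynomial.smult c (coeff (resultant (h \<mu> \<nu>) (lift_t f)) (m * n))"
proof -
  define M where "M = proots (top_form n f)"
  define K where "K = (-1) ^ (m * n) * coeff2 f 0 n ^ m"
  define A B where "A = poly (top_form m a)" and "B = poly (top_form m b)"
  define E where "E \<mu> = Polynomial.smult K (poly (pderiv (\<Prod>\<beta>\<in>#M. [:[:A \<beta>, B \<beta>:], 1:])) [:\<mu>:])" for \<mu>
  have poly_E: "poly (E \<mu>) t = K * poly (pderiv (\<Prod>\<beta>\<in>#M. [:A \<beta> + t * B \<beta>, 1:])) \<mu>" for \<mu> t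
  proof -
    have "poly (poly q [:\<mu>:]) t = poly (map_poly (\<lambda>p. poly p t) q) \<mu>" for q
      using poly_hom.poly_map_poly[of t q "[:\<mu>:]"]
      by (simp only: poly_pCons poly_0 mult_zero_right add_0_right)
    moreover have "map_poly (\<lambda>p. poly p t) (\<Prod>\<beta>\<in>#M. [:[:A \<beta>, B \<beta>:], 1:]) = (\<Prod>\<beta>\<in>#M. [:A \<beta> + t * B \<beta>, 1:])"
    proof (induction M)
      case (add \<beta> M)
      have "map_poly (\<lambda>p. poly p t) [:[:A \<beta>, B \<beta>:], 1:] = [:A \<beta> + t * B \<beta>, 1:]"
        by (simp add: map_poly_pCons)
      then show ?case
        by (simp only: image_mset_add_mset prod_mset.add_mset add.IH map_poly_eval_mult)
    qed simp
    ultimately show ?thesis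
      by (simp only: E_def poly_smult poly_hom.map_poly_pderiv)
  qed
  let ?a = "\<lambda>\<mu> \<nu>. a + [:monom \<mu> m + monom \<nu> (m - 1):]"
  let ?S = "\<lambda>\<mu> \<nu>. resultant (h \<mu> \<nu>) (lift_t f)"
  have tm: "tdeg_le m [:monom \<mu> m + monom \<nu> (m - 1):]" for \<mu> \<nu> :: complex
    by (auto simp: tdeg_le_def)
  have ta: "tdeg_le m (?a \<mu> \<nu>)" for \<mu> \<nu>
    by (rule tdeg_le_mono[OF _ ab(1) tm[of \<mu> \<nu>]]) auto
  have na: "[:coeff2 (?a \<mu> \<nu>) 0 m, coeff2 b 0 m:] \<noteq> 0" for \<mu> \<nu>
    using ab mn by simp
  have diff: "coeff (?S \<mu> \<nu>) (m * n - 1) = coeff (?S \<mu> 0) (m * n - 1) + Polynomial.smult \<nu> (E \<mu>)" for \<mu> \<nu>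
  proof (rule cofinite_poly_eq[OF ab(3)])
    fix t assume t: "poly [:coeff2 a 0 m, coeff2 b 0 m:] t \<noteq> 0"
    define k where "k = a + Polynomial.smult [:t:] b"
    have k: "tdeg_le m k" "coeff2 k 0 m \<noteq> 0"
      unfolding k_def using t by (auto intro!: tdeg_le_mono[OF _ ab(1,2)])
    have at: "?a \<mu> \<nu> + Polynomial.smult [:t:] b = k + [:monom \<mu> m + monom \<nu> (m - 1):]" for \<mu> \<nu>
      by (simp add: k_def)
    have t': "poly [:coeff2 (?a \<mu> \<nu>) 0 m, coeff2 b 0 m:] t \<noteq> 0" for \<mu> \<nu>
      using t mn by simp
    obtain \<tau> where \<tau>: "\<And>\<mu>. coeff (resultant (k + [:monom \<mu> m:]) f) (m * n) = poly \<tau> \<mu>"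
      "\<And>\<mu> \<nu>. coeff (resultant (k + [:monom \<mu> m + monom \<nu> (m - 1):]) f) (m * n - 1) =
         coeff (resultant (k + [:monom \<mu> m:]) f) (m * n - 1) + \<nu> * poly (pderiv \<tau>) \<mu>"
      using resultant_second_coeff_affine[OF k(1) degree_eq_if_tdeg_le[OF k] f(1) degree_eq_if_tdeg_le[OF f] mn]
      by blast
    have "poly \<tau> \<mu> = poly (Polynomial.smult K (\<Prod>\<beta>\<in>#M. [:A \<beta> + t * B \<beta>, 1:])) \<mu>" for \<mu>
    proof -
      have "tdeg_le m [:monom \<mu> m:]" by (auto simp: tdeg_le_def)
      then have "tdeg_le m (k + [:monom \<mu> m:])"
        by (rule tdeg_le_mono[OF _ k(1), rotated]) auto
      moreover have "coeff2 (k + [:monom \<mu> m:]) 0 m \<noteq> 0" using k mn by simp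
      moreover have "top_form m (k + [:monom \<mu> m:]) = top_form m a + Polynomial.smult t (top_form m b) + [:\<mu>:]"
        by (auto simp: poly_eq_iff coeff_top_form k_def coeff_pCons split: nat.split)
      ultimately show ?thesis
        using f by (simp add: \<tau>(1)[symmetric] resultant_top_coeff_complex K_def M_def A_def B_def
            poly_prod_mset image_mset.compositionality comp_def add_ac)
    qed
    then have "\<tau> = Polynomial.smult K (\<Prod>\<beta>\<in>#M. [:A \<beta> + t * B \<beta>, 1:])"
      using poly_eq_poly_eq_iff by blast
    then have "poly (pderiv \<tau>) \<mu> = poly (E \<mu>) t"
      by (simp add: poly_E pderiv_smult)
    then show "poly (coeff (?S \<mu> \<nu>) (m * n - 1)) t =
        poly (coeff (?S \<mu> 0) (m * n - 1) + Polynomial.smult \<nu> (E \<mu>)) t"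
      using \<tau>(2)[of \<mu> \<nu>] \<tau>(2)[of \<mu> 0]
      unfolding poly_add poly_smult eval_resultant[OF h ta ab(2) na t'] at by simp
  qed
  have lead: "coeff (?S \<mu> \<nu>) (m * n) = lead (?a \<mu> 0) b" for \<mu> \<nu>
  proof -
    have "top_form m (?a \<mu> \<nu>) = top_form m (?a \<mu> 0)"
      using mn by (auto simp: poly_eq_iff coeff_top_form)
    then show ?thesis by (simp add: coeff_resultant_lead[OF h ta ab(2) na] lead_def)
  qed
  have "M \<noteq> {#}" using size_roots mn by (auto simp: M_def)
  have degE: "degree (E \<mu>) < n" for \<mu>
    unfolding E_def
    by (rule le_less_trans[OF degree_smult_le])
      (use degree_pderiv_prod_linear[of A B M \<mu>] \<open>M \<noteq> {#}\<close> size_roots in \<open>simp add: M_def\<close>)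
  \<comment> \<open>The value of \<open>E \<mu>\<close> at \<open>t = 0\<close> as a polynomial in \<open>\<mu>\<close>, up to the factor \<open>K\<close>.\<close>
  define w where "w = pderiv (\<Prod>\<beta>\<in>#M. [:A \<beta>, 1:])"
  have "degree (\<Prod>\<beta>\<in>#N. [:A \<beta>, 1:]) = size N \<and> (\<Prod>\<beta>\<in>#N. [:A \<beta>, 1:]) \<noteq> 0" for N
    by (induction N) (auto simp: degree_mult_eq simp del: mult_pCons_left)
  then have "w \<noteq> 0"
    using \<open>M \<noteq> {#}\<close> by (simp add: w_def pderiv_eq_0_iff)
  then have "finite (F \<union> {\<mu>. poly w \<mu> = 0})"
    using F poly_roots_finite by auto
  then obtain \<mu> where \<mu>: "\<mu> \<notin> F" "poly w \<mu> \<noteq> 0"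
    using ex_new_if_finite[OF infinite_UNIV_char_0] by blast
  have "poly (E \<mu>) 0 = K * poly w \<mu>" by (simp add: poly_E w_def)
  then have E0: "E \<mu> \<noteq> 0" using \<mu>(2) f(2) by (auto simp: K_def)
  have "\<exists>\<nu>. \<forall>c. coeff (?S \<mu> \<nu>) (m * n - 1) \<noteq> Polynomial.smult c (coeff (?S \<mu> \<nu>) (m * n))"
  proof (rule ccontr)
    assume "\<not> ?thesis"
    then obtain c0 c1 where "coeff (?S \<mu> 0) (m * n - 1) = Polynomial.smult c0 (lead (?a \<mu> 0) b)"
      "coeff (?S \<mu> 1) (m * n - 1) = Polynomial.smult c1 (lead (?a \<mu> 0) b)"
      unfolding lead by metis
    then have E: "E \<mu> = Polynomial.smult (c1 - c0) (lead (?a \<mu> 0) b)"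
      using diff[of \<mu> 1] by (simp add: smult_diff_left)
    then have "c1 \<noteq> c0" using E0 by auto
    then show False using degE[of \<mu>] degree_lead(1)[OF b, of "?a \<mu> 0"] by (simp add: E)
  qed
  then show ?thesis using that \<mu>(1) by blast
qed

end

text \<open>
  The two products run over the roots \<open>\<beta>\<close> and \<open>1 / \<beta>\<close>, and their factors differ by \<open>\<beta>\<^sup>-\<^sup>m\<close>.
\<close>

lemma lead_swap_vars:
  assumes 1: "pencil_resultant m n f" and 2: "pencil_resultant m n (swap_vars f)"
  obtains \<kappa> where "\<kappa> \<noteq> 0"
    "pencil_resultant.lead m n (swap_vars f) (swap_vars a) (swap_vars b) =
       Polynomial.smult \<kappa> (pencil_resultant.lead m n f a b)"
proof -
  interpret pencil_resultant m n f by (rule 1)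
  interpret swapped: pencil_resultant m n "swap_vars f" by (rule 2)
  let ?M = "proots (top_form n f)"
  have fn: "coeff2 f n 0 \<noteq> 0" using swapped.f(2) by simp
  then have c0: "coeff (top_form n f) 0 \<noteq> 0" by (simp add: coeff_top_form)
  then have "top_form n f \<noteq> 0" by auto
  with c0 have nz: "0 \<notin># ?M" by (simp add: poly_0_coeff_0)
  have roots: "proots (top_form n (swap_vars f)) = image_mset inverse ?M"
    unfolding top_form_swap_vars[OF f(2)] by (rule proots_reflect_poly[OF c0])
  let ?A = "poly (top_form m a)" and ?B = "poly (top_form m b)"
  let ?A' = "poly (top_form m (swap_vars a))" and ?B' = "poly (top_form m (swap_vars b))"
  have "(\<Prod>\<beta>\<in>#M. [:?A' (inverse \<beta>), ?B' (inverse \<beta>):]) =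
      Polynomial.smult (\<Prod>\<beta>\<in>#M. inverse \<beta> ^ m) (\<Prod>\<beta>\<in>#M. [:?A \<beta>, ?B \<beta>:])" if "0 \<notin># M" for M
    using that
  proof (induction M)
    case (add \<beta> M)
    have "[:?A' (inverse \<beta>), ?B' (inverse \<beta>):] = Polynomial.smult (inverse \<beta> ^ m) [:?A \<beta>, ?B \<beta>:]"
      using add.prems by (simp add: poly_top_form_swap_vars)
    then show ?case
      using add by (simp only: image_mset_add_mset prod_mset.add_mset set_mset_add_mset_insert insert_iff
          mult_smult_left mult_smult_right smult_smult) (simp add: mult.commute)
  qed simp
  from this[OF nz] have *: "swapped.lead (swap_vars a) (swap_vars b) =
      Polynomial.smult ((-1) ^ (m * n) * coeff2 f n 0 ^ m * (\<Prod>\<beta>\<in>#?M. inverse \<beta> ^ m))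
        (\<Prod>\<beta>\<in>#?M. [:?A \<beta>, ?B \<beta>:])"
    by (simp add: swapped.lead_def roots image_mset.compositionality comp_def)
  have "(\<Prod>\<beta>\<in>#?M. inverse \<beta> ^ m) \<noteq> 0" using nz by auto
  then have "(coeff2 f n 0 / coeff2 f 0 n) ^ m * (\<Prod>\<beta>\<in>#?M. inverse \<beta> ^ m) \<noteq> 0"
    using fn f(2) by simp
  moreover have "swapped.lead (swap_vars a) (swap_vars b) =
      Polynomial.smult ((coeff2 f n 0 / coeff2 f 0 n) ^ m * (\<Prod>\<beta>\<in>#?M. inverse \<beta> ^ m)) (lead a b)"
    using f(2) by (simp add: * lead_def power_divide mult_ac)
  ultimately show ?thesis by (rule that)
qed

section \<open>Polynomials in the parameters\<close>

definition eval_monom :: "(nat \<Rightarrow> complex) \<Rightarrow> (nat \<Rightarrow>\<^sub>0 nat) \<Rightarrow> complex" where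
  "eval_monom a \<mu> = (\<Prod>k\<in>Poly_Mapping.keys \<mu>. a k ^ Poly_Mapping.lookup \<mu> k)"

lemma eval_monom_superset:
  assumes "finite K" "Poly_Mapping.keys \<mu> \<subseteq> K"
  shows "eval_monom a \<mu> = (\<Prod>k\<in>K. a k ^ Poly_Mapping.lookup \<mu> k)"
  unfolding eval_monom_def using assms by (intro prod.mono_neutral_left) (auto simp: in_keys_iff)

lemma eval_monom_add: "eval_monom a (\<mu> + \<nu>) = eval_monom a \<mu> * eval_monom a \<nu>"
proof -
  let ?K = "Poly_Mapping.keys \<mu> \<union> Poly_Mapping.keys \<nu>"
  have "Poly_Mapping.keys (\<mu> + \<nu>) \<subseteq> ?K" by (rule keys_add)
  then show ?thesis
    by (simp add: eval_monom_superset[of ?K] lookup_add power_add prod.distrib)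
qed

lemma eval_dpoly_conv_monom:
  "eval_dpoly a p = (\<Sum>\<mu>\<in>Poly_Mapping.keys p. Poly_Mapping.lookup p \<mu> * eval_monom a \<mu>)"
  by (simp add: eval_dpoly_def eval_monom_def)

lemma eval_dpoly_superset:
  assumes "finite S" "Poly_Mapping.keys p \<subseteq> S"
  shows "eval_dpoly a p = (\<Sum>\<mu>\<in>S. Poly_Mapping.lookup p \<mu> * eval_monom a \<mu>)"
  unfolding eval_dpoly_conv_monom
  using assms by (intro sum.mono_neutral_left) (auto simp: in_keys_iff)

lemma eval_dpoly_single [simp]: "eval_dpoly a (Poly_Mapping.single \<mu> c) = c * eval_monom a \<mu>"
  by (subst eval_dpoly_superset[of "{\<mu>}"]) auto

lemma eval_dpoly_0 [simp]: "eval_dpoly a 0 = 0"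
  by (simp add: eval_dpoly_def)

lemma eval_dpoly_add: "eval_dpoly a (p + q) = eval_dpoly a p + eval_dpoly a q"
proof -
  let ?S = "Poly_Mapping.keys p \<union> Poly_Mapping.keys q"
  have "Poly_Mapping.keys (p + q) \<subseteq> ?S" by (rule keys_add)
  then show ?thesis
    by (simp add: eval_dpoly_superset[of ?S] lookup_add distrib_right sum.distrib)
qed

lemma eval_dpoly_sum: "eval_dpoly a (\<Sum>i\<in>I. p i) = (\<Sum>i\<in>I. eval_dpoly a (p i))"
  by (induction I rule: infinite_finite_induct) (auto simp: eval_dpoly_add)

lemma dpoly_eq_sum_single: "p = (\<Sum>\<mu>\<in>Poly_Mapping.keys p. Poly_Mapping.single \<mu> (Poly_Mapping.lookup p \<mu>))"
  by (rule poly_mapping_eqI) (auto simp: lookup_sum lookup_single when_def in_keys_iff)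

lemma eval_dpoly_mult: "eval_dpoly a (p * q) = eval_dpoly a p * eval_dpoly a q"
proof -
  have "p * q = (\<Sum>\<mu>\<in>Poly_Mapping.keys p. \<Sum>\<nu>\<in>Poly_Mapping.keys q.
      Poly_Mapping.single (\<mu> + \<nu>) (Poly_Mapping.lookup p \<mu> * Poly_Mapping.lookup q \<nu>))"
    by (subst dpoly_eq_sum_single[of p], subst dpoly_eq_sum_single[of q])
      (simp add: sum_product mult_single)
  then show ?thesis
    by (simp add: eval_dpoly_sum eval_monom_add eval_dpoly_conv_monom[of a p] eval_dpoly_conv_monom[of a q]
        sum_product mult_ac)
qed

lemma eval_dpoly_Const [simp]: "eval_dpoly a (Const c) = c"
  by (simp add: Const_def eval_monom_def)

lemma eval_dpoly_delta [simp]: "eval_dpoly a (delta k) = a k"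
  by (simp add: delta_def eval_monom_def)

lemma eval_dpoly_hom: "comm_ring_hom (eval_dpoly a)"
proof
  show "eval_dpoly a 1 = 1" using eval_dpoly_Const[of a 1] by (simp add: Const_def)
qed (auto simp: eval_dpoly_add eval_dpoly_mult)

text \<open>
  Zariski open sets are defined by polynomials in the variables \<open>1, \<dots>, m\<close>. On \<open>\<complex>\<^sup>m\<close> the other arguments have the
  fixed value \<open>undefined\<close>, which can be substituted.
\<close>

lemma ex_dpoly_in_params:
  "\<exists>p'. (\<forall>\<mu>\<in>Poly_Mapping.keys p'. Poly_Mapping.keys \<mu> \<subseteq> {1..m}) \<and>
     (\<forall>a\<in>affine_space m. eval_dpoly a p' = eval_dpoly a p)"
proof -
  define in_part where "in_part \<mu> = (\<Sum>k\<in>Poly_Mapping.keys \<mu> \<inter> {1..m}. Poly_Mapping.single k (Poly_Mapping.lookup \<mu> k))"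
    for \<mu> :: "nat \<Rightarrow>\<^sub>0 nat"
  \<comment> \<open>The common value of all functions in \<open>\<complex>\<^sup>m\<close> outside of \<open>{1..m}\<close>.\<close>
  define u :: complex where "u = undefined"
  define out where "out \<mu> = (\<Prod>k\<in>Poly_Mapping.keys \<mu> - {1..m}. u ^ Poly_Mapping.lookup \<mu> k)"
    for \<mu> :: "nat \<Rightarrow>\<^sub>0 nat"
  define p' where "p' = (\<Sum>\<mu>\<in>Poly_Mapping.keys p. Poly_Mapping.single (in_part \<mu>) (Poly_Mapping.lookup p \<mu> * out \<mu>))"
  have lookup_in: "Poly_Mapping.lookup (in_part \<mu>) k = (if k \<in> {1..m} then Poly_Mapping.lookup \<mu> k else 0)" for \<mu> k
    by (auto simp: in_part_def lookup_sum lookup_single when_def in_keys_iff)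
  have keys_in: "Poly_Mapping.keys (in_part \<mu>) = Poly_Mapping.keys \<mu> \<inter> {1..m}" for \<mu>
    by (auto simp: in_keys_iff lookup_in split: if_splits)
  show ?thesis
  proof (intro exI[of _ p'] conjI ballI)
    fix \<mu> assume "\<mu> \<in> Poly_Mapping.keys p'"
    then obtain \<nu> where "\<mu> \<in> Poly_Mapping.keys (Poly_Mapping.single (in_part \<nu>) (Poly_Mapping.lookup p \<nu> * out \<nu>))"
      unfolding p'_def using keys_sum by fastforce
    then show "Poly_Mapping.keys \<mu> \<subseteq> {1..m}"
      by (auto simp: keys_in split: if_splits)
  next
    fix a assume a: "a \<in> affine_space m"
    have "out \<mu> * eval_monom a (in_part \<mu>) = eval_monom a \<mu>" for \<mu>
    proof -
      have "out \<mu> = (\<Prod>k\<in>Poly_Mapping.keys \<mu> - {1..m}. a k ^ Poly_Mapping.lookup \<mu> k)"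
        unfolding out_def u_def using a by (intro prod.cong) (auto simp: affine_space_def PiE_def extensional_def)
      moreover have "eval_monom a (in_part \<mu>) = (\<Prod>k\<in>Poly_Mapping.keys \<mu> \<inter> {1..m}. a k ^ Poly_Mapping.lookup \<mu> k)"
        unfolding eval_monom_def keys_in by (intro prod.cong) (auto simp: lookup_in)
      ultimately show ?thesis
        unfolding eval_monom_def
        by (subst prod.Int_Diff[of "Poly_Mapping.keys \<mu>" _ "{1..m}"]) (auto simp: mult.commute)
    qed
    then show "eval_dpoly a p' = eval_dpoly a p"
      by (simp add: p'_def eval_dpoly_sum eval_dpoly_conv_monom[of a p] mult.assoc)
  qed
qed

lemma eval_dpoly_1: "eval_dpoly \<Delta> 1 = 1"
  using eval_dpoly_Const[of \<Delta> 1] by (simp add: Const_def)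

lemma eval_dpoly_diff: "eval_dpoly \<Delta> (p - q) = eval_dpoly \<Delta> p - eval_dpoly \<Delta> q"
  using eval_dpoly_add[of \<Delta> "p - q" q] by simp

section \<open>The quotient and its root\<close>

lemma quotient_by_monic:
  fixes S A :: "'a::idom poly"
  assumes S: "degree S \<le> e + 2" and A: "degree A = e + 1" "lead_coeff A = 1"
  shows "fst (pseudo_divmod S A) = [:coeff S (e + 1) - coeff S (e + 2) * coeff A e, coeff S (e + 2):]"
proof -
  obtain q r where qr: "pseudo_divmod S A = (q, r)" by force
  have "A \<noteq> 0" using A by auto
  from pseudo_divmod[OF this qr] have *: "S = A * q + r" "r = 0 \<or> degree r < degree A"
    using A(2) by auto
  then have r: "degree r \<le> e" using A by auto
  have "degree q \<le> 1"
  proof (cases "q = 0")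
    case False
    have "A * q = S - r" using *(1) by simp
    then have "degree (A * q) \<le> e + 2"
      using S r by (auto intro: degree_diff_le)
    then show ?thesis using False \<open>A \<noteq> 0\<close> A(1) by (simp add: degree_mult_eq)
  qed simp
  then obtain q0 q1 where q: "q = [:q0, q1:]"
    by (metis One_nat_def degree_eq_zeroE degree_pCons_eq_if le_Suc_eq le_zero_eq pCons_cases pCons_0_0 Suc_le_mono nat.distinct(1))
  have A': "coeff A (e + 1) = 1" "coeff A (e + 2) = 0"
    using A by (auto simp: coeff_eq_0)
  have "coeff S (e + 2) = q1" "coeff S (e + 1) = q0 + q1 * coeff A e"
    using r A' by (simp_all add: *(1) q coeff_eq_0)
  then show ?thesis by (simp add: qr q)
qed

lemma linear_root_eq:
  assumes "b1 \<noteq> 0"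
  shows "linear_root [:b0, b1:] = Fract (- b0) b1"
  unfolding linear_root_def
proof (rule the_equality)
  have m: "map_poly to_fract [:b0, b1:] = [:to_fract b0, to_fract b1:]"
    using assms by (simp add: map_poly_pCons)
  show "poly (map_poly to_fract [:b0, b1:]) (Fract (- b0) b1) = 0"
    using assms unfolding m by (simp add: to_fract_def Zero_fract_def eq_fract)
  fix \<xi> assume "poly (map_poly to_fract [:b0, b1:]) \<xi> = 0"
  then have "to_fract b1 * \<xi> = - to_fract b0" unfolding m by (simp add: algebra_simps eq_neg_iff_add_eq_0)
  moreover have "to_fract b1 * Fract (- b0) b1 = - to_fract b0"
    using assms by (simp add: to_fract_def eq_fract)
  moreover have "to_fract b1 \<noteq> 0" using assms by simp
  ultimately show "\<xi> = Fract (- b0) b1" by (metis mult_left_cancel)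
qed

lemma monic_A_poly:
  shows "lead_coeff (A_poly pr d s Q r P) = 1"
    and "degree (A_poly pr d s Q r P) = (\<Sum>i=1..s. r i * (r i - 1)) + (d - 3)"
proof -
  show "lead_coeff (A_poly pr d s Q r P) = 1"
    unfolding A_poly_def lead_coeff_mult lead_coeff_prod lead_coeff_power by simp
  have nz: "(\<Prod>i=1..s. [:- pr (Q i), 1:] ^ (r i * (r i - 1))) \<noteq> 0" "(\<Prod>j=1..d - 3. [:- pr (P j), 1:]) \<noteq> 0"
    by (simp_all add: prod_zero_iff)
  have "degree (\<Prod>i=1..s. [:- pr (Q i), 1:] ^ (r i * (r i - 1))) = (\<Sum>i=1..s. r i * (r i - 1))"
    by (subst degree_prod_sum_eq) (simp, simp only: degree_linear_power)
  moreover have "degree (\<Prod>j=1..d - 3. [:- pr (P j), 1:]) = d - 3"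
    by (subst degree_prod_sum_eq) simp_all
  ultimately show "degree (A_poly pr d s Q r P) = (\<Sum>i=1..s. r i * (r i - 1)) + (d - 3)"
    unfolding A_poly_def degree_mult_eq[OF nz] by (simp only:)
qed

text \<open>
  This is where \<open>\<epsilon>\<close>-rationality is used: \<open>(d - 1) (d - 2) + (d - 3) = d (d - 2) - 1\<close>, so the quotients by \<open>A\<^sub>1\<close> and \<open>A\<^sub>2\<close>
  are linear.
\<close>

lemma degree_A_poly:
  assumes "eps_rational d s r" "d > 2"
  shows "degree (A_poly pr d s Q r P) + 1 = (d - 2) * d"
proof -
  define T where "T = (\<Sum>i=1..s. r i * (r i - 1))"
  have "int (r i * (r i - 1)) = int (r i) * (int (r i) - 1)" for i
    by (cases "r i") (simp_all add: algebra_simps)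
  then have "int T = (\<Sum>i=1..s. int (r i) * (int (r i) - 1))"
    by (simp only: T_def of_nat_sum)
  then have T: "int T = (int d - 1) * (int d - 2)"
    using assms(1) by (simp add: eps_rational_def)
  obtain k where k: "d = k + 3" using assms(2) by (intro that[of "d - 3"]) simp
  have "int T = int ((k + 2) * (k + 1))"
    unfolding T k by (simp add: algebra_simps)
  then have "T = (k + 2) * (k + 1)" by (simp only: of_nat_eq_iff)
  then show ?thesis unfolding monic_A_poly(2) T_def[symmetric] k by (simp add: algebra_simps)
qed

section \<open>Curves parametrized by quotients with a common denominator\<close>

text \<open>
  \<open>q\<^sup>n h (N\<^sub>1 / q, N\<^sub>2 / q)\<close>, a polynomial if \<open>h\<close> has total degree at most \<open>n\<close>.
\<close>

definition clear_denoms :: "complex poly \<Rightarrow> complex poly \<Rightarrow> complex poly \<Rightarrow> nat \<Rightarrow> complex poly poly \<Rightarrow> complex poly" where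
  "clear_denoms N1 N2 q n h =
     (\<Sum>j\<le>n. \<Sum>i\<le>n - j. Polynomial.smult (coeff2 h i j) (N1 ^ i * N2 ^ j * q ^ (n - i - j)))"

lemma poly_clear_denoms:
  assumes "tdeg_le n h" "poly q t \<noteq> 0"
  shows "poly (clear_denoms N1 N2 q n h) t =
    poly q t ^ n * eval2 h (poly N1 t / poly q t, poly N2 t / poly q t)"
proof -
  have "poly q t ^ n = poly q t ^ i * poly q t ^ j * poly q t ^ (n - i - j)" if "j \<le> n" "i \<le> n - j" for i j
    using that by (simp flip: power_add)
  then have "coeff2 h i j * (poly N1 t ^ i * poly N2 t ^ j * poly q t ^ (n - i - j)) =
      poly q t ^ n * (coeff2 h i j * ((poly N1 t / poly q t) ^ i * (poly N2 t / poly q t) ^ j))"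
    if "j \<le> n" "i \<le> n - j" for i j
    using assms(2) that by (simp add: field_simps power_divide)
  then show ?thesis
    unfolding clear_denoms_def eval2_sum[OF assms(1)] poly_sum sum_distrib_left
    by (intro sum.cong refl) simp
qed

text \<open>
  More than \<open>D\<close> vectors in a space of dimension \<open>D\<close>. The induction eliminates the coefficient of degree
  \<open>D\<close> with one of the polynomials.
\<close>

lemma linear_relation:
  fixes p :: "'i \<Rightarrow> 'a::field poly"
  assumes "finite I" "D < card I" "\<And>i k. i \<in> I \<Longrightarrow> D \<le> k \<Longrightarrow> coeff (p i) k = 0"
  shows "\<exists>c. (\<exists>i\<in>I. c i \<noteq> 0) \<and> (\<Sum>i\<in>I. Polynomial.smult (c i) (p i)) = 0"
  using assms
proof (induction D arbitrary: I p)
  case 0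
  then have "p i = 0" if "i \<in> I" for i using that by (simp add: poly_eq_iff)
  moreover obtain i where "i \<in> I" using 0 by fastforce
  ultimately show ?case by (intro exI[of _ "\<lambda>_. 1"]) auto
next
  case (Suc D)
  show ?case
  proof (cases "\<forall>i\<in>I. coeff (p i) D = 0")
    case True
    show ?thesis
    proof (rule Suc.IH)
      fix i k assume "i \<in> I" "D \<le> k"
      then show "coeff (p i) k = 0" using True Suc.prems(3)[of i k] by (cases "k = D") auto
    qed (use Suc.prems in auto)
  next
    case False
    then obtain s where s: "s \<in> I" "coeff (p s) D \<noteq> 0" by blast
    \<comment> \<open>Multiples of \<open>p s\<close> are subtracted to remove the terms of degree \<open>D\<close>.\<close>
    define e where "e i = coeff (p i) D / coeff (p s) D" for i
    define p' where "p' i = p i - Polynomial.smult (e i) (p s)" for i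
    have "\<exists>c. (\<exists>i\<in>I - {s}. c i \<noteq> 0) \<and> (\<Sum>i\<in>I - {s}. Polynomial.smult (c i) (p' i)) = 0"
    proof (rule Suc.IH)
      fix i k assume "i \<in> I - {s}" "D \<le> k"
      then show "coeff (p' i) k = 0"
        using s Suc.prems(3)[of i k] Suc.prems(3)[of s k] by (cases "k = D") (auto simp: p'_def e_def)
    qed (use Suc.prems s in auto)
    then obtain c where c: "\<exists>i\<in>I - {s}. c i \<noteq> 0" "(\<Sum>i\<in>I - {s}. Polynomial.smult (c i) (p' i)) = 0"
      by blast
    define c' where "c' = c(s := - (\<Sum>i\<in>I - {s}. c i * e i))"
    have "(\<Sum>i\<in>I. Polynomial.smult (c' i) (p i)) =
        Polynomial.smult (c' s) (p s) + (\<Sum>i\<in>I - {s}. Polynomial.smult (c' i) (p i))"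
      by (rule sum.remove) (use Suc.prems s in auto)
    also have "\<dots> = (\<Sum>i\<in>I - {s}. Polynomial.smult (c i) (p i)) -
        (\<Sum>i\<in>I - {s}. Polynomial.smult (c i * e i) (p s))"
      by (simp add: c'_def smult_sum)
    also have "\<dots> = 0"
      using c(2) by (simp add: p'_def smult_diff_right sum_subtractf)
    finally show ?thesis using c(1) by (intro exI[of _ c']) (auto simp: c'_def)
  qed
qed

text \<open>
  The leading monomial for the order by total degree, ties being broken by the degree in \<open>y\<close>.
\<close>

definition leading_exponent :: "'a::zero poly poly \<Rightarrow> nat \<Rightarrow> nat \<Rightarrow> bool" where
  "leading_exponent p a b \<longleftrightarrow> coeff2 p a b \<noteq> 0 \<and>
     (\<forall>i j. coeff2 p i j \<noteq> 0 \<longrightarrow> i + j < a + b \<or> i + j = a + b \<and> j \<le> b)"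

lemma ex_leading_exponent:
  assumes "p \<noteq> 0"
  obtains a b where "leading_exponent p a b"
proof -
  define S where "S = {(i, j). coeff2 p i j \<noteq> 0}"
  have S: "finite S" "S \<noteq> {}"
    using finite_support2[of p] assms by (auto simp: S_def poly2_eq_iff)
  define k where "k = Max ((\<lambda>(i, j). i + j) ` S)"
  define J where "J = {j. (k - j, j) \<in> S \<and> j \<le> k}"
  have k: "i + j \<le> k" if "(i, j) \<in> S" for i j
    unfolding k_def using S that by (intro Max_ge) auto
  obtain i j where "(i, j) \<in> S" "i + j = k"
    using Max_in[of "(\<lambda>(i, j). i + j) ` S"] S unfolding k_def by fastforce
  then have "j \<in> J" by (auto simp: J_def)
  have "finite J" by (rule finite_subset[of _ "{..k}"]) (auto simp: J_def)
  define b where "b = Max J"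
  have "b \<in> J" using \<open>finite J\<close> \<open>j \<in> J\<close> unfolding b_def by (intro Max_in) auto
  moreover have "j \<le> b" if "(i, j) \<in> S" "i + j = k" for i j
    unfolding b_def using that \<open>finite J\<close> by (intro Max_ge) (auto simp: J_def)
  ultimately have "leading_exponent p (k - b) b"
    using k unfolding leading_exponent_def J_def S_def
    by (simp add: order.order_iff_strict) (metis le_neq_implies_less order.order_iff_strict)
  then show ?thesis by (rule that)
qed

text \<open>
  The exponents of two monomials add up to the sum of the leading exponents only if both are leading.
\<close>

lemma leading_exponent_mult:
  fixes p q :: "'a::idom poly poly"
  assumes p: "leading_exponent p a b" and q: "leading_exponent q a' b'"
  shows "coeff2 (p * q) (a + a') (b + b') \<noteq> 0"
proof -
  let ?A = "a + a'" and ?B = "b + b'"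
  have "coeff2 (p * q) ?A ?B =
      (\<Sum>j\<le>?B. \<Sum>i\<le>?A. coeff2 p i j * coeff2 q (?A - i) (?B - j))"
    by (simp add: coeff2_def coeff_mult coeff_sum)
  also have "\<dots> = (\<Sum>j\<le>?B. \<Sum>i\<le>?A. if j = b then (if i = a then coeff2 p a b * coeff2 q a' b' else 0) else 0)"
  proof (intro sum.cong refl)
    fix i j assume ij: "j \<in> {..?B}" "i \<in> {..?A}"
    show "coeff2 p i j * coeff2 q (?A - i) (?B - j) =
        (if j = b then (if i = a then coeff2 p a b * coeff2 q a' b' else 0) else 0)"
    proof (cases "coeff2 p i j = 0 \<or> coeff2 q (?A - i) (?B - j) = 0")
      case False
      then have "i + j < a + b \<or> i + j = a + b \<and> j \<le> b"
        "?A - i + (?B - j) < a' + b' \<or> ?A - i + (?B - j) = a' + b' \<and> ?B - j \<le> b'"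
        using p q unfolding leading_exponent_def by blast+
      with ij have "i = a \<and> j = b" by auto
      then show ?thesis by simp
    next
      case True
      then show ?thesis using p q by (auto simp: leading_exponent_def)
    qed
  qed
  also have "\<dots> = (\<Sum>j\<le>?B. if j = b then (\<Sum>i\<le>?A. if i = a then coeff2 p a b * coeff2 q a' b' else 0) else 0)"
    by (intro sum.cong) auto
  also have "\<dots> = coeff2 p a b * coeff2 q a' b'" by simp
  finally show ?thesis using p q by (simp add: leading_exponent_def)
qed

lemma total_degree_leading_exponent:
  assumes "leading_exponent p a b"
  shows "total_degree p = a + b"
proof (rule antisym)
  show "total_degree p \<le> a + b"
    using assms unfolding total_degree_le_iff 
    by (force simp: tdeg_le_def leading_exponent_def intro: less_imp_le)
  have "tdeg_le (total_degree p) p" by (simp flip: total_degree_le_iff)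
  then show "a + b \<le> total_degree p" using assms by (simp add: tdeg_le_def leading_exponent_def)
qed

lemma fract_value_Fract: "poly q t \<noteq> 0 \<Longrightarrow> fract_value (Fract n q) t (poly n t / poly q t)"
  unfolding fract_value_def by blast

locale rational_pair =
  fixes N1 N2 L :: "complex poly" and d :: nat
  assumes degree_le: "degree N1 \<le> d" "degree N2 \<le> d" "degree L \<le> d"
    and denom_nonzero: "L \<noteq> 0"
    and nonconstant: "\<And>c. N1 \<noteq> Polynomial.smult c L"
begin

definition vanishes :: "complex poly poly \<Rightarrow> bool" where
  "vanishes h \<longleftrightarrow> (\<forall>t. poly L t \<noteq> 0 \<longrightarrow> eval2 h (poly N1 t / poly L t, poly N2 t / poly L t) = 0)"

lemma vanishes_iff: "tdeg_le n h \<Longrightarrow> vanishes h \<longleftrightarrow> clear_denoms N1 N2 L n h = 0"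
proof
  assume n: "tdeg_le n h"
  show "vanishes h" if "clear_denoms N1 N2 L n h = 0"
    using poly_clear_denoms[OF n, of L _ N1 N2] that by (simp add: vanishes_def)
  show "clear_denoms N1 N2 L n h = 0" if "vanishes h"
    using poly_clear_denoms[OF n, of L _ N1 N2] that
    by (intro cofinite_poly_eq[OF denom_nonzero]) (simp add: vanishes_def)
qed

lemma vanishes_mult_iff: "vanishes (g * h) \<longleftrightarrow> vanishes g \<or> vanishes h"
proof
  assume gh: "vanishes (g * h)"
  define n m where "n = total_degree g" and "m = total_degree h"
  have n: "tdeg_le n g" and m: "tdeg_le m h" by (simp_all add: n_def m_def flip: total_degree_le_iff)
  have "clear_denoms N1 N2 L n g * clear_denoms N1 N2 L m h = 0"
  proof (rule cofinite_poly_eq[OF denom_nonzero])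
    fix t assume "poly L t \<noteq> 0"
    then show "poly (clear_denoms N1 N2 L n g * clear_denoms N1 N2 L m h) t = poly 0 t"
      using gh by (simp add: vanishes_def poly_clear_denoms[OF n] poly_clear_denoms[OF m] eval2_mult)
  qed
  then show "vanishes g \<or> vanishes h" by (simp add: vanishes_iff[OF n] vanishes_iff[OF m])
qed (auto simp: vanishes_def eval2_mult)

lemma vanishes_add: "vanishes g \<Longrightarrow> vanishes h \<Longrightarrow> vanishes (g + h)"
  by (simp add: vanishes_def eval2_add)

text \<open>
  A relation \<open>u (N\<^sub>1 / L) = 0\<close> would give \<open>N\<^sub>1 / L\<close> finitely many values, hence make it one of the roots of \<open>u\<close>.
\<close>

lemma not_vanishes_const:
  assumes "vanishes [:u:]"
  shows "u = 0"
proof (rule ccontr)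
  assume u: "u \<noteq> 0"
  let ?R = "{c. poly u c = 0}"
  have "finite ?R" using u by (rule poly_roots_finite)
  have "(\<Prod>c\<in>?R. N1 - Polynomial.smult c L) = 0"
  proof (rule cofinite_poly_eq[OF denom_nonzero])
    fix t assume t: "poly L t \<noteq> 0"
    let ?c = "poly N1 t / poly L t"
    have "?c \<in> ?R" using assms t by (simp add: vanishes_def eval2_const)
    moreover have "poly (N1 - Polynomial.smult ?c L) t = 0" using t by simp
    ultimately have "(\<Prod>c\<in>?R. poly (N1 - Polynomial.smult c L) t) = 0"
      using \<open>finite ?R\<close> by (intro prod_zero) auto
    then show "poly (\<Prod>c\<in>?R. N1 - Polynomial.smult c L) t = poly 0 t"
      by (simp only: poly_prod poly_0)
  qed
  then obtain c where "N1 - Polynomial.smult c L = 0"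
    using \<open>finite ?R\<close> by (auto simp: prod_zero_iff)
  then show False using nonconstant[of c] by simp
qed

text \<open>
  The monomials with exponents in \<open>I\<close> yield more than \<open>n d + 1\<close> polynomials of degree at most \<open>n d\<close> in \<open>t\<close>.
\<close>

lemma ex_vanishes_with_support:
  assumes I: "finite I" "\<And>i j. (i, j) \<in> I \<Longrightarrow> i + j \<le> n" "n * d + 1 < card I"
  obtains h where "vanishes h" "h \<noteq> 0" "\<And>i j. coeff2 h i j \<noteq> 0 \<Longrightarrow> (i, j) \<in> I"
proof -
  let ?p = "\<lambda>(i, j). N1 ^ i * N2 ^ j * L ^ (n - i - j)"
  have "\<exists>c. (\<exists>x\<in>I. c x \<noteq> 0) \<and> (\<Sum>x\<in>I. Polynomial.smult (c x) (?p x)) = 0"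
  proof (rule linear_relation[OF I(1,3)])
    fix x k assume x: "x \<in> I" and k: "n * d + 1 \<le> k"
    obtain i j where ij: "x = (i, j)" "i + j \<le> n" using I(2) x by (cases x) auto
    have pow: "degree (q ^ e) \<le> d * e" if "degree q \<le> d" for q :: "complex poly" and e
      using degree_power_le[of q e] mult_le_mono1[OF that, of e] by linarith
    have "degree (N1 ^ i * N2 ^ j * L ^ (n - i - j)) \<le> d * i + d * j + d * (n - i - j)"
      by (intro degree_mult_le_add pow degree_le)
    also have "\<dots> = d * (i + j + (n - i - j))" by (simp only: add_mult_distrib2)
    also have "\<dots> = n * d" using ij by simp
    finally show "coeff (?p x) k = 0" using k ij by (intro coeff_eq_0) auto
  qed
  then obtain c where c: "\<exists>x\<in>I. c x \<noteq> 0" "(\<Sum>x\<in>I. Polynomial.smult (c x) (?p x)) = 0" by blast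
  define h where "h = (\<Sum>x\<in>I. monom2 (c x) (fst x) (snd x))"
  have coeff: "coeff2 h i j = (if (i, j) \<in> I then c (i, j) else 0)" for i j
  proof -
    have "coeff2 h i j = (\<Sum>x\<in>I. if x = (i, j) then c x else 0)"
      unfolding h_def coeff2_def coeff_sum monom2_def
      by (intro sum.cong) (auto simp: prod_eq_iff)
    then show ?thesis using I(1) by simp
  qed
  have n: "tdeg_le n h" using I(2) by (auto simp: tdeg_le_def coeff split: if_splits)
  have "clear_denoms N1 N2 L n h =
      (\<Sum>x\<in>(SIGMA j:{..n}. {..n - j}). Polynomial.smult (coeff2 h (snd x) (fst x)) (?p (snd x, fst x)))"
    unfolding clear_denoms_def by (subst sum.Sigma) (auto simp: case_prod_beta)
  also have "\<dots> = (\<Sum>x\<in>(\<lambda>(i, j). (j, i)) ` I. Polynomial.smult (coeff2 h (snd x) (fst x)) (?p (snd x, fst x)))"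
    by (intro sum.mono_neutral_right) (use I(2) in \<open>fastforce simp: coeff\<close>)+
  also have "\<dots> = (\<Sum>x\<in>I. Polynomial.smult (c x) (?p x))"
    by (subst sum.reindex) (auto simp: inj_on_def coeff intro!: sum.cong)
  finally have "vanishes h" using c(2) by (simp add: vanishes_iff[OF n])
  moreover have "h \<noteq> 0"
  proof
    assume "h = 0"
    then have "c x = 0" if "x \<in> I" for x using coeff[of "fst x" "snd x"] that by simp
    then show False using c(1) by blast
  qed
  ultimately show ?thesis using coeff by (intro that) (auto split: if_splits)
qed

lemma common_degree_pos: "d > 0"
proof (rule ccontr)
  assume "\<not> d > 0"
  then obtain a b where "N1 = [:a:]" "L = [:b:]"
    using degree_le by (auto elim!: degree_eq_zeroE)
  then show False using nonconstant[of "a / b"] denom_nonzero by simp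
qed

text \<open>
  Take a relation of least degree in \<open>y\<close> and an irreducible factor \<open>g\<close> of it that is again a relation.
  The remainder of the pseudo-division of a relation \<open>h\<close> by \<open>g\<close> is a relation of smaller degree, hence \<open>0\<close>, so
  \<open>g\<close> divides \<open>u h\<close> with \<open>u\<close> in \<open>\<complex>[x]\<close>; as \<open>g\<close> is prime and does not divide \<open>u\<close>, it divides \<open>h\<close>.
\<close>

lemma ex_generator:
  obtains g where "irreducible g" "vanishes g" "\<And>h. vanishes h \<Longrightarrow> g dvd h"
proof -
  let ?K = "{h. vanishes h \<and> h \<noteq> 0}"
  \<comment> \<open>The \<open>(2 d + 1)\<^sup>2\<close> monomials with both exponents at most \<open>2 d\<close> have total degree at most \<open>4 d\<close>.\<close>
  have "(2 * (2 * d)) * d + 1 < card ({..2 * d} \<times> {..2 * d})"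
    using common_degree_pos by simp
  then obtain h0 where "vanishes h0" "h0 \<noteq> 0"
    by (rule ex_vanishes_with_support[rotated 2]) auto
  then obtain g1 where g1: "vanishes g1" "g1 \<noteq> 0"
    and min: "\<And>h. vanishes h \<Longrightarrow> h \<noteq> 0 \<Longrightarrow> degree g1 \<le> degree h"
    using ex_has_least_nat[of "\<lambda>h. h \<in> ?K" h0 degree] by auto
  have "g1 dvd prod_mset (prime_factorization g1)"
    using g1(2) by (metis dvd_refl normalize_dvd_iff dvd_normalize_iff prod_mset_prime_factorization_weak)
  then have "vanishes (prod_mset (prime_factorization g1))"
    using g1(1) by (auto simp: vanishes_mult_iff)
  moreover have "\<exists>p\<in>#M. vanishes p" if "vanishes (prod_mset M)" for M
    using that
  proof (induction M)
    case empty
    then have "vanishes [:1:]" by (simp only: prod_mset_empty one_pCons)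
    then show ?case using not_vanishes_const[of 1] by simp
  qed (auto simp: vanishes_mult_iff)
  ultimately obtain g where g: "g \<in># prime_factorization g1" "vanishes g" by blast
  then have prime: "prime_elem g" by (auto dest: in_prime_factors_imp_prime)
  have "g dvd g1" using g(1) by (rule in_prime_factors_imp_dvd)
  then have deg: "degree g \<le> degree g1" using g1(2) by (rule dvd_imp_degree_le)
  have "g \<noteq> 0" using prime by auto
  show ?thesis
  proof
    show "irreducible g" using prime by (rule prime_elem_imp_irreducible)
    show "vanishes g" by fact
    fix h assume h: "vanishes h"
    obtain q r where qr: "pseudo_divmod h g = (q, r)" by force
    define u where "u = lead_coeff g ^ (Suc (degree h) - degree g)"
    have *: "Polynomial.smult u h = g * q + r" "r = 0 \<or> degree r < degree g"
      using pseudo_divmod[OF \<open>g \<noteq> 0\<close> qr] by (auto simp: u_def)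
    have "r = [:u:] * h + [:- 1:] * (g * q)" using *(1) by simp
    moreover have "vanishes \<dots>"
      using h g(2) by (intro vanishes_add) (simp_all only: vanishes_mult_iff simp_thms)
    ultimately have "vanishes r" by simp
    then have "r = 0" using min[of r] *(2) deg by fastforce
    then have "g dvd [:u:] * h" using *(1) by simp
    then have "g dvd [:u:] \<or> g dvd h" using prime by (simp only: prime_elem_dvd_mult_iff)
    moreover have "\<not> g dvd [:u:]"
    proof
      assume "g dvd [:u:]"
      moreover have "u \<noteq> 0" using \<open>g \<noteq> 0\<close> by (simp add: u_def)
      ultimately have "degree g \<le> 0" using dvd_imp_degree_le[of g "[:u:]"] by simp
      then obtain v where "g = [:v:]" by (auto elim: degree_eq_zeroE)
      then show False using not_vanishes_const g(2) \<open>g \<noteq> 0\<close> by auto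
    qed
    ultimately show "g dvd h" by blast
  qed
qed

text \<open>
  The set \<open>?I1 \<union> ?I2\<close> consists of monomials of degree at most \<open>n\<close> that are not divisible by the leading monomial
  of \<open>g\<close>. If the degree \<open>k\<close> of \<open>g\<close> exceeded \<open>d\<close>, then for \<open>n = k\<^sup>2 + 1\<close> there would be enough of them to support a
  relation; but the leading monomial of any multiple of \<open>g\<close> is divisible by that of \<open>g\<close>.
\<close>

lemma total_degree_generator_le:
  assumes g: "g \<noteq> 0" "\<And>h. vanishes h \<Longrightarrow> g dvd h"
  shows "total_degree g \<le> d"
proof (rule ccontr)
  assume "\<not> total_degree g \<le> d"
  moreover obtain a b where ab: "leading_exponent g a b" using ex_leading_exponent[OF g(1)] .
  define k where "k = a + b"
  ultimately have k: "d + 1 \<le> k" by (simp add: k_def total_degree_leading_exponent[OF ab])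
  \<comment> \<open>Any \<open>n \<ge> k\<^sup>2\<close> satisfies \<open>k (n - k + 1) > n d + 1\<close> if \<open>k > d\<close>.\<close>
  define n where "n = k * k + 1"
  let ?I1 = "{..<a} \<times> {..n - k}" and ?I2 = "{a..n - b} \<times> {..<b}"
  have kn: "k \<le> n" by (cases k) (auto simp: n_def)
  have "card (?I1 \<union> ?I2) = a * (n - k + 1) + (Suc (n - b) - a) * b"
    by (subst card_Un_disjoint) auto
  also have "Suc (n - b) - a = n - k + 1" using kn by (simp add: k_def)
  finally have card: "card (?I1 \<union> ?I2) = k * (n - k + 1)" 
    by (simp only: k_def add_mult_distrib mult.commute)
  have "int n * int d + 1 < int k * (int n - int k + 1)"
  proof -
    have "(int k - int d - 1) * int n \<ge> 0" using k by simp
    moreover have "int n = int k * int k + 1" by (simp add: n_def)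
    ultimately show ?thesis using k by (simp add: algebra_simps)
  qed
  then have "int (n * d + 1) < int (k * (n - k + 1))"
    using kn by (simp add: of_nat_diff ring_distribs)
  then have "n * d + 1 < card (?I1 \<union> ?I2)" unfolding card by linarith
  moreover have "i + j \<le> n" if "(i, j) \<in> ?I1 \<union> ?I2" for i j
    using that kn by (auto simp: k_def)
  ultimately obtain h where h: "vanishes h" "h \<noteq> 0" "\<And>i j. coeff2 h i j \<noteq> 0 \<Longrightarrow> (i, j) \<in> ?I1 \<union> ?I2"
    using ex_vanishes_with_support[of "?I1 \<union> ?I2" n] by blast
  obtain u where u: "h = g * u" using g(2)[OF h(1)] by (elim dvdE)
  obtain a' b' where "leading_exponent u a' b'"
    using ex_leading_exponent[of u] h(2) u by auto
  from leading_exponent_mult[OF ab this] h(3)[of "a + a'" "b + b'"] show False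
    by (auto simp: u)
qed

lemma not_is_constant: "\<not> is_constant (Fract N1 L)"
proof
  assume "is_constant (Fract N1 L)"
  then obtain c where "Fract N1 L = Fract [:c:] 1" by (auto simp: is_constant_def to_fract_def)
  then have "N1 = Polynomial.smult c L" using denom_nonzero by (simp add: eq_fract)
  then show False using nonconstant by blast
qed

text \<open>
  A point of the image may come from a \<open>t\<close> at which \<open>L\<close> vanishes and other representatives of the two fractions
  are defined; clearing the denominators of these shows that relations vanish there as well.
\<close>

lemma eval2_param_image:
  assumes "vanishes g" "P \<in> param_image (Fract N1 L, Fract N2 L)"
  shows "eval2 g P = 0"
proof -
  obtain t n1 q1 n2 q2 where P: "P = (poly n1 t / poly q1 t, poly n2 t / poly q2 t)"
    and nz: "poly q1 t \<noteq> 0" "poly q2 t \<noteq> 0"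
    and eq: "Fract N1 L = Fract n1 q1" "Fract N2 L = Fract n2 q2"
    using assms(2) by (auto simp: param_image_def fract_value_def)
  then have "q1 \<noteq> 0" "q2 \<noteq> 0" by auto
  then have eq': "N1 * q1 = n1 * L" "N2 * q2 = n2 * L"
    using eq denom_nonzero by (simp_all add: eq_fract)
  have g: "tdeg_le (total_degree g) g" by (simp flip: total_degree_le_iff)
  have "clear_denoms (n1 * q2) (n2 * q1) (q1 * q2) (total_degree g) g = 0"
  proof (rule cofinite_poly_eq)
    show "L * (q1 * q2) \<noteq> 0" using denom_nonzero \<open>q1 \<noteq> 0\<close> \<open>q2 \<noteq> 0\<close> by simp
    fix s assume s: "poly (L * (q1 * q2)) s \<noteq> 0"
    have "poly N1 s * poly q1 s = poly n1 s * poly L s" "poly N2 s * poly q2 s = poly n2 s * poly L s"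
      using eq' by (metis poly_mult)+
    then have "poly (n1 * q2) s / poly (q1 * q2) s = poly N1 s / poly L s"
      "poly (n2 * q1) s / poly (q1 * q2) s = poly N2 s / poly L s"
      using s by (simp_all add: field_simps)
    then show "poly (clear_denoms (n1 * q2) (n2 * q1) (q1 * q2) (total_degree g) g) s = poly 0 s"
      using s assms(1) by (subst poly_clear_denoms[OF g]) (simp_all add: vanishes_def)
  qed
  then show ?thesis
    using poly_clear_denoms[OF g, of "q1 * q2" t "n1 * q2" "n2 * q1"] nz by (simp add: P)
qed

theorem parametrizes_rational_curve:
  "\<exists>g. rational_curve g \<and> total_degree g \<le> d \<and> rational_parametrization (Fract N1 L, Fract N2 L) g"
proof -
  obtain g where g: "irreducible g" "vanishes g" "\<And>h. vanishes h \<Longrightarrow> g dvd h"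
    using ex_generator by blast
  let ?X = "param_image (Fract N1 L, Fract N2 L)"
  have "zariski_closure2 ?X = {P. eval2 g P = 0}"
  proof (intro equalityI subsetI CollectI)
    fix P assume "P \<in> zariski_closure2 ?X"
    then show "eval2 g P = 0"
      using eval2_param_image[OF g(2)] by (auto simp: zariski_closure2_def)
  next
    fix P assume P: "P \<in> {P. eval2 g P = 0}"
    show "P \<in> zariski_closure2 ?X"
      unfolding zariski_closure2_def
    proof clarify
      fix h assume h: "\<forall>Q\<in>?X. eval2 h Q = 0"
      have "vanishes h"
        using h fract_value_Fract unfolding vanishes_def param_image_def by fastforce
      then have "g dvd h" by (rule g(3))
      then show "eval2 h P = 0" using P by (auto elim!: dvdE simp: eval2_mult)
    qed
  qed
  then have "rational_parametrization (Fract N1 L, Fract N2 L) g"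
    using not_is_constant by (simp add: rational_parametrization_def)
  moreover have "total_degree g \<le> d"
    using g(1,3) by (intro total_degree_generator_le) auto
  ultimately show ?thesis using g(1) by (auto simp: rational_curve_def)
qed

end

section \<open>Specialization of the construction\<close>

lemma Const_0 [simp]: "Const 0 = 0" and Const_1 [simp]: "Const 1 = 1"
  by (simp_all add: Const_def)

lemma lift_const_hom: "comm_ring_hom lift_const"
proof
  show "lift_const (x + y) = lift_const x + lift_const y" "lift_const (x * y) = lift_const x * lift_const y" for x y
    by (simp_all add: lift_const_def Const_def single_add mult_single mult.commute)
  show "lift_const 1 = 1" by (simp add: lift_const_def)
qed (simp add: lift_const_def)

lemma lift_const_0 [simp]: "lift_const 0 = 0" and lift_const_eq_0_iff [simp]: "lift_const c = 0 \<longleftrightarrow> c = 0"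
proof -
  show "lift_const 0 = 0" by (simp add: lift_const_def)
  have "c = 0" if "Const c = 0" using arg_cong[OF that, of "eval_dpoly (\<lambda>_. 0)"] by simp
  then show "lift_const c = 0 \<longleftrightarrow> c = 0" by (auto simp: lift_const_def)
qed

lemma lift_const_1: "lift_const 1 = 1"
  by (simp add: lift_const_def)

lemma poly_map_lift_1:
  "poly (map_poly (map_poly (map_poly lift_const)) H) 1 = map_poly (map_poly lift_const) (poly H 1)"
proof -
  interpret map_poly_comm_ring_hom lift_const
    by (intro map_poly_comm_ring_hom.intro lift_const_hom)
  interpret hom2: map_poly_comm_ring_hom "map_poly lift_const" ..
  show ?thesis
    using comm_semiring_hom.poly_map_poly[OF hom2.comm_semiring_hom_axioms, of H 1]
    unfolding hom2.hom_one .
qed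

text \<open>
  Specialization of the parameters, as a homomorphism from \<open>\<complex>[\<Delta>][t]\<close> to \<open>\<complex>[t]\<close>.
\<close>

abbreviation spec :: "(nat \<Rightarrow> complex) \<Rightarrow> dpoly poly \<Rightarrow> complex poly" where
  "spec \<Delta> \<equiv> map_poly (eval_dpoly \<Delta>)"

lemma spec_hom: "comm_ring_hom (spec \<Delta>)"
proof -
  interpret map_poly_comm_ring_hom "eval_dpoly \<Delta>"
    by (intro map_poly_comm_ring_hom.intro eval_dpoly_hom)
  show ?thesis by (rule comm_ring_hom_axioms)
qed

lemma spec_add: "spec \<Delta> (p + q) = spec \<Delta> p + spec \<Delta> q"
  and spec_mult: "spec \<Delta> (p * q) = spec \<Delta> p * spec \<Delta> q"
  and spec_uminus: "spec \<Delta> (- p) = - spec \<Delta> p"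
  and spec_diff: "spec \<Delta> (p - q) = spec \<Delta> p - spec \<Delta> q"
proof -
  interpret comm_ring_hom "spec \<Delta>" by (rule spec_hom)
  show "spec \<Delta> (p + q) = spec \<Delta> p + spec \<Delta> q" by (rule hom_add)
  show "spec \<Delta> (p * q) = spec \<Delta> p * spec \<Delta> q" by (rule hom_mult)
  show "spec \<Delta> (- p) = - spec \<Delta> p" by (rule hom_uminus)
  show "spec \<Delta> (p - q) = spec \<Delta> p - spec \<Delta> q" by (rule hom_minus)
qed

lemma map_spec_hom: "comm_ring_hom (map_poly (spec \<Delta>))"
proof -
  interpret map_poly_comm_ring_hom "spec \<Delta>"
    by (intro map_poly_comm_ring_hom.intro spec_hom)
  show ?thesis by (rule comm_ring_hom_axioms)
qed

lemma spec_lift_const [simp]: "spec \<Delta> (lift_const c) = [:c:]"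
  by (simp add: lift_const_def poly_eq_iff coeff_map_poly coeff_pCons split: nat.split)

context pencil_resultant
begin

context
  fixes p :: "dpoly poly poly poly" and \<Delta> a b
  assumes p: "tdeg_le m p" "is_pencil (map_poly (map_poly (spec \<Delta>)) p) a b"
    and ab: "tdeg_le m a" "tdeg_le m b" "[:coeff2 a 0 m, coeff2 b 0 m:] \<noteq> 0"
begin

lemma degree_generic: "coeff2 p 0 m \<noteq> 0" "degree p = m"
proof -
  have "spec \<Delta> (coeff2 p 0 m) = [:coeff2 a 0 m, coeff2 b 0 m:]"
    using p(2) by (simp add: is_pencil_def)
  then show "coeff2 p 0 m \<noteq> 0" using ab(3) by auto
  then show "degree p = m" by (rule degree_eq_if_tdeg_le[OF p(1)])
qed

lemma degree_lift_const:
  "tdeg_le n (map_poly (map_poly lift_const) f)" "degree (map_poly (map_poly lift_const) f) = n"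
proof -
  show t: "tdeg_le n (map_poly (map_poly lift_const) f)" using f(1) by (simp add: tdeg_le_def)
  show "degree (map_poly (map_poly lift_const) f) = n"
    by (rule degree_eq_if_tdeg_le[OF t]) (use f(2) in simp)
qed

lemma spec_coeff_resultant:
  "spec \<Delta> (coeff (resultant p (map_poly (map_poly lift_const) f)) k) =
   coeff (resultant (map_poly (map_poly (spec \<Delta>)) p) (lift_t f)) k"
proof -
  have f': "map_poly (map_poly (spec \<Delta>)) (map_poly (map_poly lift_const) f) = lift_t f"
    by (simp add: poly2_eq_iff)
  have "resultant (map_poly (map_poly (spec \<Delta>)) p) (map_poly (map_poly (spec \<Delta>)) (map_poly (map_poly lift_const) f)) =
      map_poly (spec \<Delta>) (resultant p (map_poly (map_poly lift_const) f))"
    by (rule comm_ring_hom.resultant_map_poly[OF map_spec_hom])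
      (simp_all only: f' degree_generic degree_lift_const tdeg_h[OF p(2) ab] tdeg_lift[OF p(2) ab])
  then show ?thesis by (simp add: f' coeff_map_poly)
qed

text \<open>
  The quotient by \<open>A\<close> is \<open>L x + (s - \<alpha> L)\<close> before specialization, and its leading coefficient \<open>L\<close> does not vanish
  under specialization. So the root can be specialized as a fraction.
\<close>

lemma component_specializes:
  assumes A: "lead_coeff A = 1" "degree A + 1 = m * n" "degree A > 0"
    and b: "\<And>\<beta>. poly (top_form n f) \<beta> = 0 \<Longrightarrow> poly (top_form m b) \<beta> \<noteq> 0"
  defines "R \<equiv> resultant (map_poly (map_poly (spec \<Delta>)) p) (lift_t f)"
  shows "specializes_to \<Delta> (linear_root (B_quot (resultant p (map_poly (map_poly lift_const) f)) A))
    (Fract (Polynomial.smult (coeff A (m * n - 2)) (lead a b) - coeff R (m * n - 1)) (lead a b))"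
proof -
  let ?S = "resultant p (map_poly (map_poly lift_const) f)"
  let ?L = "coeff ?S (m * n)" and ?s = "coeff ?S (m * n - 1)" and ?\<alpha> = "coeff A (m * n - 2)"
  have lead: "spec \<Delta> ?L = lead a b"
    unfolding spec_coeff_resultant using p(2) ab by (rule coeff_resultant_lead)
  have L0: "?L \<noteq> 0" using lead degree_lead(2)[OF b, of a] by auto
  obtain e where e: "degree A = e + 1" using A(3) by (metis Suc_eq_plus1 gr0_implies_Suc)
  have mn_e: "m * n = e + 2" "m * n - 1 = e + 1" "m * n - 2 = e" using A(2) e by auto
  have deg_A: "degree (map_poly lift_const A) = e + 1"
    using A(1) e by (subst degree_map_poly) auto
  have "degree ?S \<le> e + 2"
    using resultant_top_coeff(1)[OF p(1) degree_lift_const(1) degree_generic(2) degree_lift_const(2)] mn_e by simp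
  moreover have "lead_coeff (map_poly lift_const A) = 1"
    using A(1) unfolding deg_A coeff_map_poly[of lift_const, OF lift_const_0] e by (simp only: lift_const_1)
  ultimately have "B_quot ?S A = [:coeff ?S (e + 1) - coeff ?S (e + 2) * coeff (map_poly lift_const A) e, coeff ?S (e + 2):]"
    unfolding B_quot_def using deg_A by (intro quotient_by_monic)
  then have "B_quot ?S A = [:?s - ?L * lift_const ?\<alpha>, ?L:]"
    unfolding mn_e(2,3) unfolding mn_e(1) by (simp only: coeff_map_poly[of lift_const, OF lift_const_0])
  then have root: "linear_root (B_quot ?S A) = Fract (- (?s - ?L * lift_const ?\<alpha>)) ?L"
    by (simp only: linear_root_eq[OF L0])
  have s: "spec \<Delta> ?s = coeff R (m * n - 1)" unfolding R_def by (rule spec_coeff_resultant)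
  have num: "spec \<Delta> (- (?s - ?L * lift_const ?\<alpha>)) = Polynomial.smult ?\<alpha> (lead a b) - coeff R (m * n - 1)"
    unfolding spec_uminus spec_diff spec_mult s lead spec_lift_const by simp
  show ?thesis
    unfolding specializes_to_def
  proof (intro exI conjI)
    show "linear_root (B_quot ?S A) = Fract (- (?s - ?L * lift_const ?\<alpha>)) ?L" by (rule root)
    show "spec \<Delta> ?L \<noteq> 0" unfolding lead by (rule degree_lead(2)[OF b])
    show "Fract (Polynomial.smult ?\<alpha> (lead a b) - coeff R (m * n - 1)) (lead a b) =
        Fract (spec \<Delta> (- (?s - ?L * lift_const ?\<alpha>))) (spec \<Delta> ?L)"
      unfolding num lead ..
  qed
qed

end

end

text \<open>
  The form \<open>G\<close> at \<open>z = 1\<close>, with the values of the parameters in any ring.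
\<close>

definition G_affine :: "nat \<Rightarrow> (nat \<Rightarrow> 'a::comm_monoid_add) \<Rightarrow> 'a poly poly" where
  "G_affine d \<delta> =
     (if d = 3 then monom2 (\<delta> 1) 0 1 + monom2 (\<delta> 2) 0 0 + monom2 (\<delta> 3) 1 0
      else monom2 (\<delta> 1) 0 (d - 2) + monom2 (\<delta> 2) 0 (d - 3) + monom2 (\<delta> 3) (d - 2) 0
        + monom2 (\<delta> 4) (d - 3) 0 + monom2 (\<delta> 5) (d - 3) 1 + monom2 (\<delta> 6) 1 (d - 3))"

lemma poly_G_form_1: "poly (G_form d) 1 = G_affine d (\<lambda>k. [:delta k:])"
  by (simp add: G_form_def G_affine_def Let_def poly_monom3_1)

lemma tdeg_le_G_affine: "d > 2 \<Longrightarrow> tdeg_le (d - 2) (G_affine d \<delta>)"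
  unfolding G_affine_def by (simp add: tdeg_le_add tdeg_le_monom2)

lemma coeff2_G_affine_axes:
  "d > 2 \<Longrightarrow> coeff2 (G_affine d \<delta>) 0 (d - 2) = \<delta> 1"
  "d > 2 \<Longrightarrow> coeff2 (G_affine d \<delta>) (d - 2) 0 = \<delta> 3"
  by (auto simp: G_affine_def)

lemma spec_G_affine:
  "spec \<Delta> (coeff2 (G_affine d (\<lambda>k. [:delta k:])) i j) = [:coeff2 (G_affine d \<Delta>) i j:]"
proof -
  have *: "spec \<Delta> (coeff2 (monom2 [:delta k:] i' j') i j) = [:coeff2 (monom2 (\<Delta> k) i' j') i j:]" for k i' j'
    by (simp add: poly_eq_iff coeff_map_poly coeff_pCons split: nat.split)
  have **: "[:x:] + [:y:] = [:x + y:]" for x y :: complex by simp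
  show ?thesis
  proof (cases "d = 3")
    case True
    show ?thesis unfolding G_affine_def if_P[OF True] coeff2_simps(1) spec_add * ** ..
  next
    case False
    show ?thesis unfolding G_affine_def if_not_P[OF False] coeff2_simps(1) spec_add * ** ..
  qed
qed

locale perturbed_pencil =
  fixes f :: "complex poly poly" and d :: nat and H1 H2 :: "complex poly poly poly"
  assumes d: "d > 2" and f: "total_degree f = d"
    and axes: "eval3 (homogenization f) 1 0 0 \<noteq> 0" "eval3 (homogenization f) 0 1 0 \<noteq> 0"
    and H: "homogeneous3 (d - 2) H1" "homogeneous3 (d - 2) H2"
    and infinity: "no_common_point_at_infinity H2 (homogenization f)"
begin

abbreviation "h1 \<equiv> poly H1 1"
abbreviation "h2 \<equiv> poly H2 1"
abbreviation "h \<equiv> poly (H_pert d H1 H2) 1"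

lemma f_coeffs: "tdeg_le d f" "coeff2 f 0 d \<noteq> 0" "coeff2 f d 0 \<noteq> 0"
proof -
  show "tdeg_le d f" using f by (simp flip: total_degree_le_iff)
  show "coeff2 f 0 d \<noteq> 0" "coeff2 f d 0 \<noteq> 0"
    using axes eval3_axes[OF homogeneous3_homogenization[of f]] by (simp_all add: f poly_homogenization_1)
qed

sublocale x: pencil_resultant "d - 2" d f
  using d f_coeffs by unfold_locales auto

sublocale y: pencil_resultant "d - 2" d "swap_vars f"
  using d f_coeffs by unfold_locales (auto simp: tdeg_le_swap_vars)

lemma top_h2_nonzero:
  assumes "poly (top_form d f) \<beta> = 0"
  shows "poly (top_form (d - 2) h2) \<beta> \<noteq> 0"
proof
  assume "poly (top_form (d - 2) h2) \<beta> = 0"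
  then have "eval3 H2 1 \<beta> 0 = 0" by (simp add: poly_top_form_at_infinity[OF H(2)])
  moreover have "eval3 (homogenization f) 1 \<beta> 0 = 0"
    using assms poly_top_form_at_infinity[OF homogeneous3_homogenization[of f], of \<beta>]
    by (simp add: f poly_homogenization_1)
  moreover have "(1 :: complex, \<beta>) \<noteq> (0, 0)" by simp
  ultimately show False using infinity unfolding no_common_point_at_infinity_def by blast
qed

lemma top_swapped_h2_nonzero:
  assumes "poly (top_form d (swap_vars f)) \<beta> = 0"
  shows "poly (top_form (d - 2) (swap_vars h2)) \<beta> \<noteq> 0"
proof -
  have "\<beta> \<noteq> 0"
  proof
    assume "\<beta> = 0"
    then show False using assms f_coeffs by (simp add: poly_0_coeff_0 coeff_top_form del: coeff_0)
  qed
  then have "poly (top_form d f) (inverse \<beta>) = 0"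
    using assms poly_top_form_swap_vars[of "inverse \<beta>" d f] by simp
  then have "poly (top_form (d - 2) h2) (inverse \<beta>) \<noteq> 0" by (rule top_h2_nonzero)
  then show ?thesis
    using poly_top_form_swap_vars[of "inverse \<beta>" "d - 2" h2] \<open>\<beta> \<noteq> 0\<close> by simp
qed

lemma coeff2_h:
  "coeff2 h i j = lift_const (coeff2 h1 i j) + monom 1 1 * lift_const (coeff2 h2 i j)
     + coeff2 (G_affine d (\<lambda>k. [:delta k:])) i j"
proof -
  have c: "poly (monom3 c 0 0 0 * X) 1 = Polynomial.smult [:c:] (poly X 1)" for c :: "dpoly poly" and X
    by (simp add: monom3_def monom_0)
  have s: "coeff2 (Polynomial.smult [:c:] X) i j = c * coeff2 X i j" for c :: "dpoly poly" and X
    by (simp add: coeff2_def)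
  show ?thesis
    unfolding H_pert_def poly_add c poly_map_lift_1 poly_G_form_1 coeff2_simps(1) s
    by simp
qed

lemma tdeg_le_affine: "tdeg_le (d - 2) h1" "tdeg_le (d - 2) h2"
  using H by (simp_all add: tdeg_le_poly_1)

lemma tdeg_le_h: "tdeg_le (d - 2) h"
  unfolding tdeg_le_def
proof (intro allI impI)
  fix i j assume "coeff2 h i j \<noteq> 0"
  then have "coeff2 h1 i j \<noteq> 0 \<or> coeff2 h2 i j \<noteq> 0 \<or> coeff2 (G_affine d (\<lambda>k. [:delta k:])) i j \<noteq> 0"
    unfolding coeff2_h by auto
  then show "i + j \<le> d - 2"
    using tdeg_le_affine tdeg_le_G_affine[OF d] unfolding tdeg_le_def by blast
qed

lemma is_pencil_h: "is_pencil (map_poly (map_poly (spec \<Delta>)) h) (h1 + G_affine d \<Delta>) h2"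
proof -
  have "spec \<Delta> (monom 1 1) = monom 1 1"
    by (simp add: map_poly_monom eval_dpoly_1)
  moreover have "monom 1 1 * [:c:] = [:0, c:]" for c :: complex
    by (simp add: monom_altdef)
  ultimately have "spec \<Delta> (coeff2 h i j) = [:coeff2 h1 i j:] + [:0, coeff2 h2 i j:] + [:coeff2 (G_affine d \<Delta>) i j:]" for i j
    unfolding coeff2_h spec_add spec_mult spec_G_affine spec_lift_const by simp
  then show ?thesis
    by (simp add: is_pencil_def add.commute)
qed

lemma tdeg_le_specialized: "tdeg_le (d - 2) (h1 + G_affine d \<Delta>)"
  by (rule tdeg_le_mono[OF _ tdeg_le_affine(1) tdeg_le_G_affine[OF d]]) auto

lemma S1_eq: "S1 f d H1 H2 = resultant h (map_poly (map_poly lift_const) f)"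
  by (simp add: S1_def)

lemma S2_eq: "S2 f d H1 H2 = resultant (swap_vars h) (map_poly (map_poly lift_const) (swap_vars f))"
  by (simp add: S2_def map_swap_vars)

text \<open>
  The coefficients of \<open>y\<^sup>d\<^sup>-\<^sup>2\<close> and \<open>x\<^sup>d\<^sup>-\<^sup>2\<close> in the constant term of the pencil do not vanish. Then the moving curve
  keeps its degree in \<open>y\<close> and \<open>x\<close>, and the two resultants commute with specialization.
\<close>

definition preserves_degrees :: "(nat \<Rightarrow> complex) \<Rightarrow> bool" where
  "preserves_degrees \<Delta> \<longleftrightarrow> coeff2 h1 0 (d - 2) + \<Delta> 1 \<noteq> 0 \<and> coeff2 h1 (d - 2) 0 + \<Delta> 3 \<noteq> 0"

abbreviation "N \<equiv> (d - 2) * d"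

definition spec_S1 :: "(nat \<Rightarrow> complex) \<Rightarrow> complex poly poly" where
  "spec_S1 \<Delta> = resultant (map_poly (map_poly (spec \<Delta>)) h) (lift_t f)"

definition nonproportional :: "(nat \<Rightarrow> complex) \<Rightarrow> bool" where
  "nonproportional \<Delta> \<longleftrightarrow> (\<forall>c. coeff (spec_S1 \<Delta>) (N - 1) \<noteq> Polynomial.smult c (coeff (spec_S1 \<Delta>) N))"

text \<open>
  With the factor \<open>\<kappa>\<close> of \<open>lead_swap_vars\<close>, both components become fractions over the leading coefficient of \<open>S\<^sub>1\<close>.
\<close>

lemma specialized_parametrization:
  assumes \<Delta>: "preserves_degrees \<Delta>" "nonproportional \<Delta>" and r: "eps_rational d s r"
  shows "\<exists>\<phi>1 \<phi>2. specializes_to \<Delta> (fst (P_Delta f d s Q r P H1 H2)) \<phi>1 \<and>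
      specializes_to \<Delta> (snd (P_Delta f d s Q r P H1 H2)) \<phi>2 \<and>
      (\<exists>g. rational_curve g \<and> total_degree g \<le> d \<and> rational_parametrization (\<phi>1, \<phi>2) g)"
proof -
  let ?a = "h1 + G_affine d \<Delta>"
  define A1 A2 where "A1 = A_poly fst d s Q r P" and "A2 = A_poly snd d s Q r P"
  have N: "N \<ge> 2" using mult_le_mono[of 1 "d - 2" 2 d] d by simp
  have A1: "lead_coeff A1 = 1" "degree A1 + 1 = N" and A2: "lead_coeff A2 = 1" "degree A2 + 1 = N"
    using monic_A_poly(1) degree_A_poly[OF r d] by (simp_all add: A1_def A2_def)
  then have A_pos: "degree A1 > 0" "degree A2 > 0" using N by linarith+
  \<comment> \<open>The coefficients of \<open>y\<^sup>d\<^sup>-\<^sup>2\<close> and \<open>x\<^sup>d\<^sup>-\<^sup>2\<close> in the specialized pencil, as polynomials in \<open>t\<close>.\<close>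
  have ax: "[:coeff2 ?a 0 (d - 2), coeff2 h2 0 (d - 2):] \<noteq> 0"
    and ay: "[:coeff2 (swap_vars ?a) 0 (d - 2), coeff2 (swap_vars h2) 0 (d - 2):] \<noteq> 0"
    using \<Delta>(1) by (simp_all add: preserves_degrees_def coeff2_G_affine_axes[OF d])
  define Ry where "Ry = resultant (map_poly (map_poly (spec \<Delta>)) (swap_vars h)) (lift_t (swap_vars f))"
  let ?Lx = "x.lead ?a h2" and ?Ly = "y.lead (swap_vars ?a) (swap_vars h2)"
  note px = is_pencil_h[of \<Delta>] and tx = tdeg_le_specialized[of \<Delta>] tdeg_le_affine(2)
  have py: "is_pencil (map_poly (map_poly (spec \<Delta>)) (swap_vars h)) (swap_vars ?a) (swap_vars h2)"
    using px by (simp add: is_pencil_def)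
  have ty: "tdeg_le (d - 2) (swap_vars ?a)" "tdeg_le (d - 2) (swap_vars h2)"
    using tx by (simp_all add: tdeg_le_swap_vars)
  have th: "tdeg_le (d - 2) (swap_vars h)" using tdeg_le_h by (simp add: tdeg_le_swap_vars)
  let ?Nx = "Polynomial.smult (coeff A1 (N - 2)) ?Lx - coeff (spec_S1 \<Delta>) (N - 1)"
  let ?Ny = "Polynomial.smult (coeff A2 (N - 2)) ?Ly - coeff Ry (N - 1)"
  have s1: "specializes_to \<Delta> (fst (P_Delta f d s Q r P H1 H2)) (Fract ?Nx ?Lx)"
    unfolding P_Delta_def fst_conv S1_eq A1_def[symmetric] spec_S1_def
    by (rule x.component_specializes[OF tdeg_le_h px tx ax A1 A_pos(1) top_h2_nonzero])
  have s2: "specializes_to \<Delta> (snd (P_Delta f d s Q r P H1 H2)) (Fract ?Ny ?Ly)"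
    unfolding P_Delta_def snd_conv S2_eq A2_def[symmetric] Ry_def
    by (rule y.component_specializes[OF th py ty ay A2 A_pos(2) top_swapped_h2_nonzero])
  obtain \<kappa> where \<kappa>: "\<kappa> \<noteq> 0" "?Ly = Polynomial.smult \<kappa> ?Lx"
    using lead_swap_vars[OF x.pencil_resultant_axioms y.pencil_resultant_axioms] by blast
  have Lx: "degree ?Lx = d" "?Lx \<noteq> 0" using x.degree_lead[OF top_h2_nonzero] by auto
  let ?Ny' = "Polynomial.smult (inverse \<kappa>) ?Ny"
  have "Fract ?Ny ?Ly = Fract ?Ny' ?Lx"
    using \<kappa> Lx(2) by (simp add: eq_fract)
  moreover have "rational_pair ?Nx ?Ny' ?Lx d"
  proof
    show "degree ?Nx \<le> d"
      using x.degree_coeff_resultant[OF px tx ax] Lx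
      by (intro degree_diff_le) (auto simp: spec_S1_def intro: order.trans[OF degree_smult_le])
    have "degree ?Ny \<le> d"
      using y.degree_coeff_resultant[OF py ty ay] Lx \<kappa>
      by (intro degree_diff_le) (auto simp: Ry_def intro: order.trans[OF degree_smult_le])
    then show "degree ?Ny' \<le> d" by (rule order.trans[OF degree_smult_le])
    show "degree ?Lx \<le> d" "?Lx \<noteq> 0" using Lx by auto
    fix c show "?Nx \<noteq> Polynomial.smult c ?Lx"
    proof
      assume "?Nx = Polynomial.smult c ?Lx"
      then have "coeff (spec_S1 \<Delta>) (N - 1) = Polynomial.smult (coeff A1 (N - 2) - c) ?Lx"
        by (simp add: smult_diff_left algebra_simps)
      also have "?Lx = coeff (spec_S1 \<Delta>) N"
        unfolding spec_S1_def by (rule x.coeff_resultant_lead[OF px tx ax, symmetric])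
      finally show False using \<Delta>(2) unfolding nonproportional_def by blast
    qed
  qed
  then have "\<exists>g. rational_curve g \<and> total_degree g \<le> d \<and>
      rational_parametrization (Fract ?Nx ?Lx, Fract ?Ny' ?Lx) g"
    by (rule rational_pair.parametrizes_rational_curve)
  ultimately show ?thesis using s1 s2 by metis
qed

text \<open>
  All parameters are \<open>0\<close> except those of \<open>y\<^sup>d\<^sup>-\<^sup>2\<close>, \<open>x\<^sup>d\<^sup>-\<^sup>2\<close> and \<open>x\<^sup>d\<^sup>-\<^sup>3 z\<close>. The last is \<open>\<delta>\<^sub>4\<close> in general; for
  \<open>d = 3\<close> it is \<open>\<delta>\<^sub>2\<close>, because then \<open>x\<^sup>d\<^sup>-\<^sup>3 z = z\<close>.
\<close>

lemma ex_preserving_nonproportional_parameters: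
  obtains \<Delta> where "\<Delta> \<in> affine_space (num_params d)" "preserves_degrees \<Delta>" "nonproportional \<Delta>"
proof -
  \<comment> \<open>The total coefficient of \<open>y\<^sup>d\<^sup>-\<^sup>2\<close> becomes \<open>1 + t c\<close> for some \<open>c\<close>, which is never the zero polynomial.\<close>
  define u where "u = 1 - coeff2 h1 0 (d - 2)"
  define e :: nat where "e = (if d = 3 then 2 else 4)"
  define D where "D \<mu> \<nu> = (\<lambda>k. if k \<in> {1..num_params d} then
      (if k = 1 then u else if k = 3 then \<mu> else if k = e then \<nu> else 0) else undefined)" for \<mu> \<nu> :: complex
  let ?a = "h1 + monom2 u 0 (d - 2)"
  have G: "h1 + G_affine d (D \<mu> \<nu>) = ?a + [:monom \<mu> (d - 2) + monom \<nu> (d - 2 - 1):]" for \<mu> \<nu>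
  proof -
    have "monom2 (0 :: complex) i j = 0" for i j by (simp add: monom2_def)
    moreover have "d - 2 - 1 = d - 3" by simp
    ultimately show ?thesis
      by (simp add: G_affine_def D_def e_def num_params_def) (simp add: monom2_def monom_0)
  qed
  have ta: "tdeg_le (d - 2) ?a"
    by (rule tdeg_le_mono[OF _ tdeg_le_affine(1), of _ "monom2 u 0 (d - 2)"]) (auto simp: tdeg_le_def split: if_splits)
  have na: "[:coeff2 ?a 0 (d - 2), coeff2 h2 0 (d - 2):] \<noteq> 0" by (simp add: u_def)
  have fin: "finite {- coeff2 h1 (d - 2) 0}" by simp
  have const: "is_pencil (map_poly (map_poly (spec (D \<mu> \<nu>))) h) (?a + [:monom \<mu> (d - 2) + monom \<nu> (d - 2 - 1):]) h2" for \<mu> \<nu>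
    using is_pencil_h[of "D \<mu> \<nu>"] unfolding G .
  obtain \<mu> \<nu> where \<mu>: "\<mu> \<notin> {- coeff2 h1 (d - 2) 0}"
    and np: "\<And>c. coeff (resultant (map_poly (map_poly (spec (D \<mu> \<nu>))) h) (lift_t f)) (N - 1) \<noteq>
       Polynomial.smult c (coeff (resultant (map_poly (map_poly (spec (D \<mu> \<nu>))) h) (lift_t f)) N)"
  proof (rule x.ex_nonproportional[OF ta tdeg_le_affine(2) na top_h2_nonzero fin const], assumption, goal_cases)
    case (1 \<mu> \<nu>)
    show ?case by (rule 1(1)[OF 1(2,3)])
  qed
  have "D \<mu> \<nu> \<in> affine_space (num_params d)"
    by (auto simp: affine_space_def D_def)
  moreover have "preserves_degrees (D \<mu> \<nu>)"
    using \<mu> by (auto simp: preserves_degrees_def D_def u_def num_params_def add_eq_0_iff2)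
  moreover have "nonproportional (D \<mu> \<nu>)" using np by (simp add: nonproportional_def spec_S1_def)
  ultimately show ?thesis by (rule that)
qed

text \<open>
  The leading coefficient has degree \<open>d\<close> in \<open>t\<close>. So the two coefficients are proportional iff all the minors of their
  columns \<open>k\<close> and \<open>d\<close> vanish; one \<open>k\<close> for which the minor does not vanish at a single point defines the set.
\<close>

lemma ex_zariski_open:
  obtains \<Omega> where "zariski_open (num_params d) \<Omega>" "\<Omega> \<noteq> {}" "\<And>\<Delta>. \<Delta> \<in> \<Omega> \<Longrightarrow> preserves_degrees \<Delta> \<and> nonproportional \<Delta>"
proof -
  let ?S = "S1 f d H1 H2"
  let ?V = "affine_space (num_params d)"
  have eval_S1: "eval_dpoly \<Delta> (coeff (coeff ?S k) i) = coeff (coeff (spec_S1 \<Delta>) k) i" if "preserves_degrees \<Delta>" for \<Delta> k i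
  proof -
    have "[:coeff2 (h1 + G_affine d \<Delta>) 0 (d - 2), coeff2 h2 0 (d - 2):] \<noteq> 0"
      using that by (simp add: preserves_degrees_def coeff2_G_affine_axes[OF d])
    from x.spec_coeff_resultant[OF tdeg_le_h is_pencil_h tdeg_le_specialized tdeg_le_affine(2) this, of k]
    have "coeff (spec \<Delta> (coeff ?S k)) i = coeff (coeff (spec_S1 \<Delta>) k) i" by (simp add: S1_eq spec_S1_def)
    then show ?thesis by (simp add: coeff_map_poly)
  qed
  obtain \<Delta>0 where \<Delta>0: "\<Delta>0 \<in> ?V" "preserves_degrees \<Delta>0" "nonproportional \<Delta>0" by (rule ex_preserving_nonproportional_parameters)
  let ?s = "\<lambda>\<Delta>. coeff (coeff (spec_S1 \<Delta>) (N - 1))" and ?l = "\<lambda>\<Delta>. coeff (coeff (spec_S1 \<Delta>) N)"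
  have l: "?l \<Delta>0 d \<noteq> 0"
  proof -
    have "[:coeff2 (h1 + G_affine d \<Delta>0) 0 (d - 2), coeff2 h2 0 (d - 2):] \<noteq> 0"
      using \<Delta>0(2) by (simp add: preserves_degrees_def coeff2_G_affine_axes[OF d])
    from x.coeff_resultant_lead[OF is_pencil_h tdeg_le_specialized tdeg_le_affine(2) this]
    show ?thesis
      using x.degree_lead[OF top_h2_nonzero, of "h1 + G_affine d \<Delta>0"] unfolding spec_S1_def
      by (metis leading_coeff_0_iff)
  qed
  have "\<exists>k. ?s \<Delta>0 k * ?l \<Delta>0 d \<noteq> ?s \<Delta>0 d * ?l \<Delta>0 k"
  proof (rule ccontr)
    assume "\<not> ?thesis"
    then have "coeff (spec_S1 \<Delta>0) (N - 1) = Polynomial.smult (?s \<Delta>0 d / ?l \<Delta>0 d) (coeff (spec_S1 \<Delta>0) N)"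
      using l by (simp add: poly_eq_iff field_simps)
    then show False using \<Delta>0(3) by (simp add: nonproportional_def)
  qed
  then obtain k where k: "?s \<Delta>0 k * ?l \<Delta>0 d \<noteq> ?s \<Delta>0 d * ?l \<Delta>0 k" by blast
  define p where "p = (Const (coeff2 h1 0 (d - 2)) + delta 1) * (Const (coeff2 h1 (d - 2) 0) + delta 3) *
     (coeff (coeff ?S (N - 1)) k * coeff (coeff ?S N) d - coeff (coeff ?S (N - 1)) d * coeff (coeff ?S N) k)"
  have p: "eval_dpoly \<Delta> p \<noteq> 0 \<longleftrightarrow> preserves_degrees \<Delta> \<and> ?s \<Delta> k * ?l \<Delta> d \<noteq> ?s \<Delta> d * ?l \<Delta> k" for \<Delta>
  proof -
    show ?thesis
      using eval_S1[of \<Delta>] unfolding p_def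
      by (auto simp: eval_dpoly_mult eval_dpoly_add eval_dpoly_diff preserves_degrees_def)
  qed
  obtain p' where p': "\<forall>\<mu>\<in>Poly_Mapping.keys p'. Poly_Mapping.keys \<mu> \<subseteq> {1..num_params d}"
    "\<forall>\<Delta>\<in>?V. eval_dpoly \<Delta> p' = eval_dpoly \<Delta> p"
    using ex_dpoly_in_params by blast
  define \<Omega> where "\<Omega> = {\<Delta> \<in> ?V. eval_dpoly \<Delta> p' \<noteq> 0}"
  have "zariski_open (num_params d) \<Omega>"
    unfolding zariski_open_def \<Omega>_def using p'(1) by (intro exI[of _ "{p'}"]) auto
  moreover have "\<Delta>0 \<in> \<Omega>" using \<Delta>0 k p' p by (simp add: \<Omega>_def)
  moreover have "preserves_degrees \<Delta> \<and> nonproportional \<Delta>" if "\<Delta> \<in> \<Omega>" for \<Delta>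
  proof -
    have *: "preserves_degrees \<Delta>" "?s \<Delta> k * ?l \<Delta> d \<noteq> ?s \<Delta> d * ?l \<Delta> k"
      using that p' p by (auto simp: \<Omega>_def)
    then show ?thesis by (auto simp: nonproportional_def)
  qed
  ultimately show ?thesis by (intro that) auto
qed

end

section \<open>The parametrization theorem\<close>

theorem theorem4p4:
  fixes \<epsilon> \<eta> :: real
    and f :: "complex poly poly"
    and d s :: nat
    and V :: "nat \<Rightarrow> (nat \<times> nat) set"
    and A :: "nat \<Rightarrow> (complex \<times> complex) set"
    and Q Q' P P' :: "nat \<Rightarrow> complex \<times> complex"
    and r :: "nat \<Rightarrow> nat"
    and X :: "(complex \<times> complex) set"
    and H1 H2 H2' :: "complex poly poly poly"
    and \<rho>1 \<rho>2 :: complex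
  assumes eps: "0 < \<epsilon>" "\<epsilon> < 1"
    and real: "real_poly2 f"
    and irred: "eps_irreducible \<epsilon> f"
    and deg: "proper_degree \<epsilon> f d" "d > 2"
    and smooth_infinity: "no_singularity_at_infinity f"
    and axes: "eval3 (homogenization f) 1 0 0 \<noteq> 0" "eval3 (homogenization f) 0 1 0 \<noteq> 0"
    and solutions: "solution_data \<epsilon> f V A"
    and clusters: "cluster_decomposition \<epsilon> f (eps_sing \<epsilon> f A) s Q r"
    and rational: "eps_rational d s r"
    and simple_points: "\<forall>j\<in>{1..d - 3}. eps_simple \<epsilon> f (P j)"
    \<comment> \<open>The modifications allowed in the text: further simple points \<open>X\<close>, perturbed points \<open>Q', P'\<close> and
      perturbed \<open>H2\<close>. The statement is for every bound \<open>\<eta>\<close> on the size of the perturbations, and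
      \<open>\<eta> = 0\<close>, \<open>X = {}\<close> is the unmodified construction.\<close>
    and extra_points: "finite X" "\<forall>R\<in>X. eps_simple \<epsilon> f R"
    and perturbed_points: "\<forall>i\<in>{1..s}. norm (Q' i - Q i) \<le> \<eta>" "\<forall>j\<in>{1..d - 3}. norm (P' j - P j) \<le> \<eta>"
    and pencil: "pencil (linear_system (d - 2) s Q' r (P' ` {1..d - 3} \<union> X)) H1 H2'"
    and perturbed_H2: "H2 = H2' + monom3 \<rho>1 (d - 2) 0 0 + monom3 \<rho>2 0 (d - 2) 0"
      "cmod \<rho>1 \<le> \<eta>" "cmod \<rho>2 \<le> \<eta>"
    and infinity_H2: "no_common_point_at_infinity H2 (homogenization f)"
  shows "\<exists>\<Omega>. zariski_open (num_params d) \<Omega> \<and> \<Omega> \<noteq> {} \<and>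
    (\<forall>\<Delta>0\<in>\<Omega>. \<exists>\<phi>1 \<phi>2.
       specializes_to \<Delta>0 (fst (P_Delta f d s Q' r P' H1 H2)) \<phi>1 \<and>
       specializes_to \<Delta>0 (snd (P_Delta f d s Q' r P' H1 H2)) \<phi>2 \<and>
       (\<exists>g. rational_curve g \<and> total_degree g \<le> d \<and>
            rational_parametrization (\<phi>1, \<phi>2) g))"
proof -
  have "homogeneous3 (d - 2) H2"
    unfolding perturbed_H2(1) using pencil_homogeneous(2)[OF pencil]
    by (intro homogeneous3_add homogeneous3_monom3) auto
  then interpret perturbed_pencil f d H1 H2
    using deg axes pencil_homogeneous(1)[OF pencil] infinity_H2
    by unfold_locales (auto simp: proper_degree_def)
  obtain \<Omega> where \<Omega>: "zariski_open (num_params d) \<Omega>" "\<Omega> \<noteq> {}"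
    and "\<And>\<Delta>. \<Delta> \<in> \<Omega> \<Longrightarrow> preserves_degrees \<Delta> \<and> nonproportional \<Delta>"
    by (rule ex_zariski_open) blast
  then show ?thesis
    using specialized_parametrization[OF _ _ rational] by (intro exI[of _ \<Omega>]) blast
qed

end
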